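(* Let $\lambda>0$, $f\in C_b(X)$ and let $u=R(\lambda,L)f$, that is $u(x)=\int_0^\infty e^{-\lambda t}P_tf(x)\,dt$. Then: (i) If $1/\theta=k\in\mathbb{N}$, then $u\in Z^k_H(X)$, and there exists $C=C(\lambda)>0$, independent of $f$, such that $\|u\|_{Z^k_H(X)}\le C\|f\|_\infty$. (ii) If $\alpha\in(0,1)$ and $\alpha+1/\theta=k\in\mathbb{N}$, then for every $f\in C^\alpha_H(X)$ the function $u$ belongs to $Z^k_H(X)$, and there exists $C=C(\lambda,\alpha)>0$, independent of $f$, such that $\|u\|_{Z^k_H(X)}\le C\|f\|_{C^\alpha_H(X)}$.
   Context: Setting. $X$ is a real separable Banach space; for Banach spaces, $H\subset X$ means that $H$ is contained in $X$ with continuous embedding. For a Banach space $Y$, $C_b(X;Y)$ is the space of bounded functions $X\to Y$ that are continuous with respect to the norm of $Y$, with the sup norm $\|\cdot\|_\infty$; $C_b(X)=C_b(X;\mathbb{R})$. $(T_t)_{t\ge0}$ is a strongly continuous semigroup of bounded linear operators on $X$, and $(\mu_t)_{t\ge0}$ are Borel probability measures on $X$ with $\mu_0=\delta_0$, $t\mapsto\mu_t$ weakly continuous on $[0,\infty)$, and $\mu_{t+s}=(\mu_t\circ T_s^{-1})*\mu_s$ for $t,s>0$. The generalized Mehler semigroup is $P_tf(x)=\int_Xf(T_tx+y)\,\mu_t(dy)$, $t\ge0$. Its generator $L$ is the unique closed operator in $C_b(X)$ whose resolvent is $R(\lambda,L)f(x)=\int_0^\infty e^{-\lambda t}P_tf(x)\,dt$,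 $\lambda>0$, $f\in C_b(X)$, $x\in X$. Fomin differentiability. A Borel probability measure $\mu$ on $X$ is Fomin differentiable along $v\in X$ if $\lim_{t\to0}(\mu(A+tv)-\mu(A))/t$ exists and is finite for every Borel set $A$. The limit is then a signed measure $d_v\mu$, absolutely continuous with respect to $\mu$, with density $\beta^\mu_v\in L^1(X,\mu)$. Equivalently, there is $\beta^\mu_v\in L^1(X,\mu)$ with $\int_X\frac{\partial f}{\partial v}\,d\mu=-\int_X\beta^\mu_vf\,d\mu$ for all $f\in C^1_b(X)$ (the space $C^1_H(X)$ defined below, with $H=X$). Standing hypotheses. (1) For every $t>0$ there is a subspace $\{0\}\ne H_t\subset X$ such that $\mu_t$ is Fomin differentiable along every $h\in H_t$. (2) There exist a Banach space $H\subset X$ and constants $M,C,\theta>0$, $\omega\in\mathbb{R}$ such that for all $t>0$, $h\in H$: $T_t(H)\subset H$ and $\|T_th\|_H\le Me^{\omega t}\|h\|_H$; $T_t(H)\subset H_t$ and $\|\beta^{\mu_t}_{T_th}\|_{L^1(X,\mu_t)}\le Ce^{\omega t}t^{-\theta}\|h\|_H$. Function spaces. For a Banach space $Y$, $F:X\to Y$ is $H$-Gateaux differentiable at $x$ if $\partial F/\partial h(x)=\lim_{t\to0}(F(x+th)-F(x))/t$ exists for all $h\in H$ and $D_HF(x):h\mapsto\partial F/\partial h(x)$ belongs to the space $\mathcal{L}(H,Y)$ of bounded linear operators. $\mathcal{L}^n(H)$ is the space of continuous $n$-linear maps $H^n\to\mathbb{R}$ with norm $\|T\|_{\mathcal{L}^n(H)}=\sup\{|T(h_1,\dots,h_n)|/(\|h_1\|_H\cdots\|h_n\|_H):h_i\in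 H\setminus\{0\}\}$, identified with $\mathcal{L}(H,\mathcal{L}^{n-1}(H))$; $D^n_Hf(x)\in\mathcal{L}^n(H)$ is the $H$-Gateaux derivative at $x$ of $D^{n-1}_Hf:X\to\mathcal{L}^{n-1}(H)$. $C^n_H(X)$ ($n\in\mathbb{N}=\{1,2,\dots\}$) is the set of $f\in C_b(X)$ having $H$-Gateaux derivatives up to order $n$ at every point such that $x\mapsto D^k_Hf(x)(h_1,\dots,h_k)$ is continuous and bounded for all $k\le n$ and $h_i\in H$, with norm $\|f\|_\infty+\sum_{k=1}^n\sup_x\|D^k_Hf(x)\|_{\mathcal{L}^k(H)}$. For $\alpha\in(0,1)$, $C^\alpha_H(X)=\{f\in C_b(X):[f]_{C^\alpha_H(X)}:=\sup_{x\in X,h\in H\setminus\{0\}}|f(x+h)-f(x)|/\|h\|_H^\alpha<\infty\}$ with norm $\|f\|_\infty+[f]_{C^\alpha_H(X)}$. For a Banach space $Y$, $Z^1_H(X,Y)=\{F\in C_b(X;Y):[F]_{Z^1_H(X,Y)}:=\sup_{x\in X,h\in H\setminus\{0\}}\|F(x+2h)-2F(x+h)+F(x)\|_Y/\|h\|_H<\infty\}$ with norm $\|F\|_\infty+[F]_{Z^1_H(X,Y)}$, and $Z^1_H(X)=Z^1_H(X,\mathbb{R})$. For $n\ge2$, $Z^n_H(X)=\{f\in C^{n-1}_H(X):D^{n-1}_Hf\in Z^1_H(X,\mathcal{L}^{n-1}(H))\}$ with norm $\|f\|_{C^{n-1}_H(X)}+[D^{n-1}_Hf]_{Z^1_H(X,\mathcal{L}^{n-1}(H))}$.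 *)

theory Defs
  imports "HOL-Probability.Probability"
begin

section \<open>Generalized Mehler semigroups\<close>

text \<open>The last assumption is \<open>\<mu>\<^sub>t\<^sub>+\<^sub>s = (\<mu>\<^sub>t \<circ> T\<^sub>s\<inverse>) * \<mu>\<^sub>s\<close>, with the convolution written out because
  the library constant \<open>convolution\<close> is restricted to Euclidean spaces.\<close>

locale generalized_mehler =
  fixes T :: "real \<Rightarrow> 'a::{banach,second_countable_topology} \<Rightarrow>\<^sub>L 'a"
    and \<mu> :: "real \<Rightarrow> 'a measure"
  assumes T_zero: "T 0 = id_blinfun"
    and T_add: "\<And>s t. 0 \<le> s \<Longrightarrow> 0 \<le> t \<Longrightarrow> T (s + t) = T s o\<^sub>L T t"
    and T_strongly_continuous: "\<And>x. continuous_on {0..} (\<lambda>t. T t x)"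
    and prob_space_mu: "\<And>t. 0 \<le> t \<Longrightarrow> prob_space (\<mu> t)"
    and sets_mu: "\<And>t. 0 \<le> t \<Longrightarrow> sets (\<mu> t) = sets borel"
    and mu_zero: "\<mu> 0 = return borel 0"
    and mu_weakly_continuous:
      "\<And>f. f \<in> bcontfun \<Longrightarrow> continuous_on {0..} (\<lambda>t. LINT y|\<mu> t. (f y :: real))"
    and mu_skew_convolution: "\<And>s t. 0 < s \<Longrightarrow> 0 < t \<Longrightarrow>
      \<mu> (t + s) = distr (distr (\<mu> t) borel (T s) \<Otimes>\<^sub>M \<mu> s) borel (\<lambda>(x, y). x + y)"

definition mehler :: "(real \<Rightarrow> 'a::{banach,second_countable_topology} \<Rightarrow>\<^sub>L 'a) \<Rightarrow> (real \<Rightarrow> 'a measure)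
    \<Rightarrow> real \<Rightarrow> ('a \<Rightarrow> real) \<Rightarrow> 'a \<Rightarrow> real" where
  "mehler T \<mu> t f x = (LINT y|\<mu> t. f (T t x + y))"

text \<open>The resolvent \<open>R(\<lambda>, L)\<close>, \<open>\<lambda> > 0\<close>, of the generator \<open>L\<close>; it is the resolvent that defines \<open>L\<close>.\<close>

definition mehler_resolvent ::
  "(real \<Rightarrow> 'a::{banach,second_countable_topology} \<Rightarrow>\<^sub>L 'a) \<Rightarrow> (real \<Rightarrow> 'a measure)
    \<Rightarrow> real \<Rightarrow> ('a \<Rightarrow> real) \<Rightarrow> 'a \<Rightarrow> real" where
  "mehler_resolvent T \<mu> lam f x = (LINT t:{0..}|lborel. exp (- lam * t) * mehler T \<mu> t f x)"


section \<open>Fomin differentiability\<close>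

definition fomin_quotient :: "'a::real_normed_vector measure \<Rightarrow> 'a \<Rightarrow> 'a set \<Rightarrow> real \<Rightarrow> real" where
  "fomin_quotient m v A t = (measure m ((\<lambda>y. y + t *\<^sub>R v) ` A) - measure m A) / t"

definition fomin_differentiable :: "'a::real_normed_vector measure \<Rightarrow> 'a \<Rightarrow> bool" where
  "fomin_differentiable m v \<longleftrightarrow> (\<forall>A\<in>sets borel. \<exists>l. (fomin_quotient m v A \<longlongrightarrow> l) (at 0))"

text \<open>\<open>\<beta>\<close> is a version of the density \<open>\<beta>\<^sup>m\<^sub>v\<close> of \<open>d\<^sub>v m\<close> with respect to \<open>m\<close>.\<close>

definition fomin_density :: "'a::real_normed_vector measure \<Rightarrow> 'a \<Rightarrow> ('a \<Rightarrow> real) \<Rightarrow> bool" where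
  "fomin_density m v \<beta> \<longleftrightarrow> integrable m \<beta> \<and>
     (\<forall>A\<in>sets borel. (fomin_quotient m v A \<longlongrightarrow> (LINT y:A|m. \<beta> y)) (at 0))"


section \<open>Multilinear forms\<close>

text \<open>The order \<open>n\<close> varies inside the definitions below, so \<open>\<L>\<^sup>n(H)\<close> is a set rather than a type: an
  \<open>n\<close>-linear form is a function on argument lists, extended by \<open>0\<close> to lists of length \<open>\<noteq> n\<close>.
  Continuity is expressed, as for \<open>bounded_linear\<close>, by finiteness of the norm. \<open>\<L>\<^sup>0(H)\<close> is \<open>\<real>\<close>.
  All norms and seminorms take values in \<open>ennreal\<close>, so that suprema are never junk values.\<close>

definition form_norm :: "nat \<Rightarrow> ('h::real_normed_vector list \<Rightarrow> real) \<Rightarrow> ennreal" where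
  "form_norm n \<phi> = (SUP hs\<in>{hs. length hs = n \<and> 0 \<notin> set hs}.
     ennreal (\<bar>\<phi> hs\<bar> / prod_list (map norm hs)))"

definition forms :: "nat \<Rightarrow> ('h::real_normed_vector list \<Rightarrow> real) set" where
  "forms n = {\<phi>. (\<forall>hs. length hs \<noteq> n \<longrightarrow> \<phi> hs = 0) \<and>
     (\<forall>hs i. length hs = n \<longrightarrow> i < n \<longrightarrow> linear (\<lambda>h. \<phi> (hs[i := h]))) \<and>
     form_norm n \<phi> < \<infinity>}"


section \<open>Differentiability along H and function spaces\<close>

text \<open>The Banach space \<open>H \<subset> X\<close> is a type \<open>'h\<close> together with its embedding \<open>J\<close> into \<open>X\<close>.

  \<open>H\<close>-Gateaux derivative at \<open>x\<close> of \<open>F : X \<rightarrow> \<L>\<^sup>n(H)\<close>. The derivative, an element of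
  \<open>\<L>(H, \<L>\<^sup>n(H))\<close>, is identified with the form \<open>D \<in> \<L>\<^sup>n\<^sup>+\<^sup>1(H)\<close> whose first argument is the
  direction of differentiation.\<close>

definition has_H_derivative :: "('h::real_normed_vector \<Rightarrow> 'a::real_normed_vector) \<Rightarrow> nat
    \<Rightarrow> ('a \<Rightarrow> 'h list \<Rightarrow> real) \<Rightarrow> ('h list \<Rightarrow> real) \<Rightarrow> 'a \<Rightarrow> bool" where
  "has_H_derivative J n F D x \<longleftrightarrow> D \<in> forms (Suc n) \<and>
     (\<forall>h. ((\<lambda>t. form_norm n (\<lambda>hs. (F (x + t *\<^sub>R J h) hs - F x hs) / t - D (h # hs)))
        \<longlongrightarrow> 0) (at (0::real)))"

primrec D_H :: "('h::real_normed_vector \<Rightarrow> 'a::real_normed_vector) \<Rightarrow> nat \<Rightarrow> ('a \<Rightarrow> real)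
    \<Rightarrow> 'a \<Rightarrow> 'h list \<Rightarrow> real" where
  "D_H J 0 f = (\<lambda>x hs. if hs = [] then f x else 0)"
| "D_H J (Suc n) f = (\<lambda>x. THE D. has_H_derivative J n (D_H J n f) D x)"

lemma has_H_derivative_unique:
  fixes J :: "'h::real_normed_vector \<Rightarrow> 'a::real_normed_vector"
  assumes "has_H_derivative J n F D x" "has_H_derivative J n F D' x"
  shows "D = D'"
proof
  fix ks :: "'h list"
  have lim: "((\<lambda>t. (F (x + t *\<^sub>R J h) hs - F x hs) / t) \<longlongrightarrow> E (h # hs)) (at 0)"
    if E: "has_H_derivative J n F E x" and hs: "length hs = n" "0 \<notin> set hs" for E h hs
  proof -
    define p where "p = prod_list (map norm hs)"
    have p: "p > 0"
      using hs(2) unfolding p_def by (induction hs) auto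
    define q where "q t = \<bar>(F (x + t *\<^sub>R J h) hs - F x hs) / t - E (h # hs)\<bar>" for t
    have le: "ennreal (q t / p)
        \<le> form_norm n (\<lambda>hs. (F (x + t *\<^sub>R J h) hs - F x hs) / t - E (h # hs))" for t
      unfolding form_norm_def q_def p_def by (rule SUP_upper) (use hs in auto)
    have "((\<lambda>t. ennreal (q t / p)) \<longlongrightarrow> 0) (at 0)"
    proof (rule tendsto_sandwich[OF _ _ tendsto_const])
      show "\<forall>\<^sub>F t in at 0. ennreal (q t / p)
        \<le> form_norm n (\<lambda>hs. (F (x + t *\<^sub>R J h) hs - F x hs) / t - E (h # hs))"
        using le by simp
    qed (use E in \<open>auto simp: has_H_derivative_def\<close>)
    then have "((\<lambda>t. q t / p) \<longlongrightarrow> 0) (at 0)"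
      using p tendsto_ennreal_iff[of "\<lambda>t. q t / p" "at 0" 0] by (simp add: q_def)
    then have "((\<lambda>t. q t / p * p) \<longlongrightarrow> 0 * p) (at 0)"
      by (intro tendsto_intros)
    then have "(q \<longlongrightarrow> 0) (at 0)"
      using p by simp
    then show ?thesis
      unfolding q_def by (simp add: tendsto_rabs_zero_iff LIM_zero_iff)
  qed
  have zero: "E ks = 0" if E: "E \<in> forms (Suc n)" and ks: "length ks = Suc n" "0 \<in> set ks" for E
  proof -
    obtain i where i: "i < length ks" "ks ! i = 0"
      using ks(2) by (auto simp: in_set_conv_nth)
    then have "linear (\<lambda>h. E (ks[i := h]))"
      using E ks(1) by (auto simp: forms_def)
    from linear_0[OF this] show ?thesis
      using list_update_id[of ks i] i(2) by simp
  qed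
  have forms: "D \<in> forms (Suc n)" "D' \<in> forms (Suc n)"
    using assms by (auto simp: has_H_derivative_def)
  consider "length ks \<noteq> Suc n" | "length ks = Suc n" "0 \<in> set ks"
    | h hs where "ks = h # hs" "length hs = n" "0 \<notin> set hs"
    by (cases ks) auto
  then show "D ks = D' ks"
  proof cases
    case 1
    then show ?thesis using forms by (auto simp: forms_def)
  next
    case 2
    then show ?thesis using zero[OF forms(1)] zero[OF forms(2)] by simp
  next
    case 3
    then show ?thesis
      using tendsto_unique[OF at_neq_bot lim[OF assms(1)] lim[OF assms(2)]] by simp
  qed
qed

definition sup_norm :: "('a \<Rightarrow> real) \<Rightarrow> ennreal" where
  "sup_norm f = (SUP x. ennreal \<bar>f x\<bar>)"

definition C_H :: "('h::real_normed_vector \<Rightarrow> 'a::real_normed_vector) \<Rightarrow> nat \<Rightarrow> ('a \<Rightarrow> real) set" where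
  "C_H J n = {f \<in> bcontfun.
     (\<forall>k<n. \<forall>x. \<exists>D. has_H_derivative J k (D_H J k f) D x) \<and>
     (\<forall>k\<in>{1..n}. \<forall>hs. length hs = k \<longrightarrow> (\<lambda>x. D_H J k f x hs) \<in> bcontfun)}"

definition C_H_norm :: "('h::real_normed_vector \<Rightarrow> 'a::real_normed_vector) \<Rightarrow> nat
    \<Rightarrow> ('a \<Rightarrow> real) \<Rightarrow> ennreal" where
  "C_H_norm J n f = sup_norm f + (\<Sum>k=1..n. SUP x. form_norm k (D_H J k f x))"

definition hoelder_seminorm :: "('h::real_normed_vector \<Rightarrow> 'a::real_normed_vector) \<Rightarrow> real
    \<Rightarrow> ('a \<Rightarrow> real) \<Rightarrow> ennreal" where
  "hoelder_seminorm J \<alpha> f =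
     (SUP x. SUP h\<in>-{0}. ennreal (\<bar>f (x + J h) - f x\<bar> / norm h powr \<alpha>))"

definition hoelder_space :: "('h::real_normed_vector \<Rightarrow> 'a::real_normed_vector) \<Rightarrow> real
    \<Rightarrow> ('a \<Rightarrow> real) set" where
  "hoelder_space J \<alpha> = {f \<in> bcontfun. hoelder_seminorm J \<alpha> f < \<infinity>}"

definition hoelder_norm :: "('h::real_normed_vector \<Rightarrow> 'a::real_normed_vector) \<Rightarrow> real
    \<Rightarrow> ('a \<Rightarrow> real) \<Rightarrow> ennreal" where
  "hoelder_norm J \<alpha> f = sup_norm f + hoelder_seminorm J \<alpha> f"

text \<open>\<open>C\<^sub>b(X; \<L>\<^sup>n(H))\<close>, continuity and boundedness being those of the norm of \<open>\<L>\<^sup>n(H)\<close>.\<close>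

definition Cb_forms :: "nat \<Rightarrow> ('a::topological_space \<Rightarrow> 'h::real_normed_vector list \<Rightarrow> real) set" where
  "Cb_forms n = {F. (\<forall>x. F x \<in> forms n) \<and>
     (\<forall>x. ((\<lambda>y. form_norm n (\<lambda>hs. F y hs - F x hs)) \<longlongrightarrow> 0) (at x)) \<and>
     (SUP x. form_norm n (F x)) < \<infinity>}"

text \<open>\<open>Z\<^sup>1\<^sub>H(X, Y)\<close> for \<open>Y = \<L>\<^sup>n(H)\<close>.\<close>

definition zygmund_seminorm :: "('h::real_normed_vector \<Rightarrow> 'a::real_normed_vector) \<Rightarrow> nat
    \<Rightarrow> ('a \<Rightarrow> 'h list \<Rightarrow> real) \<Rightarrow> ennreal" where
  "zygmund_seminorm J n F = (SUP x. SUP h\<in>-{0}.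
     form_norm n (\<lambda>hs. F (x + 2 *\<^sub>R J h) hs - 2 * F (x + J h) hs + F x hs) / ennreal (norm h))"

definition Z1_forms :: "('h::real_normed_vector \<Rightarrow> 'a::real_normed_vector) \<Rightarrow> nat
    \<Rightarrow> ('a \<Rightarrow> 'h list \<Rightarrow> real) set" where
  "Z1_forms J n = {F \<in> Cb_forms n. zygmund_seminorm J n F < \<infinity>}"

text \<open>\<open>Z\<^sup>n\<^sub>H(X)\<close> for \<open>n \<ge> 1\<close>. As \<open>C_H J 0 = bcontfun\<close> and \<open>\<L>\<^sup>0(H) = \<real>\<close>, the case \<open>n = 1\<close> is
  \<open>Z\<^sup>1\<^sub>H(X, \<real>)\<close>; see the lemmas below.\<close>

definition zygmund_space :: "('h::real_normed_vector \<Rightarrow> 'a::real_normed_vector) \<Rightarrow> nat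
    \<Rightarrow> ('a \<Rightarrow> real) set" where
  "zygmund_space J n = {f \<in> C_H J (n - 1). 1 \<le> n \<and> D_H J (n - 1) f \<in> Z1_forms J (n - 1)}"

definition zygmund_norm :: "('h::real_normed_vector \<Rightarrow> 'a::real_normed_vector) \<Rightarrow> nat
    \<Rightarrow> ('a \<Rightarrow> real) \<Rightarrow> ennreal" where
  "zygmund_norm J n f = C_H_norm J (n - 1) f + zygmund_seminorm J (n - 1) (D_H J (n - 1) f)"

lemma form_norm_0: "form_norm 0 \<phi> = ennreal \<bar>\<phi> []\<bar>"
proof -
  have "{hs :: 'a list. length hs = 0 \<and> 0 \<notin> set hs} = {[]}" by auto
  then show ?thesis unfolding form_norm_def by simp
qed

lemma zygmund_seminorm_0:
  "zygmund_seminorm J 0 (D_H J 0 f) =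
     (SUP x. SUP h\<in>-{0}. ennreal (\<bar>f (x + 2 *\<^sub>R J h) - 2 * f (x + J h) + f x\<bar> / norm h))"
  unfolding zygmund_seminorm_def form_norm_0
  by (intro SUP_cong refl) (simp add: divide_ennreal)

lemma zygmund_norm_1:
  "zygmund_norm J 1 f = sup_norm f +
     (SUP x. SUP h\<in>-{0}. ennreal (\<bar>f (x + 2 *\<^sub>R J h) - 2 * f (x + J h) + f x\<bar> / norm h))"
  unfolding zygmund_norm_def C_H_norm_def using zygmund_seminorm_0[of J f] by simp

lemma zygmund_space_1:
  fixes J :: "'h::real_normed_vector \<Rightarrow> 'a::real_normed_vector"
  shows "zygmund_space J 1 = {f \<in> bcontfun.
     (SUP x. SUP h\<in>-{0}. ennreal (\<bar>f (x + 2 *\<^sub>R J h) - 2 * f (x + J h) + f x\<bar> / norm h)) < \<infinity>}"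
proof -
  have "D_H J 0 f \<in> Cb_forms 0" if f: "f \<in> bcontfun" for f
  proof -
    have "((\<lambda>y. ennreal \<bar>f y - f x\<bar>) \<longlongrightarrow> 0) (at x)" for x
    proof -
      have "(f \<longlongrightarrow> f x) (at x)"
        using f by (auto simp: bcontfun_def continuous_on_eq_continuous_at isCont_def)
      then have "((\<lambda>y. \<bar>f y - f x\<bar>) \<longlongrightarrow> 0) (at x)"
        by (simp add: tendsto_rabs_zero_iff LIM_zero)
      from tendsto_ennrealI[OF this] show ?thesis by simp
    qed
    moreover obtain B where "\<bar>f x\<bar> \<le> B" for x
      using f by (auto simp: bcontfun_def bounded_iff)
    then have "(SUP x. ennreal \<bar>f x\<bar>) \<le> ennreal B"
      by (intro SUP_least ennreal_leI)
    then have "(SUP x. ennreal \<bar>f x\<bar>) < \<infinity>"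
      by (simp add: le_less_trans)
    ultimately show ?thesis
      by (simp add: Cb_forms_def forms_def form_norm_0)
  qed
  then show ?thesis
    using zygmund_seminorm_0[of J]
    by (auto simp: zygmund_space_def C_H_def Z1_forms_def)
qed

end

theory Submission
  imports Defs
begin

text \<open>For \<open>t > 0\<close> the measure \<open>\<mu>\<^sub>t\<close> is differentiable along \<open>T\<^sub>t h\<close>, so \<open>P\<^sub>t\<close> maps \<open>C\<^sub>b\<close> to functions
  differentiable along \<open>H\<close>, and \<open>P\<^sub>t = P\<^sub>a P\<^sub>b\<close> together with \<open>\<partial>\<^sub>h P\<^sub>a = P\<^sub>a \<partial>\<close>, the inner derivative being taken
  along \<open>T\<^sub>a h\<close>, iterates this: \<open>\<parallel>D\<^sup>n P\<^sub>t f\<parallel> \<le> c\<^sub>n \<kappa>(t)\<^sup>n \<parallel>f\<parallel>\<close> with \<open>\<kappa>(t) = max 1 (t powr - \<theta>)\<close>. Hence \<open>D\<^sup>n u\<close> is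
  the Laplace transform of \<open>D\<^sup>n P\<^sub>t f\<close> as long as \<open>n \<theta> < 1\<close>, that is for \<open>n \<le> k - 1\<close>. The Zygmund seminorm of
  \<open>D\<^sup>k\<^sup>-\<^sup>1 u\<close> comes from estimating the second difference of \<open>D\<^sup>k\<^sup>-\<^sup>1 P\<^sub>t f\<close> in two ways and cutting the time
  integral at \<open>t = \<parallel>h\<parallel> powr (1 / \<theta>)\<close>; in the Hoelder case one difference falls on \<open>f\<close>, by
  \<open>P\<^sub>t f (x + h) - P\<^sub>t f x = P\<^sub>t (f (\<cdot> + T\<^sub>t h) - f) x\<close>.

  Continuity of \<open>D\<^sup>n u\<close> in the norm of \<open>\<L>\<^sup>n(H)\<close> needs more than the bounds on \<open>\<parallel>\<beta>\<parallel>\<^sub>1\<close>. For \<open>0 \<le> \<phi> \<le> R\<close> the function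
  \<open>w = P\<^sub>t \<phi>\<close> is nonnegative with second derivative of size \<open>\<kappa>\<^sup>2 R\<close> along unit directions, whence
  \<open>\<bar>\<partial>\<^sub>h w\<bar>\<^sup>2 \<le> c \<kappa>\<^sup>2 R w\<close>. Iterating, \<open>\<bar>\<phi>\<bar> \<le> r \<le> R\<close> bounds \<open>\<parallel>D\<^sup>n P\<^sub>t \<phi> (x)\<parallel>\<close> by a power of \<open>P\<^sub>t r (x)\<close>; with
  \<open>\<phi> = f (\<cdot> + T\<^sub>t (y - x)) - f\<close> and \<open>r = \<bar>\<phi>\<bar>\<close> this tends to \<open>0\<close> as \<open>y \<rightarrow> x\<close>.\<close>

section \<open>Integration by parts for Fomin differentiable measures\<close>

context
  fixes m :: "'a::{real_normed_vector,second_countable_topology} measure" and v :: 'a and \<beta> :: "'a \<Rightarrow> real"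
  assumes prob: "prob_space m" and sets_m: "sets m = sets borel" and dens: "fomin_density m v \<beta>"
begin

interpretation prob_space m by (rule prob)

lemma measurable_m: "borel_measurable m = borel_measurable borel"
  by (rule measurable_cong_sets[OF sets_m refl])

text \<open>The density describes the derivative at \<open>s = 0\<close> only, but for every Borel
  set. Applied to the translate \<open>sh s\<close> it yields the derivative of the measure of
  \<open>sh s\<close> at every \<open>s\<close>, bounded by the L1 norm of \<open>\<beta>\<close>,
  and the mean value inequality applies.\<close>

lemma fomin_shift_lipschitz:
  assumes A: "A \<in> sets borel"
  shows "\<bar>measure m ((\<lambda>y. y + s *\<^sub>R v) ` A) - measure m A\<bar> \<le> \<bar>s\<bar> * (LINT y|m. \<bar>\<beta> y\<bar>)"
proof -
  define sh where "sh s = (\<lambda>y. y + s *\<^sub>R v) ` A" for s :: real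
  have meas: "sh s \<in> sets borel" for s
  proof -
    have "sh s = (\<lambda>y. y - s *\<^sub>R v) -` A \<inter> space borel"
      unfolding sh_def by (force simp: image_iff)
    also have "\<dots> \<in> sets borel" using A by (intro measurable_sets) auto
    finally show ?thesis .
  qed
  have int: "integrable m \<beta>" using dens by (simp add: fomin_density_def)
  have "((\<lambda>s. measure m (sh s)) has_field_derivative (LINT y:sh s|m. \<beta> y)) (at s)" for s
  proof -
    have "(\<lambda>y. y + t *\<^sub>R v) ` sh s = sh (s + t)" for t
      unfolding sh_def image_image by (simp add: algebra_simps)
    then have "(\<lambda>t. (measure m (sh (s + t)) - measure m (sh s)) / t) = fomin_quotient m v (sh s)"
      by (auto simp: fomin_quotient_def)
    then show ?thesis
      using dens meas[of s] by (simp add: DERIV_def fomin_density_def)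
  qed
  moreover have "norm (LINT y:sh s|m. \<beta> y) \<le> (LINT y|m. \<bar>\<beta> y\<bar>)" for s
  proof -
    have "norm (LINT y:sh s|m. \<beta> y) \<le> (LINT y|m. norm (indicator (sh s) y *\<^sub>R \<beta> y))"
      unfolding set_lebesgue_integral_def by (rule integral_norm_bound)
    also have "\<dots> \<le> (LINT y|m. \<bar>\<beta> y\<bar>)"
    proof (rule integral_mono)
      show "integrable m (\<lambda>y. norm (indicator (sh s) y *\<^sub>R \<beta> y))"
        using int meas[of s] sets_m by (intro integrable_norm integrable_mult_indicator) auto
    qed (use int in \<open>auto simp: indicator_def\<close>)
    finally show ?thesis .
  qed
  ultimately have "norm (measure m (sh s) - measure m (sh 0)) \<le> (LINT y|m. \<bar>\<beta> y\<bar>) * norm (s - 0)"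
    by (intro field_differentiable_bound[of UNIV "\<lambda>s. measure m (sh s)" "\<lambda>s. LINT y:sh s|m. \<beta> y"]) auto
  then show ?thesis by (simp add: sh_def mult.commute)
qed

section \<open>Passage from Borel sets to bounded Borel functions\<close>

lemma integrable_bounded_borel:
  assumes "g \<in> borel_measurable borel" "\<And>y. \<bar>g y\<bar> \<le> (B::real)"
  shows "integrable m (\<lambda>y. g (y + w))"
  using assms by (intro integrable_const_bound[of _ B]) (auto simp: measurable_m)

lemma integrable_bounded_density:
  assumes "g \<in> borel_measurable borel" "\<And>y. \<bar>g y\<bar> \<le> (B::real)"
  shows "integrable m (\<lambda>y. g y * \<beta> y)"
proof (rule Bochner_Integration.integrable_bound[of m "\<lambda>y. B * \<beta> y"])
  show "integrable m (\<lambda>y. B * \<beta> y)" using dens by (simp add: fomin_density_def)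
  show "(\<lambda>y. g y * \<beta> y) \<in> borel_measurable m"
    using dens assms by (auto simp: fomin_density_def measurable_m intro!: borel_measurable_times)
  show "AE y in m. norm (g y * \<beta> y) \<le> norm (B * \<beta> y)"
    using assms(2) by (auto simp: abs_mult intro!: mult_right_mono order_trans[OF assms(2)])
qed

text \<open>For \<open>0 \<le> g \<le> 1\<close> this is the floor of \<open>N g\<close> divided by
  \<open>N\<close>. Written as an average of \<open>N\<close> indicators of superlevel sets, it
  transfers statements on sets to functions by finite linearity.\<close>

definition staircase :: "('a \<Rightarrow> real) \<Rightarrow> nat \<Rightarrow> 'a \<Rightarrow> real" where
  "staircase g N y = (\<Sum>j=1..N. indicator {z. real j \<le> real N * g z} y) / real N"

lemma staircase_approx:
  assumes "0 \<le> g y" "g y \<le> 1" "0 < N"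
  shows "0 \<le> real N * (g y - staircase g N y)" "real N * (g y - staircase g N y) \<le> 1"
proof -
  have N: "N > 0" using assms by simp
  define n where "n = nat \<lfloor>real N * g y\<rfloor>"
  have g0: "0 \<le> real N * g y" using assms by simp
  have g1: "real N * g y \<le> real N" using assms by (simp add: mult_left_le)
  have le: "real j \<le> real N * g y \<longleftrightarrow> j \<le> n" for j
    unfolding n_def using g0 by (auto simp: le_nat_iff le_floor_iff)
  have nN: "n \<le> N" using g1 le[of n] by linarith
  have "(\<Sum>j=1..N. indicator {z. real j \<le> real N * g z} y) = (\<Sum>j=1..N. if j \<in> {1..n} then 1 else (0::real))"
    by (intro sum.cong) (auto simp: indicator_def le)
  also have "\<dots> = (\<Sum>j\<in>{1..n}. 1)"
    using nN by (subst sum.inter_restrict[symmetric]) (auto intro!: arg_cong[where f=card])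
  finally have "staircase g N y = real n / real N" by (simp add: staircase_def)
  then have eq: "real N * (g y - staircase g N y) = real N * g y - real n" using N by (simp add: field_simps)
  have "real n = of_int \<lfloor>real N * g y\<rfloor>" unfolding n_def using g0 by simp
  then show "0 \<le> real N * (g y - staircase g N y)" "real N * (g y - staircase g N y) \<le> 1"
    unfolding eq by linarith+
qed

lemma borel_measurable_staircase [measurable]:
  assumes [measurable]: "g \<in> borel_measurable borel"
  shows "staircase g N \<in> borel_measurable borel"
  unfolding staircase_def by measurable

lemma staircase_bounded: "\<bar>staircase g N y\<bar> \<le> 1"
proof -
  have "(\<Sum>j=1..N. indicator {z. real j \<le> real N * g z} y) \<le> (\<Sum>j=1..N. 1::real)"
    by (intro sum_mono) (auto simp: indicator_def)
  moreover have "0 \<le> (\<Sum>j=1..N. indicator {z. real j \<le> real N * g z} y :: real)"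
    by (intro sum_nonneg) auto
  ultimately show ?thesis by (cases "N = 0") (auto simp: staircase_def divide_simps)
qed

text \<open>The minus sign turns the indicator of \<open>A\<close> into that of
  \<open>A + s v\<close>, so this extends the numerator of \<open>fomin_quotient\<close> from sets
  to functions.\<close>

definition shift_diff :: "('a \<Rightarrow> real) \<Rightarrow> real \<Rightarrow> real" where
  "shift_diff g s = (LINT y|m. g (y - s *\<^sub>R v)) - (LINT y|m. g y)"

lemma shift_diff_indicator:
  assumes A: "A \<in> sets borel"
  shows "shift_diff (indicator A) s = measure m ((\<lambda>y. y + s *\<^sub>R v) ` A) - measure m A"
proof -
  have A': "A \<in> sets m" using A sets_m by simp
  have eq: "(\<lambda>y. y + s *\<^sub>R v) ` A = (\<lambda>y. y - s *\<^sub>R v) -` A \<inter> space borel"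
    by (force simp: image_iff)
  have "(\<lambda>y. y - s *\<^sub>R v) -` A \<inter> space borel \<in> sets borel"
    using A by (intro measurable_sets) auto
  then have "(\<lambda>y. y + s *\<^sub>R v) ` A \<in> sets m"
    by (simp add: eq sets_m)
  moreover have "indicator A (y - s *\<^sub>R v) = (indicator ((\<lambda>y. y + s *\<^sub>R v) ` A) y :: real)" for y
    by (auto simp: indicator_def image_iff algebra_simps)
  ultimately show ?thesis
    using A' by (simp add: shift_diff_def)
qed

lemma shift_diff_staircase:
  assumes [measurable]: "g \<in> borel_measurable borel"
  shows "shift_diff (staircase g N) s = (\<Sum>j=1..N. shift_diff (indicator {z. real j \<le> real N * g z}) s) / real N"
proof -
  have 1: "integrable m (\<lambda>y. indicator {z. real j \<le> real N * g z} (y + w) :: real)" for j w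
    by (rule integrable_bounded_borel[of _ 1]) auto
  show ?thesis
    unfolding shift_diff_def staircase_def
    using 1[of _ "- (s *\<^sub>R v)"] 1[of _ 0]
    by (simp add: sum_subtractf diff_divide_distrib Bochner_Integration.integral_sum)
qed

lemma shift_diff_diff:
  assumes "g \<in> borel_measurable borel" "\<And>y. \<bar>g y\<bar> \<le> B" "f \<in> borel_measurable borel" "\<And>y. \<bar>f y\<bar> \<le> B'"
  shows "shift_diff (\<lambda>y. c * (g y - f y)) s = c * (shift_diff g s - shift_diff f s)"
  unfolding shift_diff_def
  using integrable_bounded_borel[OF assms(1,2), of "- (s *\<^sub>R v)"] integrable_bounded_borel[OF assms(1,2), of 0]
    integrable_bounded_borel[OF assms(3,4), of "- (s *\<^sub>R v)"] integrable_bounded_borel[OF assms(3,4), of 0]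
  by (simp add: algebra_simps)

abbreviation (input) "\<beta>norm \<equiv> LINT y|m. \<bar>\<beta> y\<bar>"

lemma level_sets:
  assumes [measurable]: "g \<in> borel_measurable borel"
  shows "{z. (c::real) \<le> d * g z} \<in> sets borel"
  by measurable

text \<open>The Lipschitz bound for sets survives averaging over the \<open>N\<close> superlevel
  sets with the same constant, and replacing \<open>g\<close> by its staircase costs at most
  \<open>1 / N\<close> in each of the two integrals.\<close>

lemma shift_diff_unit_le:
  assumes g [measurable]: "g \<in> borel_measurable borel" and g01: "\<And>y. 0 \<le> g y" "\<And>y. g y \<le> 1"
  shows "\<bar>shift_diff g s\<bar> \<le> \<bar>s\<bar> * \<beta>norm"
proof (rule field_le_epsilon)
  fix e :: real assume e: "0 < e"
  define N where "N = nat \<lceil>2 / e\<rceil>"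
  have "2 / e \<le> real N" unfolding N_def by linarith
  then have N0: "N > 0" using e by (auto intro!: Nat.gr0I simp: field_simps)
  have N: "N > 0" "2 / real N \<le> e"
    using \<open>2 / e \<le> real N\<close> N0 e by (auto simp: divide_le_eq mult.commute)
  have st: "\<bar>shift_diff (staircase g N) s\<bar> \<le> \<bar>s\<bar> * \<beta>norm"
  proof -
    have "\<bar>\<Sum>j=1..N. shift_diff (indicator {z. real j \<le> real N * g z}) s\<bar> \<le> (\<Sum>j=1..N. \<bar>s\<bar> * \<beta>norm)"
      by (intro order_trans[OF sum_abs] sum_mono)
        (simp add: shift_diff_indicator level_sets[OF g] fomin_shift_lipschitz)
    then show ?thesis using N by (simp add: shift_diff_staircase[OF g] field_simps)
  qed
  have b: "\<bar>real N * (g y - staircase g N y)\<bar> \<le> 1" for y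
    using staircase_approx[of g y N, OF g01 N(1)] by (simp add: abs_le_iff)
  have i1: "\<bar>LINT y|m. (real N * (g (y + w) - staircase g N (y + w)))\<bar> \<le> 1" for w
  proof -
    have "(\<lambda>y. real N * (g y - staircase g N y)) \<in> borel_measurable borel" by measurable
    from integrable_bounded_borel[OF this, of 1 w] b
    have "norm (LINT y|m. (real N * (g (y + w) - staircase g N (y + w)))) \<le> (LINT y|m. norm (real N * (g (y + w) - staircase g N (y + w))))"
      by (intro integral_norm_bound)
    also have "\<dots> \<le> (LINT y|m. 1)"
      using b integrable_bounded_borel[of "\<lambda>y. real N * (g y - staircase g N y)" 1 w]
      by (intro integral_mono) (auto simp del: abs_mult)
    finally show ?thesis by (simp add: prob_space)
  qed
  have "\<bar>shift_diff (\<lambda>y. real N * (g y - staircase g N y)) s\<bar> \<le> 2"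
    using i1[of "- (s *\<^sub>R v)"] i1[of 0] by (simp add: shift_diff_def)
  then have "real N * \<bar>shift_diff g s - shift_diff (staircase g N) s\<bar> \<le> 2"
    using shift_diff_diff[of g 1 "staircase g N" 1 "real N" s] g01 staircase_bounded by (simp add: abs_mult)
  then have "\<bar>shift_diff g s - shift_diff (staircase g N) s\<bar> \<le> 2 / real N" using N by (simp add: field_simps)
  with st N show "\<bar>shift_diff g s\<bar> \<le> \<bar>s\<bar> * \<beta>norm + e" by linarith
qed

text \<open>For a staircase the limit is a finite sum of limits for sets. The remainder rescaled by
  \<open>N\<close> again takes values in \<open>[0, 1]\<close>, so \<open>shift_diff_unit_le\<close>
  bounds its difference quotient uniformly in \<open>s\<close>; this uniformity justifies the
  exchange of the limits in \<open>s\<close> and \<open>N\<close>.\<close>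

lemma shift_diff_unit_tendsto:
  assumes g [measurable]: "g \<in> borel_measurable borel" and g01: "\<And>y. 0 \<le> g y" "\<And>y. g y \<le> 1"
  shows "((\<lambda>s. shift_diff g s / s) \<longlongrightarrow> (LINT y|m. g y * \<beta> y)) (at 0)"
proof (rule tendstoI)
  fix e :: real assume e: "0 < e"
  have K0: "\<beta>norm \<ge> 0" by simp
  define N where "N = Suc (nat \<lceil>3 * \<beta>norm / e\<rceil>)"
  have "3 * \<beta>norm / e < real N" unfolding N_def by linarith
  moreover have "N > 0" unfolding N_def by simp
  ultimately have N: "N > 0" "\<beta>norm / real N < e / 3"
    using e by (auto simp: divide_less_eq less_divide_eq mult.commute)
  have int: "integrable m \<beta>" using dens by (simp add: fomin_density_def)
  let ?I = "\<lambda>j. indicator {z. real j \<le> real N * g z} :: 'a \<Rightarrow> real"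
  have lim: "((\<lambda>s. shift_diff (?I j) s / s) \<longlongrightarrow> (LINT y|m. ?I j y * \<beta> y)) (at 0)" for j
    using dens level_sets[OF g, of "real j" "real N"]
    by (simp add: shift_diff_indicator fomin_density_def fomin_quotient_def[abs_def] set_lebesgue_integral_def)
  have "((\<lambda>s. (\<Sum>j=1..N. shift_diff (?I j) s / s) / real N) \<longlongrightarrow> (\<Sum>j=1..N. LINT y|m. ?I j y * \<beta> y) / real N) (at 0)"
    by (intro tendsto_intros lim) (use N in auto)
  moreover have "(\<Sum>j=1..N. shift_diff (?I j) s / s) / real N = shift_diff (staircase g N) s / s" for s
    by (simp add: shift_diff_staircase[OF g] sum_divide_distrib mult.commute)
  moreover have "(\<Sum>j=1..N. LINT y|m. ?I j y * \<beta> y) / real N = (LINT y|m. staircase g N y * \<beta> y)"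
  proof -
    have "integrable m (\<lambda>y. ?I j y * \<beta> y)" for j
      by (rule integrable_bounded_density[of _ 1]) auto
    then have "(\<Sum>j=1..N. LINT y|m. ?I j y * \<beta> y) = (LINT y|m. (\<Sum>j=1..N. ?I j y * \<beta> y))"
      by (rule Bochner_Integration.integral_sum[symmetric])
    then show ?thesis
      by (simp only: staircase_def sum_distrib_right times_divide_eq_left integral_divide_zero)
  qed
  ultimately have "((\<lambda>s. shift_diff (staircase g N) s / s) \<longlongrightarrow> (LINT y|m. staircase g N y * \<beta> y)) (at 0)" by simp
  then have ev: "\<forall>\<^sub>F s in at 0. dist (shift_diff (staircase g N) s / s) (LINT y|m. staircase g N y * \<beta> y) < e / 3"
    using e by (intro tendstoD) auto
  define r where "r y = real N * (g y - staircase g N y)" for y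
  have r: "r \<in> borel_measurable borel" "\<And>y. 0 \<le> r y" "\<And>y. r y \<le> 1"
    using staircase_approx[of g _ N, OF g01 N(1)] unfolding r_def by (auto simp: g)
  have ir: "shift_diff r s = real N * (shift_diff g s - shift_diff (staircase g N) s)" for s
    unfolding r_def using g01 staircase_bounded by (intro shift_diff_diff[of g 1 "staircase g N" 1]) auto
  have d2: "\<bar>shift_diff g s / s - shift_diff (staircase g N) s / s\<bar> \<le> \<beta>norm / real N" if "s \<noteq> 0" for s
  proof -
    have "real N * \<bar>shift_diff g s - shift_diff (staircase g N) s\<bar> \<le> \<bar>s\<bar> * \<beta>norm"
      using shift_diff_unit_le[OF r, of s] by (simp add: ir abs_mult)
    then have "\<bar>shift_diff g s - shift_diff (staircase g N) s\<bar> / \<bar>s\<bar> \<le> \<beta>norm / real N"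
      using that N(1) by (simp add: divide_le_eq le_divide_eq mult.commute mult.left_commute)
    then show ?thesis by (simp add: diff_divide_distrib[symmetric])
  qed
  have ib: "integrable m (\<lambda>y. g y * \<beta> y)" "integrable m (\<lambda>y. staircase g N y * \<beta> y)" "integrable m (\<lambda>y. r y * \<beta> y)"
    using g01 r staircase_bounded by (auto intro!: integrable_bounded_density[of _ 1])
  have "(LINT y|m. r y * \<beta> y) = real N * ((LINT y|m. g y * \<beta> y) - (LINT y|m. staircase g N y * \<beta> y))"
    using ib(1,2) by (simp add: r_def algebra_simps)
  moreover have "\<bar>LINT y|m. r y * \<beta> y\<bar> \<le> \<beta>norm"
  proof -
    have "\<bar>LINT y|m. r y * \<beta> y\<bar> \<le> (LINT y|m. \<bar>r y * \<beta> y\<bar>)"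
      by (rule integral_abs_bound)
    also have "\<dots> \<le> \<beta>norm"
    proof (rule integral_mono)
      fix y show "\<bar>r y * \<beta> y\<bar> \<le> \<bar>\<beta> y\<bar>"
        using r(2,3)[of y] by (simp add: abs_mult mult_left_le_one_le)
    qed (use ib(3) int in auto)
    finally show ?thesis .
  qed
  ultimately have d3: "\<bar>(LINT y|m. g y * \<beta> y) - (LINT y|m. staircase g N y * \<beta> y)\<bar> \<le> \<beta>norm / real N"
    using N(1) by (simp add: abs_mult pos_le_divide_eq mult.commute[of _ "real N"])
  show "\<forall>\<^sub>F s in at 0. dist (shift_diff g s / s) (LINT y|m. g y * \<beta> y) < e"
    using ev eventually_neq_at_within[of 0]
  proof eventually_elim
    case (elim s)
    show ?case using elim(1) d2[OF elim(2)] d3 N(2) unfolding dist_real_def by linarith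
  qed
qed

text \<open>An affine map brings \<open>g\<close> into \<open>[0, 1]\<close>, where
  \<open>shift_diff_unit_tendsto\<close> applies. The derivative is carried by the measure while
  \<open>g\<close> is merely bounded and Borel, which is the source of all smoothing below.\<close>

lemma fomin_derivative:
  assumes g: "g \<in> borel_measurable borel" and B: "\<And>y. \<bar>g y\<bar> \<le> B"
  shows "((\<lambda>s. LINT y|m. g (y + s *\<^sub>R v)) has_field_derivative - (LINT y|m. g y * \<beta> y)) (at 0)"
proof -
  define B' where "B' = \<bar>B\<bar> + 1"
  have B': "B' > 0" "\<bar>g y\<bar> \<le> B'" for y using B[of y] by (auto simp: B'_def)
  define f where "f y = (g y + B') / (2 * B')" for y
  have f: "f \<in> borel_measurable borel" "\<And>y. 0 \<le> f y" "\<And>y. f y \<le> 1"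
  proof -
    show "f \<in> borel_measurable borel" unfolding f_def[abs_def] using g by simp
    show "0 \<le> f y" "f y \<le> 1" for y
      using B'(2)[of y] B'(1) by (auto simp: f_def field_simps abs_le_iff)
  qed
  have geq: "g y = 2 * B' * (f y - 1 / 2)" for y using B' by (simp add: f_def field_simps)
  have ginc: "shift_diff g s = 2 * B' * shift_diff f s" for s
    using shift_diff_diff[of f 1 "\<lambda>_. 1 / 2" 1 "2 * B'" s] f geq by (simp add: shift_diff_def)
  have UN: "shift_diff (indicator UNIV) s = 0" for s
    by (simp add: shift_diff_def)
  \<comment> \<open>Translations preserve the total mass, so the density has mean zero; this cancels
    the additive constant of the rescaling.\<close>
  have "((\<lambda>s. shift_diff (indicator UNIV) s / s) \<longlongrightarrow> (LINT y|m. indicator UNIV y * \<beta> y)) (at 0)"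
    by (rule shift_diff_unit_tendsto) auto
  then have b0: "(LINT y|m. \<beta> y) = 0"
    using UN tendsto_unique[OF at_neq_bot _ tendsto_const[of 0 "at (0::real)"]] by simp
  have int: "integrable m \<beta>" using dens by (simp add: fomin_density_def)
  have "(LINT y|m. g y * \<beta> y) = 2 * B' * (LINT y|m. f y * \<beta> y)"
  proof -
    have "integrable m (\<lambda>y. f y * \<beta> y)" using f by (intro integrable_bounded_density[of f 1]) auto
    then have "(LINT y|m. 2 * B' * (f y * \<beta> y) - B' * \<beta> y) = 2 * B' * (LINT y|m. f y * \<beta> y)"
      using int b0 by (subst Bochner_Integration.integral_diff) auto
    then show ?thesis by (simp add: geq algebra_simps)
  qed
  moreover have "((\<lambda>s. 2 * B' * (shift_diff f s / s)) \<longlongrightarrow> 2 * B' * (LINT y|m. f y * \<beta> y)) (at 0)"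
    using f by (intro tendsto_intros shift_diff_unit_tendsto)
  ultimately have "((\<lambda>s. shift_diff g s / s) \<longlongrightarrow> (LINT y|m. g y * \<beta> y)) (at 0)"
    using B' by (simp add: ginc)
  \<comment> \<open>\<open>shift_diff\<close> translates by \<open>- s v\<close> and the claim by
    \<open>+ s v\<close>; the substitution of \<open>- s\<close> for \<open>s\<close> produces the
    sign.\<close>
  moreover have "filterlim uminus (at 0) (at (0::real))"
    using tendsto_minus[OF tendsto_ident_at, of "0::real" UNIV] by (simp add: filterlim_at eventually_at_filter)
  ultimately have "((\<lambda>s. - (shift_diff g (- s) / (- s))) \<longlongrightarrow> - (LINT y|m. g y * \<beta> y)) (at 0)"
    by (intro tendsto_minus) (rule filterlim_compose)
  then show ?thesis by (simp add: DERIV_def shift_diff_def)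
qed

end

section \<open>Iterated derivatives along H\<close>

text \<open>Scalar derivatives in one direction, accessible to one-variable calculus. Derivatives in
  the norm of forms are recovered from them only for the resolvent, in
  \<open>U_form_has_H_derivative\<close>. As \<open>deriv\<close> is an arbitrary value where no
  derivative exists, \<open>H_differentiable\<close> is tracked separately.\<close>

definition H_deriv :: "('h::real_normed_vector \<Rightarrow> 'a::real_normed_vector) \<Rightarrow> 'h \<Rightarrow> ('a \<Rightarrow> real) \<Rightarrow> 'a \<Rightarrow> real" where
  "H_deriv J h g x = deriv (\<lambda>s. g (x + s *\<^sub>R J h)) 0"

definition H_differentiable :: "('h::real_normed_vector \<Rightarrow> 'a::real_normed_vector) \<Rightarrow> 'h \<Rightarrow> ('a \<Rightarrow> real) \<Rightarrow> bool" where
  "H_differentiable J h g \<longleftrightarrow> (\<forall>x. (\<lambda>s. g (x + s *\<^sub>R J h)) field_differentiable at 0)"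

definition H_C1 :: "('h::real_normed_vector \<Rightarrow> 'a::real_normed_vector) \<Rightarrow> ('a \<Rightarrow> real) \<Rightarrow> bool" where
  "H_C1 J g \<longleftrightarrow> (\<forall>h. H_differentiable J h g \<and> continuous_on UNIV (H_deriv J h g))"

text \<open>The head is the direction differentiated last, in agreement with
  \<open>has_H_derivative\<close>, where the new direction becomes the first argument.\<close>

primrec H_derivs :: "('h::real_normed_vector \<Rightarrow> 'a::real_normed_vector) \<Rightarrow> 'h list \<Rightarrow> ('a \<Rightarrow> real) \<Rightarrow> 'a \<Rightarrow> real" where
  "H_derivs J [] g = g"
| "H_derivs J (h # hs) g = H_deriv J h (H_derivs J hs g)"

lemma H_derivs_append: "H_derivs J (hs @ ks) g = H_derivs J hs (H_derivs J ks g)"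
  by (induction hs) auto

lemma H_deriv_eqI:
  "((\<lambda>s. g (x + s *\<^sub>R J h)) has_field_derivative D) (at 0) \<Longrightarrow> H_deriv J h g x = D"
  unfolding H_deriv_def by (rule DERIV_imp_deriv)

lemma H_differentiableI:
  "(\<And>x. ((\<lambda>s. g (x + s *\<^sub>R J h)) has_field_derivative D x) (at 0)) \<Longrightarrow> H_differentiable J h g"
  unfolding H_differentiable_def by (auto simp: field_differentiable_def)

lemma H_differentiable_DERIV_0:
  "H_differentiable J h g \<Longrightarrow> ((\<lambda>s. g (x + s *\<^sub>R J h)) has_field_derivative H_deriv J h g x) (at 0)"
  unfolding H_deriv_def H_differentiable_def by (simp add: field_differentiable_derivI)

lemma H_differentiable_DERIV:
  assumes "H_differentiable J h g"
  shows "((\<lambda>s. g (x + s *\<^sub>R J h)) has_field_derivative H_deriv J h g (x + s *\<^sub>R J h)) (at s)"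
  using H_differentiable_DERIV_0[OF assms, of "x + s *\<^sub>R J h"]
  by (simp add: DERIV_def algebra_simps)

lemma H_derivs_shift: "H_derivs J hs (\<lambda>x. g (x + z)) = (\<lambda>x. H_derivs J hs g (x + z))"
  by (induction hs) (auto simp: H_deriv_def algebra_simps)

lemma H_differentiable_shift:
  assumes "H_differentiable J h g"
  shows "H_differentiable J h (\<lambda>x. g (x + z))"
proof -
  have "(\<lambda>s. g (x + s *\<^sub>R J h + z)) = (\<lambda>s. g ((x + z) + s *\<^sub>R J h))" for x
    by (simp add: algebra_simps)
  then show ?thesis using assms unfolding H_differentiable_def by auto
qed

lemma
  assumes "H_differentiable J h f" "H_differentiable J h g"
  shows H_differentiable_lin: "H_differentiable J h (\<lambda>x. a * f x + b * g x)"
    and H_deriv_lin: "H_deriv J h (\<lambda>x. a * f x + b * g x) = (\<lambda>x. a * H_deriv J h f x + b * H_deriv J h g x)"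
proof -
  have *: "((\<lambda>s. a * f (x + s *\<^sub>R J h) + b * g (x + s *\<^sub>R J h)) has_field_derivative
      (a * H_deriv J h f x + b * H_deriv J h g x)) (at 0)" for x
    by (intro DERIV_add DERIV_cmult H_differentiable_DERIV_0 assms)
  show "H_differentiable J h (\<lambda>x. a * f x + b * g x)"
    using * by (rule H_differentiableI)
  show "H_deriv J h (\<lambda>x. a * f x + b * g x) = (\<lambda>x. a * H_deriv J h f x + b * H_deriv J h g x)"
    by (intro ext H_deriv_eqI *)
qed

lemma H_deriv_mvt:
  assumes "H_differentiable J h g"
  obtains \<xi> where "\<bar>\<xi>\<bar> \<le> \<bar>s\<bar>" "g (x + s *\<^sub>R J h) - g x = s * H_deriv J h g (x + \<xi> *\<^sub>R J h)"
proof -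
  let ?G = "\<lambda>s. g (x + s *\<^sub>R J h)" and ?D = "\<lambda>s. H_deriv J h g (x + s *\<^sub>R J h)"
  have D: "\<And>s. (?G has_field_derivative ?D s) (at s)" by (rule H_differentiable_DERIV[OF assms])
  consider "s < 0" | "s = 0" | "0 < s" by linarith
  then show thesis
  proof cases
    case 1
    obtain \<xi> where "s < \<xi>" "\<xi> < 0" "?G 0 - ?G s = (0 - s) * ?D \<xi>"
      using MVT2[OF 1, of ?G ?D] D by blast
    then show thesis using that[of \<xi>] by (auto simp: algebra_simps)
  next
    case 2 then show thesis using that[of 0] by simp
  next
    case 3
    obtain \<xi> where "0 < \<xi>" "\<xi> < s" "?G s - ?G 0 = (s - 0) * ?D \<xi>"
      using MVT2[OF 3, of ?G ?D] D by blast
    then show thesis using that[of \<xi>] by (auto simp: algebra_simps)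
  qed
qed

lemma H_deriv_increment_le:
  assumes "H_differentiable J h g" "\<And>y. \<bar>H_deriv J h g y\<bar> \<le> B"
  shows "\<bar>g (x + s *\<^sub>R J h) - g x\<bar> \<le> \<bar>s\<bar> * B"
proof -
  obtain \<xi> where "g (x + s *\<^sub>R J h) - g x = s * H_deriv J h g (x + \<xi> *\<^sub>R J h)"
    using H_deriv_mvt[OF assms(1)] by metis
  then show ?thesis using assms(2) by (simp add: abs_mult mult_left_mono)
qed

text \<open>An increment along \<open>h + k\<close> is one along \<open>h\<close> followed by one
  along \<open>k\<close> from a moving base point. The mean value theorem and continuity of the
  derivative along \<open>k\<close> identify the limit of the latter. Homogeneity is the chain
  rule.\<close>

lemma linear_H_deriv:
  fixes J :: "'h::real_normed_vector \<Rightarrow> 'a::real_normed_vector"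
  assumes J: "linear J" and g: "H_C1 J g"
  shows "linear (\<lambda>h. H_deriv J h g x)"
proof (rule linearI)
  interpret J: linear J by (rule J)
  have df: "H_differentiable J h g" and ct: "isCont (H_deriv J h g) y" for h y
    using g by (auto simp: H_C1_def continuous_on_eq_continuous_at)
  fix h k :: 'h and c :: real
  have "((\<lambda>s. g (x + s *\<^sub>R J (h + k))) has_field_derivative H_deriv J h g x + H_deriv J k g x) (at 0)"
  proof -
    have "\<exists>\<xi>. \<bar>\<xi>\<bar> \<le> \<bar>s\<bar> \<and> g (x + s *\<^sub>R J h + s *\<^sub>R J k) - g (x + s *\<^sub>R J h)
        = s * H_deriv J k g (x + s *\<^sub>R J h + \<xi> *\<^sub>R J k)" for s
      using H_deriv_mvt[OF df[of k], of s "x + s *\<^sub>R J h"] by metis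
    then obtain \<xi> where \<xi>: "\<And>s. \<bar>\<xi> s\<bar> \<le> \<bar>s\<bar>"
        "\<And>s. g (x + s *\<^sub>R J h + s *\<^sub>R J k) - g (x + s *\<^sub>R J h) = s * H_deriv J k g (x + s *\<^sub>R J h + \<xi> s *\<^sub>R J k)"
      by metis
    have "(\<xi> \<longlongrightarrow> 0) (at 0)"
      by (rule Lim_null_comparison[of _ "\<lambda>s. \<bar>s\<bar>"]) (use \<xi>(1) in \<open>auto intro!: tendsto_eq_intros\<close>)
    then have "((\<lambda>s. x + s *\<^sub>R J h + \<xi> s *\<^sub>R J k) \<longlongrightarrow> x) (at 0)"
      by (auto intro!: tendsto_eq_intros)
    then have "((\<lambda>s. H_deriv J k g (x + s *\<^sub>R J h + \<xi> s *\<^sub>R J k)) \<longlongrightarrow> H_deriv J k g x) (at 0)"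
      by (rule isCont_tendsto_compose[OF ct])
    moreover have "((\<lambda>s. (g (x + s *\<^sub>R J h) - g x) / s) \<longlongrightarrow> H_deriv J h g x) (at 0)"
      using H_differentiable_DERIV_0[OF df[of h], of x] by (simp add: DERIV_def)
    ultimately have "((\<lambda>s. (g (x + s *\<^sub>R J h) - g x) / s + H_deriv J k g (x + s *\<^sub>R J h + \<xi> s *\<^sub>R J k))
        \<longlongrightarrow> H_deriv J h g x + H_deriv J k g x) (at 0)"
      by (intro tendsto_add)
    moreover have "\<forall>\<^sub>F s in at 0. (g (x + s *\<^sub>R J h) - g x) / s + H_deriv J k g (x + s *\<^sub>R J h + \<xi> s *\<^sub>R J k)
        = (g (x + s *\<^sub>R J (h + k)) - g x) / s"
      using eventually_neq_at_within[of 0]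
    proof eventually_elim
      case (elim s)
      then show ?case using \<xi>(2)[of s] by (simp add: J.add scaleR_add_right field_simps)
    qed
    ultimately have "((\<lambda>s. (g (x + s *\<^sub>R J (h + k)) - g x) / s) \<longlongrightarrow> H_deriv J h g x + H_deriv J k g x) (at 0)"
      by (rule Lim_transform_eventually)
    then show ?thesis by (simp add: DERIV_def)
  qed
  then show "H_deriv J (h + k) g x = H_deriv J h g x + H_deriv J k g x"
    by (rule H_deriv_eqI)
  have "((\<lambda>s. g (x + (s * c) *\<^sub>R J h)) has_field_derivative H_deriv J h g (x + (0 * c) *\<^sub>R J h) * c) (at 0)"
    by (rule DERIV_chain2[OF H_differentiable_DERIV[OF df[of h]]]) (auto intro!: derivative_eq_intros)
  then have "((\<lambda>s. g (x + s *\<^sub>R J (c *\<^sub>R h))) has_field_derivative H_deriv J h g x * c) (at 0)"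
    by (simp add: J.scaleR mult.commute)
  then show "H_deriv J (c *\<^sub>R h) g x = c *\<^sub>R H_deriv J h g x"
    using H_deriv_eqI by fastforce
qed

section \<open>Functions with bounded continuous derivatives of all orders along
  \<open>H\<close>\<close>

definition H_smooth :: "('h::real_normed_vector \<Rightarrow> 'a::real_normed_vector) \<Rightarrow> ('a \<Rightarrow> real) \<Rightarrow> bool" where
  "H_smooth J g \<longleftrightarrow> (\<forall>hs h. H_differentiable J h (H_derivs J hs g) \<and> H_derivs J hs g \<in> bcontfun)"

lemma bcontfun_continuous: "g \<in> bcontfun \<Longrightarrow> continuous_on UNIV g"
  by (simp add: bcontfun_def)

lemma H_smooth_C1:
  assumes "H_smooth J g"
  shows "H_C1 J (H_derivs J hs g)"
  using assms unfolding H_smooth_def H_C1_def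
  by (metis H_derivs.simps(2) bcontfun_continuous)

lemma H_derivs_lin:
  assumes "H_smooth J f" "H_smooth J g"
  shows "H_derivs J hs (\<lambda>x. a * f x + b * g x) = (\<lambda>x. a * H_derivs J hs f x + b * H_derivs J hs g x)"
proof (induction hs)
  case (Cons h hs)
  then show ?case
    using assms by (simp add: H_smooth_def H_deriv_lin)
qed simp

text \<open>The head slot is \<open>linear_H_deriv\<close>. In a later slot, linearity of the inner
  derivative at every point is an identity between functions, which the outer \<open>H_deriv\<close>
  preserves because it is linear in the function.\<close>

lemma linear_H_derivs:
  assumes J: "linear J" and g: "H_smooth J g" and i: "i < length hs"
  shows "linear (\<lambda>h. H_derivs J (hs[i := h]) g x)"
  using i
proof (induction hs arbitrary: i x)
  case (Cons a hs)
  show ?case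
  proof (cases i)
    case 0
    then show ?thesis using linear_H_deriv[OF J H_smooth_C1[OF g]] by simp
  next
    case (Suc j)
    let ?w = "\<lambda>h. H_derivs J (hs[j := h]) g"
    have lin: "linear (\<lambda>h. ?w h x)" for x using Cons Suc by auto
    have df: "H_differentiable J a (?w h)" for h using g by (simp add: H_smooth_def)
    show ?thesis
    proof (rule linearI)
      fix h k c
      have "?w (h + k) = (\<lambda>x. 1 * ?w h x + 1 * ?w k x)"
        using linear_add[OF lin] by (intro ext) simp
      then show "H_derivs J ((a # hs)[i := h + k]) g x = H_derivs J ((a # hs)[i := h]) g x + H_derivs J ((a # hs)[i := k]) g x"
        using H_deriv_lin[OF df[of h] df[of k], of 1 1] Suc by simp
      have "?w (c *\<^sub>R h) = (\<lambda>x. c * ?w h x + 0 * ?w h x)"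
        using linear_cmul[OF lin] by (intro ext) simp
      then show "H_derivs J ((a # hs)[i := c *\<^sub>R h]) g x = c *\<^sub>R H_derivs J ((a # hs)[i := h]) g x"
        using H_deriv_lin[OF df[of h] df[of h], of c 0] Suc by simp
    qed
  qed
qed simp

text \<open>For \<open>w \<ge> 0\<close> the Taylor polynomial \<open>w 0 + s w' + B s\<^sup>2 / 2\<close> is nonnegative, so its
  discriminant is not positive.\<close>

lemma nonneg_derivative_le:
  fixes w :: "real \<Rightarrow> real"
  assumes w: "\<And>s. (w has_field_derivative w' s) (at s)" and w': "\<And>s. (w' has_field_derivative w'' s) (at s)"
    and B: "\<And>s. \<bar>w'' s\<bar> \<le> B" and nonneg: "\<And>s. 0 \<le> w s"
  shows "(w' 0)\<^sup>2 \<le> 2 * B * w 0"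
proof -
  have B0: "0 \<le> B" using B[of 0] by linarith
  have taylor: "w s \<le> w 0 + w' 0 * s + B / 2 * s\<^sup>2" for s
  proof (cases "s = 0")
    case False
    define d where "d n = (if n = 0 then w else if n = 1 then w' else w'')" for n :: nat
    have "\<exists>t. (if s < 0 then s < t \<and> t < 0 else 0 < t \<and> t < s) \<and>
        w s = (\<Sum>m<2. d m 0 / fact m * (s - 0) ^ m) + d 2 t / fact 2 * (s - 0) ^ 2"
      using False w w'
      by (intro Taylor[of 2 d w "- \<bar>s\<bar>" "\<bar>s\<bar>" 0 s]) (auto simp: d_def less_2_cases_iff)
    then obtain t where "w s = w 0 + w' 0 * s + w'' t / 2 * s\<^sup>2"
      by (auto simp: d_def numeral_2_eq_2)
    moreover have "w'' t / 2 * s\<^sup>2 \<le> B / 2 * s\<^sup>2" using B[of t] by (intro mult_right_mono) auto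
    ultimately show ?thesis by simp
  qed simp
  have main: "(w' 0)\<^sup>2 \<le> 2 * b * w 0" if b: "b > 0" "b \<ge> B" for b
  proof -
    \<comment> \<open>The minimiser of the Taylor polynomial with \<open>b\<close> in place of
      \<open>B\<close>.\<close>
    define s where "s = - w' 0 / b"
    have "B / 2 * s\<^sup>2 \<le> b / 2 * s\<^sup>2" using b by (intro mult_right_mono) auto
    then have "0 \<le> w 0 + w' 0 * s + b / 2 * s\<^sup>2" using taylor[of s] nonneg[of s] by linarith
    then have "0 \<le> b * (w 0 + w' 0 * s + b / 2 * s\<^sup>2)" using b by simp
    then show ?thesis using b by (simp add: s_def power2_eq_square field_simps)
  qed
  show ?thesis
  proof (cases "B = 0")
    case True
    \<comment> \<open>Division by \<open>B\<close> is impossible here; small positive values of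
      \<open>b\<close> bound the square of \<open>w' 0\<close> by every positive
      \<open>e\<close>.\<close>
    have "(w' 0)\<^sup>2 \<le> 0 + e" if "e > 0" for e
    proof -
      have p: "w 0 + 1 > 0" using nonneg[of 0] by linarith
      have "(w' 0)\<^sup>2 \<le> 2 * (e / (2 * (w 0 + 1))) * w 0" using p that True by (intro main) (auto simp: field_simps)
      also have "\<dots> \<le> e" using p that nonneg[of 0] by (simp add: field_simps)
      finally show ?thesis by simp
    qed
    then have "(w' 0)\<^sup>2 \<le> 0" by (rule field_le_epsilon)
    then show ?thesis using True by simp
  qed (use main[of B] B0 in auto)
qed

section \<open>The semigroup\<close>

lemma bcontfun_boundE:
  fixes g :: "'a::topological_space \<Rightarrow> real"
  assumes "g \<in> bcontfun"
  obtains B where "0 \<le> B" "\<And>x. \<bar>g x\<bar> \<le> B"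
proof -
  obtain B where "\<And>x. \<bar>g x\<bar> \<le> B"
    using assms by (auto simp: bcontfun_def bounded_iff)
  then show thesis using that[of B] abs_ge_zero order_trans by blast
qed

lemma bcontfunI_real:
  fixes g :: "'a::topological_space \<Rightarrow> real"
  shows "continuous_on UNIV g \<Longrightarrow> (\<And>x. \<bar>g x\<bar> \<le> B) \<Longrightarrow> g \<in> bcontfun"
  by (rule bcontfun_normI) auto

lemma bcontfun_compose:
  fixes g :: "'a::topological_space \<Rightarrow> real" and s :: "'b::topological_space \<Rightarrow> 'a"
  assumes "g \<in> bcontfun" "continuous_on UNIV s"
  shows "(\<lambda>x. g (s x)) \<in> bcontfun"
proof -
  obtain B where "\<And>x. \<bar>g x\<bar> \<le> B" using bcontfun_boundE[OF assms(1)] by blast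
  moreover have "continuous_on UNIV (\<lambda>x. g (s x))"
    using continuous_on_compose2[OF bcontfun_continuous[OF assms(1)] assms(2)] by simp
  ultimately show ?thesis by (intro bcontfunI_real) auto
qed

lemma bcontfun_lin:
  fixes f g :: "'a::topological_space \<Rightarrow> real"
  assumes f: "f \<in> bcontfun" and g: "g \<in> bcontfun"
  shows "(\<lambda>x. a * f x + b * g x) \<in> bcontfun"
proof -
  obtain B where B: "\<And>x. \<bar>f x\<bar> \<le> B" using bcontfun_boundE[OF f] by blast
  obtain B' where B': "\<And>x. \<bar>g x\<bar> \<le> B'" using bcontfun_boundE[OF g] by blast
  show ?thesis
  proof (rule bcontfunI_real)
    show "continuous_on UNIV (\<lambda>x. a * f x + b * g x)"
      using f g by (intro continuous_intros bcontfun_continuous)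
    show "\<bar>a * f x + b * g x\<bar> \<le> \<bar>a\<bar> * B + \<bar>b\<bar> * B'" for x
      by (intro order_trans[OF abs_triangle_ineq] add_mono) (auto simp: abs_mult intro!: mult_left_mono B B')
  qed
qed

lemma continuous_on_UNIV_sequentiallyI:
  fixes g :: "'a::{first_countable_topology,t2_space} \<Rightarrow> 'b::topological_space"
  assumes "\<And>x u. u \<longlonglongrightarrow> x \<Longrightarrow> (\<lambda>n. g (u n)) \<longlonglongrightarrow> g x"
  shows "continuous_on UNIV g"
  using assms by (auto simp: continuous_on_eq_continuous_at intro!: continuous_at_sequentiallyI)

text \<open>As \<open>P\<^sub>t = P\<^sub>1 P\<^sub>t\<^sub>-\<^sub>1\<close> for \<open>t > 1\<close>, bounds for \<open>t \<le> 1\<close> suffice and the growth \<open>e\<^sup>\<omega>\<^sup>t\<close> of the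
  hypotheses plays no role.\<close>

locale smoothing_mehler = generalized_mehler T \<mu>
  for T :: "real \<Rightarrow> 'a::{banach,second_countable_topology} \<Rightarrow>\<^sub>L 'a" and \<mu> +
  fixes J :: "'h::real_normed_vector \<Rightarrow> 'a" and S :: "real \<Rightarrow> 'h \<Rightarrow> 'h" and \<Lambda> \<Gamma> \<theta> :: real
  assumes J: "bounded_linear J"
    and T_J: "\<And>t h. 0 < t \<Longrightarrow> T t (J h) = J (S t h)"
    and norm_S: "\<And>t h. 0 < t \<Longrightarrow> t \<le> 1 \<Longrightarrow> norm (S t h) \<le> \<Lambda> * norm h"
    and density: "\<And>t h. 0 < t \<Longrightarrow> t \<le> 1 \<Longrightarrow> \<exists>\<beta>. fomin_density (\<mu> t) (T t (J h)) \<beta> \<and>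
      (LINT y|\<mu> t. \<bar>\<beta> y\<bar>) \<le> \<Gamma> * t powr (- \<theta>) * norm h"
    and pos: "0 < \<Lambda>" "0 < \<Gamma>" "0 < \<theta>"
begin

abbreviation "P \<equiv> mehler T \<mu>"

lemma measurable_mu: "0 \<le> t \<Longrightarrow> borel_measurable (\<mu> t) = borel_measurable borel"
  by (rule measurable_cong_sets[OF sets_mu refl])

lemma continuous_borel: "continuous_on UNIV g \<Longrightarrow> g \<in> borel_measurable borel"
  by (rule borel_measurable_continuous_onI)

lemma integrable_bcontfun:
  assumes "g \<in> bcontfun" "0 \<le> t"
  shows "integrable (\<mu> t) (g :: 'a \<Rightarrow> real)"
proof -
  interpret prob_space "\<mu> t" using assms prob_space_mu by blast
  obtain B where "\<And>x. \<bar>g x\<bar> \<le> B" using bcontfun_boundE[OF assms(1)] by blast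
  then show ?thesis
    using assms by (intro integrable_const_bound[of _ B]) (auto simp: measurable_mu continuous_borel bcontfun_continuous)
qed

section \<open>Positivity, contraction and the semigroup law\<close>

lemma P_integrable: "g \<in> bcontfun \<Longrightarrow> 0 \<le> t \<Longrightarrow> integrable (\<mu> t) (\<lambda>y. (g (T t x + y) :: real))"
  by (rule integrable_bcontfun, erule bcontfun_compose) (auto intro: continuous_intros)

lemma P_lin:
  "f \<in> bcontfun \<Longrightarrow> g \<in> bcontfun \<Longrightarrow> 0 \<le> t \<Longrightarrow> P t (\<lambda>x. a * f x + b * g x) x = a * P t f x + b * P t g x"
  using P_integrable[of f t x] P_integrable[of g t x] by (simp add: mehler_def)

lemma P_mono:
  "f \<in> bcontfun \<Longrightarrow> g \<in> bcontfun \<Longrightarrow> 0 \<le> t \<Longrightarrow> (\<And>x. f x \<le> g x) \<Longrightarrow> P t f x \<le> P t g x"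
  unfolding mehler_def by (rule integral_mono) (auto intro: P_integrable)

lemma const_bcontfun_real: "(\<lambda>_::'a. c::real) \<in> bcontfun"
  by (rule bcontfunI_real[of _ "\<bar>c\<bar>"]) (auto intro: continuous_intros)

lemma P_const: "0 \<le> t \<Longrightarrow> P t (\<lambda>_. c) x = c"
  using prob_space.prob_space[OF prob_space_mu] by (simp add: mehler_def)

lemma P_abs_le:
  assumes "f \<in> bcontfun" "g \<in> bcontfun" "0 \<le> t" "\<And>x. \<bar>f x\<bar> \<le> g x"
  shows "\<bar>P t f x\<bar> \<le> P t g x"
proof -
  have "f x \<le> g x" "- g x \<le> f x" for x using assms(4)[of x] by auto
  then have "P t f x \<le> P t g x" "P t (\<lambda>x. (-1) * g x + 0 * g x) x \<le> P t f x"
    using assms by (auto intro!: P_mono bcontfun_lin[of g g "-1" 0, simplified])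
  then show ?thesis using P_lin[OF assms(2,2,3), of "-1" 0] by (auto simp: abs_le_iff)
qed

lemma P_abs_le_const: "f \<in> bcontfun \<Longrightarrow> 0 \<le> t \<Longrightarrow> (\<And>x. \<bar>f x\<bar> \<le> B) \<Longrightarrow> \<bar>P t f x\<bar> \<le> B"
  using P_abs_le[of f "\<lambda>_. B" t x] P_const[of t B x] const_bcontfun_real by simp

lemma P_nonneg: "(\<And>x. 0 \<le> g x) \<Longrightarrow> 0 \<le> P t g x"
  by (simp add: mehler_def)

lemma P_bcontfun:
  assumes f: "f \<in> bcontfun" and t: "0 \<le> t"
  shows "P t f \<in> bcontfun"
proof -
  obtain B where B: "\<And>x. \<bar>f x\<bar> \<le> B" using bcontfun_boundE[OF f] by blast
  show ?thesis
  proof (rule bcontfunI_real)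
    show "\<bar>P t f x\<bar> \<le> B" for x using P_abs_le_const[OF f t B] .
    show "continuous_on UNIV (P t f)"
    proof (rule continuous_on_UNIV_sequentiallyI)
      fix x u assume u: "u \<longlonglongrightarrow> (x::'a)"
      interpret prob_space "\<mu> t" using t prob_space_mu by blast
      show "(\<lambda>n. P t f (u n)) \<longlonglongrightarrow> P t f x"
        unfolding mehler_def
      proof (rule integral_dominated_convergence[where w="\<lambda>_. B"])
        show "AE y in \<mu> t. (\<lambda>n. f (T t (u n) + y)) \<longlonglongrightarrow> f (T t x + y)"
        proof (intro AE_I2 continuous_on_tendsto_compose[OF bcontfun_continuous[OF f]])
          show "(\<lambda>n. T t (u n) + y) \<longlonglongrightarrow> T t x + y" for y
            by (intro tendsto_intros u)
        qed auto
      qed (use P_integrable[OF f t] B in auto)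
    qed
  qed
qed

lemma P_shift: "P t (\<lambda>x. f (x + T t z)) x = P t f (x + z)"
  by (simp add: mehler_def blinfun.add_right algebra_simps)

text \<open>Jensen's inequality for the square root, read off from the nonnegativity of the
  variance. It lets the square roots of the first order estimate pass through the semigroup when
  that estimate is iterated.\<close>

lemma P_sqrt_le:
  assumes r: "r \<in> bcontfun" "\<And>x. 0 \<le> r x" and t: "0 \<le> t"
  shows "P t (\<lambda>x. sqrt (r x)) x \<le> sqrt (P t r x)"
proof -
  interpret prob_space "\<mu> t" using t prob_space_mu by blast
  let ?X = "\<lambda>y. sqrt (r (T t x + y))"
  have sq: "(\<lambda>x. sqrt (r x)) \<in> bcontfun"
  proof -
    obtain B where B: "\<And>x. \<bar>r x\<bar> \<le> B" using bcontfun_boundE[OF r(1)] by blast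
    have "continuous_on UNIV (\<lambda>x. sqrt (r x))"
      using bcontfun_continuous[OF r(1)] by (rule continuous_on_real_sqrt)
    moreover have "\<bar>sqrt (r x)\<bar> \<le> sqrt B" for x
      using B[of x] r(2)[of x] by simp
    ultimately show ?thesis by (rule bcontfunI_real)
  qed
  have "variance ?X = expectation (\<lambda>y. (?X y)\<^sup>2) - (expectation ?X)\<^sup>2"
    using P_integrable[OF sq t] P_integrable[OF r(1) t] r(2) by (intro variance_eq) auto
  moreover have "0 \<le> variance ?X" by (rule variance_positive)
  ultimately have "(P t (\<lambda>x. sqrt (r x)) x)\<^sup>2 \<le> P t r x"
    using r(2) by (simp add: mehler_def)
  then show ?thesis by (rule real_le_rsqrt)
qed

text \<open>Under the skew convolution a point of \<open>\<mu> (t + s)\<close> is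
  \<open>T s y + z\<close> with \<open>y\<close> and \<open>z\<close> independent, distributed by
  \<open>\<mu> t\<close> and \<open>\<mu> s\<close>. Fubini and
  \<open>T (t + s) x + T s y + z = T s (T t x + y) + z\<close> give the iterated integral.\<close>

lemma P_semigroup:
  assumes f: "f \<in> bcontfun" and s: "0 < s" and t: "0 < t"
  shows "P (t + s) f = P t (P s f)"
proof
  fix x
  interpret mt: prob_space "\<mu> t" using t prob_space_mu by simp
  interpret ms: prob_space "\<mu> s" using s prob_space_mu by simp
  have Tm: "blinfun_apply (T s) \<in> measurable (\<mu> t) borel"
    using t by (simp add: measurable_mu linear_continuous_on blinfun.bounded_linear_right borel_measurable_continuous_onI)
  interpret D: prob_space "distr (\<mu> t) borel (T s)"
    by (rule mt.prob_space_distr[OF Tm])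
  interpret pair_prob_space "distr (\<mu> t) borel (T s)" "\<mu> s" ..
  have fm: "f \<in> borel_measurable borel" using f by (simp add: bcontfun_continuous continuous_borel)
  \<comment> \<open>By second countability the product of the Borel algebras is the Borel algebra of
    the product, so addition is measurable for the product measure.\<close>
  have sb: "sets (distr (\<mu> t) borel (T s) \<Otimes>\<^sub>M \<mu> s) = sets (borel :: ('a \<times> 'a) measure)"
    using s by (simp add: borel_prod[symmetric] sets_mu cong: sets_pair_measure_cong)
  have pm: "(\<lambda>p. g (fst p + snd p)) \<in> borel_measurable (distr (\<mu> t) borel (T s) \<Otimes>\<^sub>M \<mu> s)"
    if "g \<in> borel_measurable borel" for g :: "'a \<Rightarrow> 'b::topological_space"
    unfolding measurable_cong_sets[OF sb refl]
    by (intro measurable_compose[OF _ that] borel_measurable_continuous_onI continuous_intros)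
  define g where "g y = f (T (t + s) x + y)" for y
  have gb: "g \<in> bcontfun" unfolding g_def by (intro bcontfun_compose[OF f] continuous_intros)
  obtain B where B: "\<And>x. \<bar>g x\<bar> \<le> B" using bcontfun_boundE[OF gb] by blast
  have gm: "g \<in> borel_measurable borel" using gb by (simp add: bcontfun_continuous continuous_borel)
  have int: "integrable (distr (\<mu> t) borel (T s) \<Otimes>\<^sub>M \<mu> s) (\<lambda>p. g (fst p + snd p))"
    using B by (intro integrable_const_bound[of _ B] pm gm) auto
  have "P (t + s) f x = (LINT p|(distr (\<mu> t) borel (T s) \<Otimes>\<^sub>M \<mu> s). g (fst p + snd p))"
    unfolding mehler_def mu_skew_convolution[OF s t] g_def[symmetric]
    using pm[of "\<lambda>y. y"] gm by (subst integral_distr) (auto simp: case_prod_beta')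
  also have "\<dots> = (LINT y|(distr (\<mu> t) borel (T s)). LINT z|\<mu> s. g (y + z))"
    using integral_fst'[OF int] by simp
  also have "\<dots> = (LINT y|\<mu> t. LINT z|\<mu> s. g (T s y + z))"
  proof (rule integral_distr[OF Tm])
    show "(\<lambda>y. LINT z|\<mu> s. g (y + z)) \<in> borel_measurable borel"
    proof (rule ms.borel_measurable_lebesgue_integral)
      have sb': "sets (borel \<Otimes>\<^sub>M \<mu> s) = sets (borel :: ('a \<times> 'a) measure)"
        using s by (simp add: borel_prod[symmetric] sets_mu cong: sets_pair_measure_cong)
      show "(\<lambda>(y, z). g (y + z)) \<in> borel_measurable (borel \<Otimes>\<^sub>M \<mu> s)"
        unfolding measurable_cong_sets[OF sb' refl] case_prod_beta'
        by (intro measurable_compose[OF _ gm] borel_measurable_continuous_onI continuous_intros)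
    qed
  qed
  also have "\<dots> = P t (P s f) x"
    using T_add[of s t] s t
    by (simp add: mehler_def g_def blinfun.add_right add.commute[of t s] algebra_simps)
  finally show "P (t + s) f x = P t (P s f) x" .
qed

section \<open>Derivatives produced by the semigroup\<close>

definition \<kappa> :: "real \<Rightarrow> real" where "\<kappa> t = min t 1 powr (- \<theta>)"

lemma \<kappa>_ge_1: "0 < t \<Longrightarrow> 1 \<le> \<kappa> t"
  unfolding \<kappa>_def using pos powr_mono2'[of "- \<theta>" "min t 1" 1] by simp

lemma J_linear: "linear J" using J by (rule bounded_linear.linear)

lemma T_line: "0 < t \<Longrightarrow> T t (x + s *\<^sub>R J h) = T t x + s *\<^sub>R J (S t h)"
  by (simp add: blinfun.add_right blinfun.scaleR_right T_J)

text \<open>Moving \<open>x\<close> by \<open>s J h\<close> translates the integrand by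
  \<open>s T_t J h\<close>, so \<open>fomin_derivative\<close> expresses the derivative as an
  integral of \<open>f\<close> against \<open>\<beta>\<close>. The bound and continuity follow from
  this formula, with \<open>B\<close> times the modulus of \<open>\<beta>\<close> as dominating
  function.\<close>

lemma P_first_order_small:
  assumes t: "0 < t" "t \<le> 1" and f: "f \<in> bcontfun" and B: "\<And>x. \<bar>f x\<bar> \<le> B"
  shows "H_differentiable J h (P t f)" "H_deriv J h (P t f) \<in> bcontfun"
    "\<bar>H_deriv J h (P t f) x\<bar> \<le> \<Gamma> * t powr (- \<theta>) * norm h * B"
proof -
  interpret prob_space "\<mu> t" using t prob_space_mu by simp
  obtain \<beta> where \<beta>: "fomin_density (\<mu> t) (T t (J h)) \<beta>" "(LINT y|\<mu> t. \<bar>\<beta> y\<bar>) \<le> \<Gamma> * t powr (- \<theta>) * norm h"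
    using density[OF t] by blast
  have int: "integrable (\<mu> t) \<beta>" using \<beta> by (simp add: fomin_density_def)
  have fx: "(\<lambda>y. f (T t x + y)) \<in> borel_measurable borel" for x
    by (intro continuous_borel bcontfun_continuous bcontfun_compose[OF f] continuous_intros)
  have D: "((\<lambda>s. P t f (x + s *\<^sub>R J h)) has_field_derivative - (LINT y|\<mu> t. f (T t x + y) * \<beta> y)) (at 0)" for x
    using fomin_derivative[OF prob_space_axioms sets_mu \<beta>(1) fx B] t
    by (simp add: mehler_def blinfun.add_right blinfun.scaleR_right algebra_simps)
  show "H_differentiable J h (P t f)" using D by (rule H_differentiableI)
  have eq: "H_deriv J h (P t f) x = - (LINT y|\<mu> t. f (T t x + y) * \<beta> y)" for x
    by (intro H_deriv_eqI D)
  have fi: "integrable (\<mu> t) (\<lambda>y. f (T t x + y) * \<beta> y)" for x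
    using t by (intro integrable_bounded_density[OF prob_space_axioms sets_mu \<beta>(1) fx B]) simp
  have B0: "0 \<le> B" using B[of 0] by linarith
  have bd: "\<bar>H_deriv J h (P t f) x\<bar> \<le> \<Gamma> * t powr (- \<theta>) * norm h * B" for x
  proof -
    have "\<bar>LINT y|\<mu> t. f (T t x + y) * \<beta> y\<bar> \<le> (LINT y|\<mu> t. \<bar>f (T t x + y) * \<beta> y\<bar>)"
      by (rule integral_abs_bound)
    also have "\<dots> \<le> (LINT y|\<mu> t. B * \<bar>\<beta> y\<bar>)"
    proof (rule integral_mono)
      show "\<bar>f (T t x + y) * \<beta> y\<bar> \<le> B * \<bar>\<beta> y\<bar>" for y
        using B by (simp add: abs_mult mult_right_mono)
    qed (use fi int in auto)
    also have "\<dots> \<le> B * (\<Gamma> * t powr (- \<theta>) * norm h)"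
      using \<beta>(2) B0 by (simp add: mult_left_mono)
    finally show ?thesis by (simp add: eq mult.commute)
  qed
  then show "\<bar>H_deriv J h (P t f) x\<bar> \<le> \<Gamma> * t powr (- \<theta>) * norm h * B" .
  show "H_deriv J h (P t f) \<in> bcontfun"
  proof (rule bcontfunI_real[OF _ bd], rule continuous_on_UNIV_sequentiallyI)
    fix x u assume u: "u \<longlonglongrightarrow> (x::'a)"
    have "(\<lambda>n. LINT y|\<mu> t. f (T t (u n) + y) * \<beta> y) \<longlonglongrightarrow> (LINT y|\<mu> t. f (T t x + y) * \<beta> y)"
    proof (rule integral_dominated_convergence[where w="\<lambda>y. B * \<bar>\<beta> y\<bar>"])
      show "AE y in \<mu> t. (\<lambda>n. f (T t (u n) + y) * \<beta> y) \<longlonglongrightarrow> f (T t x + y) * \<beta> y"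
        by (intro AE_I2 tendsto_mult tendsto_const continuous_on_tendsto_compose[OF bcontfun_continuous[OF f]] tendsto_add
            blinfun.tendsto u) auto
    qed (use fi int B in \<open>auto simp: abs_mult intro!: mult_right_mono\<close>)
    then show "(\<lambda>n. H_deriv J h (P t f) (u n)) \<longlonglongrightarrow> H_deriv J h (P t f) x"
      unfolding eq by (rule tendsto_minus)
  qed
qed

lemma P_first_order:
  assumes t: "0 < t" and f: "f \<in> bcontfun"
  shows "H_differentiable J h (P t f)" (is ?A) "H_deriv J h (P t f) \<in> bcontfun" (is ?B)
    "(\<And>x. \<bar>f x\<bar> \<le> B) \<Longrightarrow> \<bar>H_deriv J h (P t f) x\<bar> \<le> \<Gamma> * \<kappa> t * norm h * B"
proof -
  have main: "?A \<and> ?B \<and> ((\<forall>x. \<bar>f x\<bar> \<le> B) \<longrightarrow> \<bar>H_deriv J h (P t f) x\<bar> \<le> \<Gamma> * \<kappa> t * norm h * B)" for B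
  proof (cases "t \<le> 1")
    case True
    obtain B' where "\<And>x. \<bar>f x\<bar> \<le> B'" using bcontfun_boundE[OF f] by blast
    then show ?thesis
      using P_first_order_small[OF t True f, of B'] P_first_order_small(3)[OF t True f] True t by (auto simp: \<kappa>_def)
  next
    case False
    \<comment> \<open>Beyond time 1 only the last unit of time is used for smoothing;
      \<open>P (t - 1)\<close> does not increase the sup norm and
      \<open>\<kappa> t = 1\<close>.\<close>
    define g where "g = P (t - 1) f"
    have g: "g \<in> bcontfun" unfolding g_def using False f by (intro P_bcontfun) auto
    have eq: "P t f = P 1 g" using P_semigroup[OF f, of "t - 1" 1] False by (simp add: g_def)
    obtain B' where B': "\<And>x. \<bar>g x\<bar> \<le> B'" using bcontfun_boundE[OF g] by blast
    have "\<bar>g x\<bar> \<le> B" if "\<forall>x. \<bar>f x\<bar> \<le> B" for x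
      unfolding g_def using False f that by (intro P_abs_le_const) auto
    then show ?thesis
      using P_first_order_small[OF _ _ g B', of 1 h] P_first_order_small(3)[OF _ _ g, of 1 B] False
      unfolding eq by (simp add: \<kappa>_def)
  qed
  show ?A ?B using main by blast+
  show "\<bar>H_deriv J h (P t f) x\<bar> \<le> \<Gamma> * \<kappa> t * norm h * B" if "\<And>x. \<bar>f x\<bar> \<le> B" using main that by blast
qed

text \<open>\<open>T_line\<close> turns an increment along \<open>h\<close> outside the integral
  into one along \<open>S t h\<close> inside. The difference quotients are dominated by the sup of
  the inner derivative.\<close>

lemma H_deriv_P_commute:
  assumes t: "0 < t" and g: "g \<in> bcontfun" "H_differentiable J (S t h) g" "H_deriv J (S t h) g \<in> bcontfun"
  shows "H_deriv J h (P t g) = P t (H_deriv J (S t h) g)"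
proof
  fix x
  interpret prob_space "\<mu> t" using t prob_space_mu by simp
  obtain B where B: "\<And>x. \<bar>H_deriv J (S t h) g x\<bar> \<le> B" using bcontfun_boundE[OF g(3)] by blast
  have "((\<lambda>s. P t g (x + s *\<^sub>R J h)) has_field_derivative P t (H_deriv J (S t h) g) x) (at 0)"
    unfolding DERIV_def tendsto_at_iff_sequentially comp_def
  proof (intro allI impI)
    fix u :: "nat \<Rightarrow> real" assume u0: "\<forall>i. u i \<in> UNIV - {0}" and u: "u \<longlonglongrightarrow> 0"
    let ?q = "\<lambda>s y. (g (T t x + y + s *\<^sub>R J (S t h)) - g (T t x + y)) / s"
    have shift: "T t (x + s *\<^sub>R J h) + y = T t x + y + s *\<^sub>R J (S t h)" for s y
      by (simp add: T_line[OF t])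
    have i1: "integrable (\<mu> t) (\<lambda>y. g (T t x + y + s *\<^sub>R J (S t h)))" for s
      using P_integrable[OF g(1), of t "x + s *\<^sub>R J h"] t by (simp add: shift)
    have i2: "integrable (\<mu> t) (\<lambda>y. g (T t x + y))" using P_integrable[OF g(1)] t by simp
    have lim: "(\<lambda>i. LINT y|\<mu> t. ?q (u i) y) \<longlonglongrightarrow> (LINT y|\<mu> t. H_deriv J (S t h) g (T t x + y))"
    proof (rule integral_dominated_convergence[where w="\<lambda>_. B"])
      show "AE y in \<mu> t. (\<lambda>i. ?q (u i) y) \<longlonglongrightarrow> H_deriv J (S t h) g (T t x + y)"
      proof (intro AE_I2)
        fix y
        have "((\<lambda>s. ?q s y) \<longlongrightarrow> H_deriv J (S t h) g (T t x + y)) (at 0)"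
          using H_differentiable_DERIV_0[OF g(2), of "T t x + y"] by (simp add: DERIV_def)
        then show "(\<lambda>i. ?q (u i) y) \<longlonglongrightarrow> H_deriv J (S t h) g (T t x + y)"
          using u0 u by (auto simp: tendsto_at_iff_sequentially comp_def)
      qed
      show "AE y in \<mu> t. norm (?q (u i) y) \<le> B" for i
      proof (intro AE_I2)
        fix y
        have "\<bar>g (T t x + y + u i *\<^sub>R J (S t h)) - g (T t x + y)\<bar> \<le> \<bar>u i\<bar> * B"
          by (rule H_deriv_increment_le[OF g(2) B])
        then show "norm (?q (u i) y) \<le> B" using u0 by (simp add: divide_le_eq mult.commute)
      qed
      show "(\<lambda>y. ?q (u i) y) \<in> borel_measurable (\<mu> t)" for i
        using i1[of "u i"] i2 by (intro borel_measurable_divide borel_measurable_diff) auto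
      show "(\<lambda>y. H_deriv J (S t h) g (T t x + y)) \<in> borel_measurable (\<mu> t)"
        using P_integrable[OF g(3), of t x] t by auto
    qed simp
    have eq: "(LINT y|\<mu> t. ?q s y) = (P t g (x + s *\<^sub>R J h) - P t g x) / s" for s
      using i1[of s] i2 by (simp add: mehler_def shift)
    show "(\<lambda>i. (P t g (x + (0 + u i) *\<^sub>R J h) - P t g (x + 0 *\<^sub>R J h)) / u i) \<longlonglongrightarrow> P t (H_deriv J (S t h) g) x"
      using lim unfolding eq by (simp add: mehler_def[of T \<mu> t "H_deriv J (S t h) g"])
  qed
  then show "H_deriv J h (P t g) x = P t (H_deriv J (S t h) g) x"
    by (rule H_deriv_eqI)
qed

text \<open>The outer time \<open>a\<close> is at most 1, so that \<open>norm_S\<close> applies to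
  it, and \<open>b \<ge> a\<close>. Hence both rates exceed \<open>\<kappa> t\<close> by at most the
  factor \<open>2 powr \<theta>\<close>.\<close>

lemma P_split:
  assumes t: "0 < t" and f: "f \<in> bcontfun"
  defines "a \<equiv> min t 1 / 2"
  defines "b \<equiv> t - a"
  shows "0 < a" "0 < b" "a \<le> 1" "\<kappa> a = 2 powr \<theta> * \<kappa> t" "\<kappa> b \<le> 2 powr \<theta> * \<kappa> t"
    "H_deriv J h (P t f) = P a (H_deriv J (S a h) (P b f))"
    "P t f = P a (P b f)"
proof -
  show ab: "0 < a" "0 < b" "a \<le> 1" using t by (auto simp: a_def b_def min_def)
  show ka: "\<kappa> a = 2 powr \<theta> * \<kappa> t"
    using t by (auto simp: \<kappa>_def a_def powr_divide powr_minus min_def field_simps)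
  have "min a 1 \<le> min b 1" by (auto simp: a_def b_def min_def)
  then have "\<kappa> b \<le> \<kappa> a" unfolding \<kappa>_def using ab pos by (intro powr_mono2') auto
  then show "\<kappa> b \<le> 2 powr \<theta> * \<kappa> t" by (simp add: ka)
  show eq: "P t f = P a (P b f)"
    using P_semigroup[OF f ab(2) ab(1)] by (simp add: b_def)
  show "H_deriv J h (P t f) = P a (H_deriv J (S a h) (P b f))"
    unfolding eq using ab f by (intro H_deriv_P_commute P_bcontfun P_first_order) auto
qed

text \<open>The innermost derivative is absorbed first: by \<open>P_split\<close> it leaves
  \<open>P a g\<close> with a bounded continuous \<open>g\<close>, and the remaining derivatives are
  the same problem at time \<open>a\<close>. Therefore the induction runs from the end of the list
  with \<open>t\<close> and \<open>f\<close> arbitrary.\<close>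

lemma P_smooth:
  assumes "0 < t" "f \<in> bcontfun"
  shows "H_smooth J (P t f)"
proof -
  have "H_derivs J hs (P t f) \<in> bcontfun \<and> H_differentiable J k (H_derivs J hs (P t f))" for hs k
    using assms
  proof (induction hs arbitrary: t f rule: rev_induct)
    case Nil
    then show ?case by (simp add: P_bcontfun P_first_order)
  next
    case (snoc h hs)
    note split = P_split[OF snoc.prems]
    show ?case
      using snoc.IH[OF split(1), of "H_deriv J (S (min t 1 / 2) h) (P (t - min t 1 / 2) f)"]
        P_first_order[OF split(2) snoc.prems(2)]
      by (simp add: H_derivs_append split(6))
  qed
  then show ?thesis by (simp add: H_smooth_def)
qed

end

section \<open>Bounds for the derivatives of the semigroup\<close>

abbreviation halfline :: "real measure" where
  "halfline \<equiv> restrict_space lborel {0<..}"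

context smoothing_mehler
begin

text \<open>One derivative falls on \<open>P b f\<close> along \<open>S a h\<close>, the other on
  \<open>P a\<close>; each costs one application of \<open>P_first_order\<close>.\<close>

lemma P_second_order:
  assumes t: "0 < t" and f: "f \<in> bcontfun" and R: "\<And>x. \<bar>f x\<bar> \<le> R"
  shows "\<bar>H_deriv J h (H_deriv J h (P t f)) x\<bar> \<le> 2 * \<Lambda> * (\<Gamma> * 2 powr \<theta> * \<kappa> t * norm h)\<^sup>2 * R / 2"
proof -
  define a where "a = min t 1 / 2"
  define b where "b = t - a"
  note split = P_split[OF t f, folded a_def, folded b_def]
  define g where "g = H_deriv J (S a h) (P b f)"
  have g: "g \<in> bcontfun" unfolding g_def using split f by (intro P_first_order)
  have R0: "0 \<le> R" using R[of 0] by linarith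
  have "\<bar>g y\<bar> \<le> \<Gamma> * (2 powr \<theta> * \<kappa> t) * (\<Lambda> * norm h) * R" for y
  proof -
    have "\<bar>g y\<bar> \<le> \<Gamma> * \<kappa> b * norm (S a h) * R"
      unfolding g_def by (rule P_first_order(3)[OF split(2) f R])
    also have "\<dots> \<le> \<Gamma> * (2 powr \<theta> * \<kappa> t) * (\<Lambda> * norm h) * R"
      using split(5) norm_S[OF split(1,3), of h] pos R0 \<kappa>_ge_1[OF split(2)] \<kappa>_ge_1[OF t]
      by (intro mult_mono mult_nonneg_nonneg) auto
    finally show ?thesis .
  qed
  from P_first_order(3)[OF split(1) g this, of h]
  have "\<bar>H_deriv J h (P a g) x\<bar> \<le> \<Gamma> * (2 powr \<theta> * \<kappa> t) * norm h * (\<Gamma> * (2 powr \<theta> * \<kappa> t) * (\<Lambda> * norm h) * R)"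
    by (simp add: split(4))
  then show ?thesis
    using split(6)[of h] by (simp add: g_def power2_eq_square mult.assoc mult.left_commute)
qed

text \<open>\<open>nonneg_derivative_le\<close> along the line through \<open>x\<close> in direction
  \<open>J h\<close>, with \<open>P_second_order\<close> as curvature bound.\<close>

lemma P_first_order_nonneg:
  assumes t: "0 < t" and f: "f \<in> bcontfun" and f0: "\<And>x. 0 \<le> f x" and R: "\<And>x. f x \<le> R"
  shows "\<bar>H_deriv J h (P t f) x\<bar> \<le> sqrt (2 * \<Lambda>) * (\<Gamma> * 2 powr \<theta> * \<kappa> t * norm h) * sqrt (R * P t f x)"
proof -
  have sm: "H_smooth J (P t f)" using P_smooth[OF t f] .
  have df: "H_differentiable J h (P t f)" "H_differentiable J h (H_deriv J h (P t f))"
    using sm[unfolded H_smooth_def, rule_format, of h "[]"] sm[unfolded H_smooth_def, rule_format, of h "[h]"] by auto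
  have R': "\<bar>f x\<bar> \<le> R" for x using f0 R by simp
  let ?c = "\<Gamma> * 2 powr \<theta> * \<kappa> t * norm h"
  have "(H_deriv J h (P t f) (x + 0 *\<^sub>R J h))\<^sup>2 \<le> 2 * (2 * \<Lambda> * ?c\<^sup>2 * R / 2) * P t f (x + 0 *\<^sub>R J h)"
    by (rule nonneg_derivative_le[OF H_differentiable_DERIV[OF df(1)] H_differentiable_DERIV[OF df(2)]
          P_second_order[OF t f R'] P_nonneg[OF f0]])
  then have "(H_deriv J h (P t f) x)\<^sup>2 \<le> 2 * \<Lambda> * ?c\<^sup>2 * (R * P t f x)" by (simp add: mult_ac)
  then have "\<bar>H_deriv J h (P t f) x\<bar> \<le> sqrt (2 * \<Lambda> * ?c\<^sup>2 * (R * P t f x))"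
    by (intro real_le_rsqrt) simp
  also have "\<dots> = sqrt (2 * \<Lambda>) * ?c * sqrt (R * P t f x)"
    using pos \<kappa>_ge_1[OF t] by (simp add: real_sqrt_mult)
  finally show ?thesis .
qed

definition c1 :: real where "c1 = 2 * sqrt (2 * \<Lambda>) * \<Gamma> * 2 powr \<theta>"

lemma c1_nonneg: "0 \<le> c1" using pos by (simp add: c1_def)

text \<open>The positive and negative parts of \<open>f\<close> both lie between 0 and
  \<open>r\<close>, so \<open>P_first_order_nonneg\<close> applies to each; their sum accounts for
  the factor 2 in \<open>c1\<close>.\<close>

lemma P_first_order_dominated:
  assumes t: "0 < t" and f: "f \<in> bcontfun" and r: "r \<in> bcontfun" and fr: "\<And>x. \<bar>f x\<bar> \<le> r x" and R: "\<And>x. r x \<le> R"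
  shows "\<bar>H_deriv J h (P t f) x\<bar> \<le> c1 * \<kappa> t * norm h * sqrt (R * P t r x)"
proof -
  have R0: "0 \<le> R" using fr[of 0] R[of 0] by linarith
  have part: "(\<lambda>x. max (s * f x) 0) \<in> bcontfun" for s :: real
  proof -
    obtain B where B: "\<And>x. \<bar>f x\<bar> \<le> B" using bcontfun_boundE[OF f] by blast
    have "\<bar>max (s * f x) 0\<bar> \<le> \<bar>s\<bar> * B" for x
    proof -
      have "\<bar>max (s * f x) 0\<bar> \<le> \<bar>s * f x\<bar>" by auto
      also have "\<dots> \<le> \<bar>s\<bar> * B" using B[of x] by (simp add: abs_mult mult_left_mono)
      finally show ?thesis .
    qed
    moreover have "continuous_on UNIV (\<lambda>x. max (s * f x) 0)"
      using bcontfun_continuous[OF f] by (intro continuous_on_max continuous_on_mult continuous_on_const)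
    ultimately show ?thesis by (rule bcontfunI_real[rotated])
  qed
  define p where "p s = (\<lambda>x. max (s * f x) 0)" for s :: real
  have p: "p s \<in> bcontfun" for s unfolding p_def by (rule part)
  have le: "p s x \<le> r x" if "\<bar>s\<bar> = 1" for s x
    using fr[of x] that by (auto simp: p_def abs_if split: if_splits)
  have bnd: "\<bar>H_deriv J h (P t (p s)) x\<bar> \<le> c1 / 2 * \<kappa> t * norm h * sqrt (R * P t r x)" if s: "\<bar>s\<bar> = 1" for s
  proof -
    have "\<bar>H_deriv J h (P t (p s)) x\<bar> \<le> sqrt (2 * \<Lambda>) * (\<Gamma> * 2 powr \<theta> * \<kappa> t * norm h) * sqrt (R * P t (p s) x)"
      using le[OF s] R by (intro P_first_order_nonneg t p) (auto simp: p_def intro: order_trans)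
    also have "\<dots> = c1 / 2 * \<kappa> t * norm h * sqrt (R * P t (p s) x)" by (simp add: c1_def)
    also have "\<dots> \<le> c1 / 2 * \<kappa> t * norm h * sqrt (R * P t r x)"
      using c1_nonneg \<kappa>_ge_1[OF t] R0 P_mono[OF p r _ le[OF s], of t] t
      by (intro mult_left_mono) (auto intro!: mult_left_mono)
    finally show ?thesis .
  qed
  have "f = (\<lambda>x. 1 * p 1 x + (-1) * p (-1) x)" by (auto simp: p_def max_def)
  then have "P t f = (\<lambda>x. 1 * P t (p 1) x + (-1) * P t (p (-1)) x)"
    using P_lin[OF p p, of t 1 1 "-1" "-1"] t by auto
  then have "H_deriv J h (P t f) x = H_deriv J h (P t (p 1)) x - H_deriv J h (P t (p (-1))) x"
    using H_deriv_lin[OF P_first_order(1)[OF t p] P_first_order(1)[OF t p], of h 1 1 "-1" "-1"] by simp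
  then show ?thesis using bnd[of 1] bnd[of "-1"] by simp
qed

text \<open>The constants of the induction in \<open>P_bound_dominated\<close>: the \<open>n\<close>
  outer derivatives act at time \<open>a\<close> and pay \<open>2 powr \<theta>\<close> each, and
  the last factor is the cost of the innermost derivative.\<close>

primrec dconst :: "nat \<Rightarrow> real" where
  "dconst 0 = 1"
| "dconst (Suc n) = dconst n * (2 powr \<theta>) ^ n * (c1 * 2 powr \<theta> * \<Lambda>)"

lemma dconst_nonneg: "0 \<le> dconst n"
  using pos c1_nonneg by (induction n) auto

lemma prod_list_norm_nonneg: "0 \<le> prod_list (map norm hs)"
  by (induction hs) auto

text \<open>The exponent arithmetic of one induction step of \<open>P_bound_dominated\<close>: one
  more derivative halves the exponent \<open>e\<close> of \<open>p\<close> and contributes a single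
  factor \<open>c\<close>.\<close>

lemma powr_interpolate:
  fixes c R p e :: real
  assumes "0 \<le> c" "0 \<le> R" "0 \<le> p"
  shows "(c * R) powr (1 - e) * (c * sqrt R * sqrt p) powr e = c * (R powr (1 - e / 2) * p powr (e / 2))"
proof -
  have sq: "sqrt x powr e = x powr (e / 2)" if "0 \<le> x" for x
    using that by (simp add: powr_half_sqrt[symmetric] powr_powr)
  have "c powr (1 - e) * c powr e = c" using assms by (simp add: powr_add[symmetric])
  moreover have "R powr (1 - e) * R powr (e / 2) = R powr (1 - e / 2)"
    by (simp add: powr_add[symmetric] field_simps)
  ultimately show ?thesis
    using assms by (simp add: powr_mult sq mult_ac) (metis (no_types, lifting) mult.assoc mult.commute)
qed

text \<open>Peeling off the innermost derivative leaves \<open>P a g\<close>, where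
  \<open>P_first_order_dominated\<close> bounds \<open>g\<close> by \<open>r'\<close>, a multiple of
  the square root of \<open>P b r\<close>. The induction hypothesis applies to \<open>g\<close>,
  \<open>r'\<close> and the new ceiling \<open>c R\<close>. The ratio of dominating function to
  ceiling is replaced by its square root each time, whence the exponent
  \<open>(1 / 2) ^ n\<close>.\<close>

lemma P_bound_dominated:
  fixes hs :: "'h list"
  assumes "0 < t" "f \<in> bcontfun" "r \<in> bcontfun" "\<And>x. \<bar>f x\<bar> \<le> r x" "\<And>x. r x \<le> R"
  defines "e \<equiv> (1 / 2) ^ length hs"
  shows "\<bar>H_derivs J hs (P t f) x\<bar> \<le> dconst (length hs) * \<kappa> t ^ length hs * prod_list (map norm hs) *
    (R powr (1 - e) * P t r x powr e)"
  unfolding e_def using assms(1-5)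
proof (induction hs arbitrary: t f r R x rule: rev_induct)
  case Nil
  \<comment> \<open>Since \<open>0 powr 0 = 0\<close>, the factor \<open>R powr 0\<close> is 1 only
    for nonzero \<open>R\<close>; for \<open>R = 0\<close> both sides vanish.\<close>
  have "R = 0 \<Longrightarrow> P t r x = 0"
  proof -
    assume "R = 0"
    then have "r y = 0" for y using Nil(4)[of y] Nil(5)[of y] by linarith
    then show ?thesis by (simp add: mehler_def)
  qed
  moreover have "0 \<le> r y" for y using Nil(4)[of y] by linarith
  moreover have "0 \<le> R" using calculation(2)[of x] Nil(5)[of x] by linarith
  ultimately show ?case
    using P_abs_le[OF Nil(2,3), of t x] P_nonneg[of r t x] Nil(1,4) by (cases "R = 0") auto
next
  case (snoc h hs)
  define a where "a = min t 1 / 2"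
  define b where "b = t - a"
  note split = P_split[OF snoc.prems(1,2), folded a_def, folded b_def]
  note split' = P_split[OF snoc.prems(1,3), folded a_def, folded b_def]
  define g where "g = H_deriv J (S a h) (P b f)"
  define c where "c = c1 * (2 powr \<theta> * \<kappa> t) * (\<Lambda> * norm h)"
  define r' where "r' x = c * sqrt R * sqrt (P b r x)" for x
  define e :: real where "e = (1 / 2) ^ length hs"
  have r0: "0 \<le> r x" for x using snoc.prems(4)[of x] by linarith
  have R0: "0 \<le> R" using r0[of 0] snoc.prems(5)[of 0] by linarith
  have k1: "1 \<le> \<kappa> t" using \<kappa>_ge_1 snoc.prems by simp
  have c0: "0 \<le> c" using c1_nonneg pos k1 by (simp add: c_def)
  have Pb: "P b r \<in> bcontfun" "0 \<le> P b r x" "P b r x \<le> R" for x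
    using P_bcontfun[OF snoc.prems(3)] split(2) P_nonneg[OF r0] P_abs_le_const[OF snoc.prems(3), of b R x] r0 snoc.prems(5)
    by auto
  have sqb: "(\<lambda>x. sqrt (P b r x)) \<in> bcontfun"
    using Pb(2,3) continuous_on_real_sqrt[OF bcontfun_continuous[OF Pb(1)]]
    by (intro bcontfunI_real[of _ "sqrt R"]) auto
  have g: "g \<in> bcontfun" unfolding g_def using split snoc.prems by (intro P_first_order)
  have r': "r' \<in> bcontfun"
    using bcontfun_lin[OF sqb sqb, of "c * sqrt R" 0] by (simp add: r'_def[abs_def])
  have gr: "\<bar>g y\<bar> \<le> r' y" for y
  proof -
    have "\<bar>g y\<bar> \<le> c1 * \<kappa> b * norm (S a h) * sqrt (R * P b r y)"
      unfolding g_def by (rule P_first_order_dominated[OF split(2) snoc.prems(2-5)])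
    also have "\<dots> \<le> c1 * (2 powr \<theta> * \<kappa> t) * (\<Lambda> * norm h) * sqrt (R * P b r y)"
      using split(5) norm_S[OF split(1,3), of h] pos R0 \<kappa>_ge_1[OF split(2)] k1 c1_nonneg Pb(2)
      by (intro mult_mono mult_nonneg_nonneg) auto
    finally show ?thesis by (simp add: c_def r'_def real_sqrt_mult)
  qed
  have rR: "r' y \<le> c * R" for y
  proof -
    have "sqrt R * sqrt (P b r y) \<le> sqrt R * sqrt R"
      using Pb(3)[of y] R0 by (intro mult_left_mono) auto
    then show ?thesis using c0 R0 by (simp add: r'_def mult.assoc mult_left_mono)
  qed
  have Pr0: "0 \<le> P t r x" by (rule P_nonneg[OF r0])
  \<comment> \<open>Jensen moves the root outside \<open>P a\<close>, and
    \<open>P a (P b r) = P t r\<close>.\<close>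
  have Pr': "P a r' x \<le> c * sqrt R * sqrt (P t r x)"
  proof -
    have "P a r' x = c * sqrt R * P a (\<lambda>x. sqrt (P b r x)) x"
      using P_lin[OF sqb sqb, of a "c * sqrt R" 0 x] split(1) by (simp add: r'_def[abs_def])
    also have "\<dots> \<le> c * sqrt R * sqrt (P a (P b r) x)"
      using c0 R0 split(1) by (intro mult_left_mono P_sqrt_le Pb) auto
    finally show ?thesis using split'(7) by simp
  qed
  have Pr'0: "0 \<le> P a r' x" using order_trans[OF abs_ge_zero gr] by (intro P_nonneg)
  have "\<bar>H_derivs J (hs @ [h]) (P t f) x\<bar> = \<bar>H_derivs J hs (P a g) x\<bar>"
    by (simp add: H_derivs_append split(6) g_def)
  also have "\<dots> \<le> dconst (length hs) * \<kappa> a ^ length hs * prod_list (map norm hs) * ((c * R) powr (1 - e) * P a r' x powr e)"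
    unfolding e_def by (rule snoc.IH[OF split(1) g r' gr rR])
  also have "\<dots> \<le> dconst (length hs) * \<kappa> a ^ length hs * prod_list (map norm hs) *
      ((c * R) powr (1 - e) * (c * sqrt R * sqrt (P t r x)) powr e)"
    using dconst_nonneg prod_list_norm_nonneg \<kappa>_ge_1[OF split(1)] Pr' Pr'0
    by (intro mult_left_mono powr_mono2 mult_nonneg_nonneg) (auto simp: e_def)
  also have "\<dots> = dconst (length hs) * \<kappa> a ^ length hs * prod_list (map norm hs) *
      (c * (R powr (1 - e / 2) * P t r x powr (e / 2)))"
    using powr_interpolate[OF c0 R0 Pr0] by simp
  also have "\<dots> = dconst (length (hs @ [h])) * \<kappa> t ^ length (hs @ [h]) * prod_list (map norm (hs @ [h])) *
      (R powr (1 - e / 2) * P t r x powr (e / 2))"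
    by (simp add: split(4) c_def power_mult_distrib)
  finally show ?case by (simp add: e_def)
qed

text \<open>With the constant \<open>B\<close> as both dominating function and ceiling, the
  interpolated factor collapses to \<open>B\<close>.\<close>

lemma P_bound:
  assumes t: "0 < t" and f: "f \<in> bcontfun" and B: "\<And>x. \<bar>f x\<bar> \<le> B"
  shows "\<bar>H_derivs J hs (P t f) x\<bar> \<le> dconst (length hs) * \<kappa> t ^ length hs * prod_list (map norm hs) * B"
proof -
  have B0: "0 \<le> B" using B[of 0] by linarith
  then have "B powr (1 - e) * B powr e = B" for e by (simp add: powr_add[symmetric])
  then show ?thesis
    using P_bound_dominated[OF t f const_bcontfun_real[of B] B, of B hs x] P_const[of t B x] t by simp
qed

text \<open>Derivatives commute with translations, and a translation of \<open>P t f\<close> by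
  \<open>z\<close> is a translation of \<open>f\<close> by \<open>T t z\<close> under
  \<open>P t\<close>. Differences of derivatives thus become derivatives for a new bounded
  continuous function.\<close>

lemma P_shift_diff:
  assumes t: "0 < t" and f: "f \<in> bcontfun"
  shows "(\<lambda>z. f (z + w) - f z) \<in> bcontfun"
    "H_derivs J hs (P t f) (x + z) - H_derivs J hs (P t f) x
      = H_derivs J hs (P t (\<lambda>y. f (y + T t z) - f y)) x"
proof -
  have fw: "(\<lambda>z. f (z + w)) \<in> bcontfun" for w
    by (intro bcontfun_compose[OF f] continuous_intros)
  then show "(\<lambda>z. f (z + w) - f z) \<in> bcontfun" using bcontfun_lin[OF fw f, of 1 w "-1"] by simp
  have "P t (\<lambda>y. 1 * f (y + T t z) + (-1) * f y) = (\<lambda>x. 1 * P t (\<lambda>y. f (y + T t z)) x + (-1) * P t f x)"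
    using P_lin[OF fw f, of t 1 "T t z" "-1"] t by (intro ext) simp
  then have "H_derivs J hs (P t (\<lambda>y. 1 * f (y + T t z) + (-1) * f y)) x
     = 1 * H_derivs J hs (P t (\<lambda>y. f (y + T t z))) x + (-1) * H_derivs J hs (P t f) x"
    by (simp only: H_derivs_lin[OF P_smooth[OF t fw] P_smooth[OF t f]])
  moreover have "P t (\<lambda>y. f (y + T t z)) = (\<lambda>x. P t f (x + z))" by (intro ext P_shift)
  ultimately show "H_derivs J hs (P t f) (x + z) - H_derivs J hs (P t f) x
      = H_derivs J hs (P t (\<lambda>y. f (y + T t z) - f y)) x"
    by (simp add: H_derivs_shift)
qed

section \<open>Measurability in time\<close>

lemma sets_halfline: "sets halfline = sets (restrict_space borel {0<..})"
  by (simp add: sets_restrict_space)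

lemma continuous_on_imp_measurable_halfline:
  "continuous_on {0..} g \<Longrightarrow> g \<in> borel_measurable halfline"
  unfolding measurable_cong_sets[OF sets_halfline refl]
  by (intro borel_measurable_continuous_on_restrict) (auto elim: continuous_on_subset)

text \<open>The measure of an open set \<open>U\<close> is the limit of the integrals of the functions
  \<open>min 1 (n * infdist y (- U))\<close>, which depend continuously on \<open>t\<close>.\<close>

lemma measurable_mu_kernel: "\<mu> \<in> measurable halfline (subprob_algebra borel)"
proof (rule measurable_subprob_algebra_generated[where \<Omega>=UNIV and G="{U. open U}"])
  show "sets borel = sigma_sets UNIV {U::'a set. open U}" by (simp add: sets_borel)
  show "Int_stable {U::'a set. open U}" by (auto simp: Int_stable_def)
  show "subprob_space (\<mu> t)" "sets (\<mu> t) = sets borel" if "t \<in> space halfline" for t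
    using that prob_space_mu[of t] sets_mu[of t] by (auto simp: space_restrict_space prob_space_imp_subprob_space)
  have one: "(\<lambda>t. emeasure (\<mu> t) UNIV) \<in> borel_measurable halfline"
  proof (subst measurable_cong[where g="\<lambda>_. 1"])
    fix t assume "t \<in> space halfline"
    then have t: "0 \<le> t" by (auto simp: space_restrict_space)
    interpret prob_space "\<mu> t" using t prob_space_mu by blast
    show "emeasure (\<mu> t) UNIV = 1"
      using emeasure_space_1 sets_eq_imp_space_eq[OF sets_mu[OF t]] by simp
  qed simp
  then show "(\<lambda>t. emeasure (\<mu> t) UNIV) \<in> borel_measurable halfline" .
  fix U :: "'a set" assume "U \<in> {U. open U}"
  then have U: "open U" by simp
  show "(\<lambda>t. emeasure (\<mu> t) U) \<in> borel_measurable halfline"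
  \<comment> \<open>The complement of \<open>UNIV\<close> is empty and \<open>infdist\<close> to the
    empty set is 0 by convention, so the approximating functions would vanish.\<close>
  proof (cases "U = UNIV")
    case False
    define g where "g n y = min 1 (real n * infdist y (- U))" for n y
    have gb: "g n \<in> bcontfun" for n
      by (rule bcontfunI_real[of _ 1]) (auto simp: g_def[abs_def] infdist_nonneg intro!: continuous_intros)
    have lim: "(\<lambda>n. g n y) \<longlonglongrightarrow> indicator U y" for y
    proof (cases "y \<in> U")
      case True
      then have d: "infdist y (- U) > 0"
        using U False by (intro infdist_pos_not_in_closed) auto
      then obtain m where "1 / infdist y (- U) < real m" using reals_Archimedean2 by blast
      then have "\<forall>n\<ge>m. g n y = 1"
        using d by (auto simp: g_def divide_less_eq min_def) (smt (verit) mult_right_mono of_nat_mono)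
      then have "\<forall>\<^sub>F n in sequentially. g n y = indicator U y"
        using True by (auto simp: eventually_sequentially)
      then show ?thesis by (rule tendsto_eventually)
    next
      case False
      then show ?thesis by (simp add: g_def)
    qed
    have "(\<lambda>t. measure (\<mu> t) U) \<in> borel_measurable halfline"
    proof (rule borel_measurable_LIMSEQ_real)
      fix t assume "t \<in> space halfline"
      then have t: "0 \<le> t" by (auto simp: space_restrict_space)
      interpret prob_space "\<mu> t" using t prob_space_mu by blast
      have "(\<lambda>n. LINT y|\<mu> t. g n y) \<longlonglongrightarrow> (LINT y|\<mu> t. indicator U y)"
      proof (rule integral_dominated_convergence[where w="\<lambda>_. 1"])
        show "g n \<in> borel_measurable (\<mu> t)" for n using integrable_bcontfun[OF gb t] by auto
        show "indicator U \<in> borel_measurable (\<mu> t)" using U sets_mu[OF t] by (intro borel_measurable_indicator) simp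
        show "AE y in \<mu> t. norm (g n y) \<le> 1" for n by (simp add: g_def infdist_nonneg)
      qed (simp_all add: lim)
      moreover have "U \<in> sets (\<mu> t)" using U sets_mu[OF t] by simp
      ultimately show "(\<lambda>n. LINT y|\<mu> t. g n y) \<longlonglongrightarrow> measure (\<mu> t) U" by simp
    next
      show "(\<lambda>t. LINT y|\<mu> t. g n y) \<in> borel_measurable halfline" for n
        by (rule continuous_on_imp_measurable_halfline[OF mu_weakly_continuous[OF gb]])
    qed
    then have "(\<lambda>t. ennreal (measure (\<mu> t) U)) \<in> borel_measurable halfline" by simp
    then show ?thesis
    proof (subst measurable_cong)
      fix t assume "t \<in> space halfline"
      then interpret prob_space "\<mu> t" using prob_space_mu by (auto simp: space_restrict_space)
      show "emeasure (\<mu> t) U = ennreal (measure (\<mu> t) U)" by (simp add: emeasure_eq_measure)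
    qed
  qed (use one in simp)
qed auto

text \<open>Time enters both the measure and the integrand. Pushing \<open>\<mu> t\<close> forward
  to the graph \<open>y \<mapsto> (t, y)\<close> leaves a fixed integrand and a measurable
  kernel.\<close>

lemma measurable_integral_mu:
  fixes F :: "real \<Rightarrow> 'a \<Rightarrow> real"
  assumes F: "(\<lambda>(t, y). F t y) \<in> borel_measurable (halfline \<Otimes>\<^sub>M borel)"
  shows "(\<lambda>t. LINT y|\<mu> t. F t y) \<in> borel_measurable halfline"
proof (subst measurable_cong)
  fix t assume t: "t \<in> space halfline"
  have s: "sets (\<mu> t) = sets borel" using t sets_mu by (auto simp: space_restrict_space)
  have "Pair t \<in> measurable (\<mu> t) (halfline \<Otimes>\<^sub>M borel)"
    using t measurable_Pair1'[OF t, of borel] by (simp add: measurable_cong_sets[OF s refl])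
  then show "(LINT y|\<mu> t. F t y) = integral\<^sup>L (distr (\<mu> t) (halfline \<Otimes>\<^sub>M borel) (\<lambda>y. (t, y))) (\<lambda>(t, y). F t y)"
    using F by (subst integral_distr) auto
next
  note measurable_distr2[measurable] measurable_mu_kernel[measurable] F[measurable]
  show "(\<lambda>t. integral\<^sup>L (distr (\<mu> t) (halfline \<Otimes>\<^sub>M borel) (\<lambda>y. (t, y))) (\<lambda>(t, y). F t y)) \<in> borel_measurable halfline"
    by measurable
qed

lemma measurable_T_add:
  assumes f: "f \<in> bcontfun"
  shows "(\<lambda>(t, y). f (T t x + y) :: real) \<in> borel_measurable (halfline \<Otimes>\<^sub>M borel)"
proof -
  have [measurable]: "(\<lambda>t. T t x) \<in> borel_measurable halfline"
    by (rule continuous_on_imp_measurable_halfline[OF T_strongly_continuous])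
  have [measurable]: "f \<in> borel_measurable borel" using f by (simp add: bcontfun_continuous continuous_borel)
  show ?thesis by measurable
qed

text \<open>Each derivative is a pointwise limit of difference quotients with steps
  \<open>1 / (i + 1)\<close>, which are measurable by induction.\<close>

lemma H_derivs_measurable:
  assumes f: "f \<in> bcontfun"
  shows "(\<lambda>t. H_derivs J hs (P t f) x) \<in> borel_measurable halfline"
proof (induction hs arbitrary: x)
  case Nil
  then show ?case
    unfolding H_derivs.simps mehler_def by (intro measurable_integral_mu measurable_T_add f)
next
  case (Cons h hs)
  let ?q = "\<lambda>i t. (H_derivs J hs (P t f) (x + (1 / real (Suc i)) *\<^sub>R J h) - H_derivs J hs (P t f) x) / (1 / real (Suc i))"
  show ?case
  proof (rule borel_measurable_LIMSEQ_real[where u = ?q])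
    fix t assume "t \<in> space halfline"
    then have t: "0 < t" by (auto simp: space_restrict_space)
    have "H_differentiable J h (H_derivs J hs (P t f))"
      using P_smooth[OF t f] by (simp add: H_smooth_def)
    from H_differentiable_DERIV_0[OF this, of x]
    have "((\<lambda>s. (H_derivs J hs (P t f) (x + s *\<^sub>R J h) - H_derivs J hs (P t f) x) / s) \<longlongrightarrow> H_derivs J (h # hs) (P t f) x) (at 0)"
      by (simp add: DERIV_def)
    then show "(\<lambda>i. ?q i t) \<longlonglongrightarrow> H_derivs J (h # hs) (P t f) x"
      using LIMSEQ_inverse_real_of_nat
      unfolding tendsto_at_iff_sequentially comp_def
      by (auto simp: inverse_eq_divide dest!: spec[of _ "\<lambda>i. 1 / real (Suc i)"])
  next
    show "?q i \<in> borel_measurable halfline" for i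
      by (intro borel_measurable_divide borel_measurable_diff Cons.IH) auto
  qed
qed

end

section \<open>The resolvent\<close>

lemma has_bochner_integral_halfline:
  fixes f :: "real \<Rightarrow> real"
  assumes f: "f \<in> borel_measurable borel" and nonneg: "\<And>t. 0 \<le> f t" and I: "(f has_integral I) \<Omega>"
    and \<Omega>: "\<Omega> \<in> sets borel" and eq: "\<And>t. t > 0 \<Longrightarrow> t \<in> \<Omega> \<Longrightarrow> g t = f t" "\<And>t. t > 0 \<Longrightarrow> t \<notin> \<Omega> \<Longrightarrow> g t = 0"
    and neg: "\<And>t. t \<le> 0 \<Longrightarrow> t \<in> \<Omega> \<Longrightarrow> f t = 0"
  shows "has_bochner_integral halfline g I"
proof -
  have "has_bochner_integral lborel (\<lambda>t. indicator \<Omega> t * f t) I"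
  proof (rule has_bochner_integral_nn_integral)
    show "(\<lambda>t. indicator \<Omega> t * f t) \<in> borel_measurable lborel" using f \<Omega> by simp
    show "0 \<le> I" using has_integral_nonneg[OF I] nonneg by blast
    show "(\<integral>\<^sup>+ t. ennreal (indicator \<Omega> t * f t) \<partial>lborel) = ennreal I"
      by (rule nn_integral_has_integral_lebesgue[OF nonneg I])
  qed (use nonneg in auto)
  moreover have "(\<lambda>t. indicator {0<..} t *\<^sub>R g t) = (\<lambda>t. indicator \<Omega> t * f t)"
    using eq neg by (force simp: indicator_def)
  ultimately show ?thesis
    using integrable_restrict_space[of "{0<..}" lborel g] integral_restrict_space[of "{0<..}" lborel g]
    by (simp add: has_bochner_integral_iff)
qed

lemma halfline_powr_from_0:
  assumes "-1 < a" "0 \<le> c"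
  shows "has_bochner_integral halfline (\<lambda>t. indicator {0..c} t * t powr a) (c powr (a + 1) / (a + 1))"
  by (rule has_bochner_integral_halfline[OF _ _ has_integral_powr_from_0[OF assms]]) auto

lemma halfline_powr_to_inf:
  assumes "e < -1" "0 < a"
  shows "has_bochner_integral halfline (\<lambda>t. indicator {a..} t * t powr e) (- (a powr (e + 1)) / (e + 1))"
  by (rule has_bochner_integral_halfline[OF _ _ has_integral_powr_to_inf[OF assms]]) (use assms in auto)

lemma halfline_exp:
  assumes "0 < lam"
  shows "has_bochner_integral halfline (\<lambda>t. exp (- lam * t)) (1 / lam)"
\<comment> \<open>The indicator makes the integrand vanish at 0, a point of \<open>{0..}\<close>
  outside the half-line.\<close>
proof (rule has_bochner_integral_halfline[where \<Omega>="{0..}" and f="\<lambda>t. exp (- lam * t) * indicator {0<..} t"])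
  have "((\<lambda>t. exp (- lam * t)) has_integral 1 / lam) {0..}"
    using has_integral_exp_minus_to_infinity[OF assms, of 0] by simp
  then show "((\<lambda>t. exp (- lam * t) * indicator {0<..} t) has_integral 1 / lam) {0..}"
    by (rule has_integral_spike[of "{0}", rotated 2]) (auto simp: indicator_def)
qed auto

lemma abs_integral_le_dominated:
  fixes f H :: "real \<Rightarrow> real"
  assumes f: "f \<in> borel_measurable M" and H: "has_bochner_integral M H I" and le: "\<And>t. t \<in> space M \<Longrightarrow> \<bar>f t\<bar> \<le> H t"
  shows "integrable M f" "\<bar>integral\<^sup>L M f\<bar> \<le> I"
proof -
  have Hi: "integrable M H" "integral\<^sup>L M H = I" using H by (auto simp: has_bochner_integral_iff)
  show fi: "integrable M f"
    by (rule Bochner_Integration.integrable_bound[OF Hi(1) f]) (use le in \<open>force intro: AE_I2\<close>)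
  have "\<bar>integral\<^sup>L M f\<bar> \<le> integral\<^sup>L M (\<lambda>t. \<bar>f t\<bar>)" by (rule integral_abs_bound)
  also have "\<dots> \<le> integral\<^sup>L M H" using fi Hi le by (intro integral_mono) auto
  finally show "\<bar>integral\<^sup>L M f\<bar> \<le> I" using Hi by simp
qed

lemma exp_measurable_halfline [measurable]: "(\<lambda>t. exp (- lam * t)) \<in> borel_measurable halfline"
  by (intro measurable_restrict_space1) measurable

text \<open>The two bounds cross at \<open>t = \<eta> powr (1 / \<theta>)\<close>.\<close>

lemma critical_integral:
  fixes G :: "real \<Rightarrow> real"
  assumes G: "G \<in> borel_measurable halfline" and "0 < \<eta>" "p < 1" "1 < q" "0 < \<theta>" "0 < lam" "0 \<le> a" "0 \<le> b" "0 \<le> c"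
    and small: "\<And>t. 0 < t \<Longrightarrow> t \<le> 1 \<Longrightarrow> \<bar>G t\<bar> \<le> a * \<eta> powr p * t powr - (1 - (1 - p) * \<theta>)"
    and mid: "\<And>t. 0 < t \<Longrightarrow> t \<le> 1 \<Longrightarrow> \<bar>G t\<bar> \<le> b * \<eta> powr q * t powr - (1 + (q - 1) * \<theta>)"
    and large: "\<And>t. 1 < t \<Longrightarrow> \<bar>G t\<bar> \<le> c * \<eta>"
  shows "\<bar>LINT t|halfline. exp (- lam * t) * G t\<bar> \<le> (a / ((1 - p) * \<theta>) + b / ((q - 1) * \<theta>) + c / lam) * \<eta>"
proof -
  define e1 where "e1 = - (1 - (1 - p) * \<theta>)"
  define e2 where "e2 = - (1 + (q - 1) * \<theta>)"
  have e1: "e1 > -1" "e1 + 1 = (1 - p) * \<theta>" using assms by (auto simp: e1_def)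
  have e2: "e2 < -1" "e2 + 1 = - ((q - 1) * \<theta>)" using assms by (auto simp: e2_def)
  \<comment> \<open>For \<open>\<eta> > 1\<close> the crossing time exceeds 1; the cut is then at 1
    and the middle piece disappears, hence the case distinction in \<open>w\<close> as well.\<close>
  define t0 where "t0 = (if \<eta> \<le> 1 then \<eta> powr (1 / \<theta>) else 1)"
  have t0: "0 < t0" "t0 \<le> 1" using assms by (auto simp: t0_def powr_le1)
  define w where "w = (if \<eta> \<le> 1 then b * \<eta> powr q else 0)"
  have w0: "0 \<le> w" using assms by (simp add: w_def)
  have meas: "(\<lambda>t. exp (- lam * t) * G t) \<in> borel_measurable halfline" using G by measurable
  \<comment> \<open>The majorant: \<open>small\<close> up to \<open>t0\<close>, \<open>mid\<close>
    from \<open>t0\<close> on, and the exponential for times beyond 1. The summands are nonnegative,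
    so overlaps are harmless.\<close>
  let ?H = "\<lambda>t. a * \<eta> powr p * (indicator {0..t0} t * t powr e1) + w * (indicator {t0..} t * t powr e2) + c * \<eta> * exp (- lam * t)"
  let ?I = "a * \<eta> powr p * (t0 powr (e1 + 1) / (e1 + 1)) + w * (- (t0 powr (e2 + 1)) / (e2 + 1)) + c * \<eta> * (1 / lam)"
  have H: "has_bochner_integral halfline ?H ?I"
    using e1 e2 t0 assms
    by (intro has_bochner_integral_add has_bochner_integral_mult_right halfline_powr_from_0 halfline_powr_to_inf halfline_exp) auto
  have le: "\<bar>exp (- lam * t) * G t\<bar> \<le> ?H t" if "t \<in> space halfline" for t
  proof -
    have t: "0 < t" using that by (simp add: space_restrict_space)
    have ex: "exp (- lam * t) \<le> 1" using assms t by simp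
    have nn: "0 \<le> a * \<eta> powr p * (indicator {0..t0} t * t powr e1)" "0 \<le> w * (indicator {t0..} t * t powr e2)"
      "0 \<le> c * \<eta> * exp (- lam * t)" using assms w0 by auto
    have "\<bar>exp (- lam * t) * G t\<bar> = exp (- lam * t) * \<bar>G t\<bar>" by (simp add: abs_mult)
    also have "\<dots> \<le> ?H t"
    proof (cases "t \<le> 1")
      case True
      have G1: "exp (- lam * t) * \<bar>G t\<bar> \<le> \<bar>G t\<bar>" using ex by (simp add: mult_left_le_one_le)
      show ?thesis
      proof (cases "t \<le> t0")
        case le: True
        then have "\<bar>G t\<bar> \<le> a * \<eta> powr p * (indicator {0..t0} t * t powr e1)"
          using small[OF t True] t by (simp add: e1_def)
        then show ?thesis using G1 nn by linarith
      next
        case False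
        then have "\<eta> \<le> 1" using True by (auto simp: t0_def split: if_splits)
        then have "\<bar>G t\<bar> \<le> w * (indicator {t0..} t * t powr e2)"
          using mid[OF t True] False by (simp add: e2_def w_def)
        then show ?thesis using G1 nn by linarith
      qed
    next
      case False
      then have "exp (- lam * t) * \<bar>G t\<bar> \<le> c * \<eta> * exp (- lam * t)"
        using large[of t] by (simp add: mult.commute)
      then show ?thesis using nn by linarith
    qed
    finally show ?thesis .
  qed
  have "\<bar>LINT t|halfline. exp (- lam * t) * G t\<bar> \<le> ?I"
    by (rule abs_integral_le_dominated(2)[OF meas H le])
  also have "?I \<le> (a / ((1 - p) * \<theta>) + b / ((q - 1) * \<theta>) + c / lam) * \<eta>"
  proof -
    \<comment> \<open>At the crossing time the integrated power turns \<open>\<eta> powr p\<close>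
      into exactly \<open>\<eta>\<close>; below, the same happens to \<open>\<eta> powr q\<close>.
      This is the linear growth that the Zygmund seminorm asks for.\<close>
    have "\<eta> powr p * t0 powr ((1 - p) * \<theta>) \<le> \<eta>"
    proof (cases "\<eta> \<le> 1")
      case True
      have "\<eta> powr p * t0 powr ((1 - p) * \<theta>) = \<eta> powr (p + (1 - p))"
        using True assms by (simp add: t0_def powr_powr powr_add[symmetric] del: powr_add)
      then show ?thesis using assms by simp
    next
      case False
      then show ?thesis using powr_mono[of p 1 \<eta>] assms by (simp add: t0_def)
    qed
    then have "a * (\<eta> powr p * t0 powr ((1 - p) * \<theta>)) / ((1 - p) * \<theta>) \<le> a * \<eta> / ((1 - p) * \<theta>)"
      using assms by (intro divide_right_mono mult_left_mono) auto
    then have 1: "a * \<eta> powr p * (t0 powr (e1 + 1) / (e1 + 1)) \<le> a / ((1 - p) * \<theta>) * \<eta>"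
      by (simp add: e1 mult.assoc)
    have "w * t0 powr (- ((q - 1) * \<theta>)) \<le> b * \<eta>"
    proof (cases "\<eta> \<le> 1")
      case True
      have "t0 powr (- ((q - 1) * \<theta>)) = \<eta> powr (1 - q)"
        using True assms by (simp add: t0_def powr_powr)
      then have "w * t0 powr (- ((q - 1) * \<theta>)) = b * \<eta> powr (q + (1 - q))"
        using True by (simp only: w_def if_True powr_add mult.assoc)
      then show ?thesis using assms by simp
    qed (use assms in \<open>simp add: w_def\<close>)
    then have "w * t0 powr (- ((q - 1) * \<theta>)) / ((q - 1) * \<theta>) \<le> b * \<eta> / ((q - 1) * \<theta>)"
      using assms by (intro divide_right_mono) auto
    then have 2: "w * (- (t0 powr (e2 + 1)) / (e2 + 1)) \<le> b / ((q - 1) * \<theta>) * \<eta>"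
      by (simp add: e2)
    show ?thesis using 1 2 by (simp add: distrib_right)
  qed
  finally show ?thesis .
qed

section \<open>Estimates in the norm of forms\<close>

lemma form_norm_le:
  assumes "\<And>hs. length hs = n \<Longrightarrow> \<bar>\<phi> hs\<bar> \<le> K * prod_list (map norm hs)"
  shows "form_norm n \<phi> \<le> ennreal K"
  unfolding form_norm_def
proof (intro SUP_least ennreal_leI)
  fix hs :: "'a list" assume hs: "hs \<in> {hs. length hs = n \<and> 0 \<notin> set hs}"
  then have "0 \<notin> set hs" by simp
  then have "0 < prod_list (map norm hs)" by (induction hs) auto
  then show "\<bar>\<phi> hs\<bar> / prod_list (map norm hs) \<le> K"
    using assms[of hs] hs by (simp add: divide_le_eq)
qed

lemma form_norm_tendsto_0:
  assumes "\<And>e. 0 < e \<Longrightarrow> \<forall>\<^sub>F t in F. \<forall>hs. length hs = n \<longrightarrow> \<bar>\<phi> t hs\<bar> \<le> e * prod_list (map norm hs)"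
  shows "((\<lambda>t. form_norm n (\<phi> t)) \<longlongrightarrow> 0) F"
proof (rule tendsto_zero_ennreal)
  fix r :: real assume r: "0 < r"
  then have "\<forall>\<^sub>F t in F. \<forall>hs. length hs = n \<longrightarrow> \<bar>\<phi> t hs\<bar> \<le> (r / 2) * prod_list (map norm hs)"
    by (intro assms) simp
  then show "\<forall>\<^sub>F t in F. form_norm n (\<phi> t) < ennreal r"
  proof eventually_elim
    case (elim t)
    then have "form_norm n (\<phi> t) \<le> ennreal (r / 2)" by (intro form_norm_le) auto
    also have "\<dots> < ennreal r" using r by (intro ennreal_lessI) auto
    finally show ?case .
  qed
qed

text \<open>Defined before \<open>f\<close> and \<open>B\<close> are fixed, so that constants built
  from it visibly do not depend on \<open>f\<close>.\<close>

definition (in smoothing_mehler) weight_int :: "real \<Rightarrow> nat \<Rightarrow> real" where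
  "weight_int lam n = (LINT t|halfline. exp (- lam * t) * \<kappa> t ^ n)"

locale smoothing_resolvent = smoothing_mehler T \<mu> J S \<Lambda> \<Gamma> \<theta>
  for T :: "real \<Rightarrow> 'a::{banach,second_countable_topology} \<Rightarrow>\<^sub>L 'a" and \<mu>
    and J :: "'h::real_normed_vector \<Rightarrow> 'a" and S \<Lambda> \<Gamma> \<theta> +
  fixes lam :: real and f :: "'a \<Rightarrow> real" and B :: real
  assumes lam: "0 < lam" and f: "f \<in> bcontfun" and B: "\<And>x. \<bar>f x\<bar> \<le> B"
begin

lemma B_nonneg: "0 \<le> B" using B[of 0] by linarith

definition weight :: "nat \<Rightarrow> real \<Rightarrow> real" where
  "weight n t = exp (- lam * t) * \<kappa> t ^ n"

lemma \<kappa>_power: "0 < t \<Longrightarrow> \<kappa> t ^ n = min t 1 powr - (real n * \<theta>)"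
  by (simp add: \<kappa>_def powr_realpow[symmetric] powr_powr mult.commute)

lemma \<kappa>_measurable [measurable]: "\<kappa> \<in> borel_measurable halfline"
  unfolding \<kappa>_def[abs_def] by (intro measurable_restrict_space1) measurable

lemma weight_nonneg: "0 \<le> weight n t"
  by (simp add: weight_def \<kappa>_def)

text \<open>Near 0 the singularity \<open>t powr - (n \<theta>)\<close> is integrable by assumption;
  beyond 1 the rate \<open>\<kappa>\<close> equals 1 and the exponential decides.\<close>

lemma weight_integrable:
  assumes "real n * \<theta> < 1"
  shows "integrable halfline (weight n)"
proof (rule abs_integral_le_dominated(1)[OF _ has_bochner_integral_add[OF halfline_powr_from_0[of "- (real n * \<theta>)" 1] halfline_exp[OF lam]]])
  show "weight n \<in> borel_measurable halfline" unfolding weight_def[abs_def] by measurable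
  show "\<bar>weight n t\<bar> \<le> indicator {0..1} t * t powr - (real n * \<theta>) + exp (- lam * t)" if "t \<in> space halfline" for t
  proof -
    have t: "0 < t" using that by (simp add: space_restrict_space)
    have ex: "exp (- lam * t) \<le> 1" using lam t by simp
    show ?thesis
    proof (cases "t \<le> 1")
      case True
      have "weight n t \<le> t powr - (real n * \<theta>)"
        using True t ex by (simp add: weight_def \<kappa>_power mult_left_le_one_le)
      moreover have "indicator {0..1} t * t powr - (real n * \<theta>) = t powr - (real n * \<theta>)" using t True by simp
      moreover have "0 \<le> exp (- lam * t)" by simp
      ultimately show ?thesis using weight_nonneg[of n t] by linarith
    next
      case False
      then show ?thesis by (simp add: weight_def \<kappa>_power)
    qed
  qed
qed (use assms in auto)

lemma weight_int_nonneg: "0 \<le> weight_int lam n"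
  unfolding weight_int_def weight_def[symmetric] by (intro integral_nonneg_AE AE_I2 weight_nonneg)

text \<open>The candidate for the derivative of the resolvent in the directions \<open>hs\<close>,
  with differentiation carried under the time integral.\<close>

definition U :: "'h list \<Rightarrow> 'a \<Rightarrow> real" where
  "U hs x = (LINT t|halfline. exp (- lam * t) * H_derivs J hs (P t f) x)"

abbreviation \<pi> :: "'h list \<Rightarrow> real" where "\<pi> hs \<equiv> prod_list (map norm hs)"

lemma U_integrand_measurable: "(\<lambda>t. exp (- lam * t) * H_derivs J hs (P t f) x) \<in> borel_measurable halfline"
  using H_derivs_measurable[OF f] by measurable

lemma U_integrand_le:
  assumes "0 < t" "length hs = n"
  shows "\<bar>exp (- lam * t) * H_derivs J hs (P t f) x\<bar> \<le> dconst n * \<pi> hs * B * weight n t"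
proof -
  have "exp (- lam * t) * \<bar>H_derivs J hs (P t f) x\<bar> \<le> exp (- lam * t) * (dconst n * \<kappa> t ^ n * \<pi> hs * B)"
    using P_bound[OF assms(1) f B, of hs x] assms(2) by (intro mult_left_mono) auto
  then show ?thesis by (simp add: weight_def abs_mult mult_ac)
qed

lemma weight_has_integral:
  "real n * \<theta> < 1 \<Longrightarrow> has_bochner_integral halfline (\<lambda>t. c * weight n t) (c * weight_int lam n)"
  unfolding weight_int_def weight_def[symmetric] by (intro has_bochner_integral_mult_right has_bochner_integral_integrable weight_integrable)

lemma
  assumes n: "real n * \<theta> < 1" "length hs = n"
  shows U_integrable: "integrable halfline (\<lambda>t. exp (- lam * t) * H_derivs J hs (P t f) x)"
    and U_bound: "\<bar>U hs x\<bar> \<le> dconst n * weight_int lam n * B * \<pi> hs"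
proof -
  note * = abs_integral_le_dominated[OF U_integrand_measurable weight_has_integral[OF n(1), of "dconst n * \<pi> hs * B"], of hs x]
  have le: "\<bar>exp (- lam * t) * H_derivs J hs (P t f) x\<bar> \<le> dconst n * \<pi> hs * B * weight n t" if "t \<in> space halfline" for t
    using U_integrand_le[OF _ n(2)] that by (simp add: space_restrict_space)
  show "integrable halfline (\<lambda>t. exp (- lam * t) * H_derivs J hs (P t f) x)" using le by (rule *(1))
  show "\<bar>U hs x\<bar> \<le> dconst n * weight_int lam n * B * \<pi> hs" unfolding U_def using *(2)[OF le] by (simp add: mult_ac)
qed

lemma U_Nil: "U [] = mehler_resolvent T \<mu> lam f"
proof
  fix x
  have "U [] x = (LINT t|lborel. indicator {0<..} t *\<^sub>R (exp (- lam * t) * P t f x))"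
    unfolding U_def H_derivs.simps by (rule integral_restrict_space) simp
  also have "\<dots> = mehler_resolvent T \<mu> lam f x"
    unfolding mehler_resolvent_def set_lebesgue_integral_def
    by (rule integral_discrete_difference[of "{0}"]) (auto simp: indicator_def)
  finally show "U [] x = mehler_resolvent T \<mu> lam f x" .
qed

text \<open>The modulus \<open>m\<close> is uniform in the directions because of the bound of \<open>P_bound_dominated\<close> with
  \<open>r = \<bar>f (\<cdot> + T t z) - f\<bar>\<close>, for which \<open>P t r x\<close> does not see the directions.\<close>

lemma U_norm_continuous:
  assumes n: "real n * \<theta> < 1"
  obtains m where "m \<midarrow>x\<rightarrow> (0::real)" "\<And>y hs. length hs = n \<Longrightarrow> \<bar>U hs y - U hs x\<bar> \<le> m y * \<pi> hs"
proof -
  define e :: real where "e = (1 / 2) ^ n"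
  have e: "0 < e" by (simp add: e_def)
  define r where "r t z y = \<bar>f (y + T t z) - f y\<bar>" for t z y
  define d where "d t z = P t (r t z) x" for t z
  have rb: "r t z \<in> bcontfun" "\<bar>r t z y\<bar> \<le> 2 * B" if "0 < t" for t z y
  proof -
    have c: "continuous_on UNIV (r t z)"
      using bcontfun_continuous[OF P_shift_diff(1)[OF that f]] unfolding r_def[abs_def] by (intro continuous_on_rabs)
    show 2: "\<bar>r t z y\<bar> \<le> 2 * B" for y using B[of y] B[of "y + T t z"] by (simp add: r_def)
    show "r t z \<in> bcontfun" by (rule bcontfunI_real[OF c 2])
  qed
  have d0: "0 \<le> d t z" for t z unfolding d_def by (rule P_nonneg) (simp add: r_def)
  have dB: "d t z \<le> 2 * B" if "0 < t" for t z
    using P_abs_le_const[OF rb(1)[OF that] _ rb(2)[OF that], of t z x] that by (simp add: d_def abs_le_iff)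
  have dm: "(\<lambda>t. d t z) \<in> borel_measurable halfline" for z
  proof -
    have [measurable]: "(\<lambda>t. T t w) \<in> borel_measurable halfline" for w
      by (rule continuous_on_imp_measurable_halfline[OF T_strongly_continuous])
    have [measurable]: "f \<in> borel_measurable borel" using f by (simp add: bcontfun_continuous continuous_borel)
    have "(\<lambda>t. LINT y|\<mu> t. r t z (T t x + y)) \<in> borel_measurable halfline"
      unfolding r_def by (rule measurable_integral_mu) measurable
    then show ?thesis by (simp add: d_def mehler_def)
  qed
  \<comment> \<open>\<open>2 B\<close> is the ceiling of \<open>r t z\<close> in
    \<open>P_bound_dominated\<close>.\<close>
  define K where "K = dconst n * (2 * B) powr (1 - e)"
  have K0: "0 \<le> K" using dconst_nonneg by (simp add: K_def)
  define g where "g z t = weight n t * (K * d t z powr e)" for z t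
  have gm: "g z \<in> borel_measurable halfline" for z
  proof -
    have [measurable]: "(\<lambda>t. d t z) \<in> borel_measurable halfline" by (rule dm)
    show ?thesis unfolding g_def[abs_def] weight_def[abs_def] by measurable
  qed
  have g0: "0 \<le> g z t" for z t using weight_nonneg K0 by (simp add: g_def)
  have gle: "g z t \<le> K * (2 * B) powr e * weight n t" if "0 < t" for z t
  proof -
    have "d t z powr e \<le> (2 * B) powr e" using dB[OF that] d0 e by (intro powr_mono2) auto
    then have "weight n t * (K * d t z powr e) \<le> weight n t * (K * (2 * B) powr e)"
      using weight_nonneg K0 by (intro mult_left_mono) auto
    then show ?thesis by (simp add: g_def mult_ac)
  qed
  have gi: "integrable halfline (g z)" for z
    by (rule abs_integral_le_dominated(1)[OF gm weight_has_integral[OF n, of "K * (2 * B) powr e"]])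
      (use gle g0 in \<open>auto simp: space_restrict_space\<close>)
  define m where "m y = (LINT t|halfline. g (y - x) t)" for y
  have "\<bar>U hs y - U hs x\<bar> \<le> m y * \<pi> hs" if hs: "length hs = n" for y hs
  proof -
      have eq: "U hs y - U hs x = (LINT t|halfline. exp (- lam * t) * H_derivs J hs (P t f) y - exp (- lam * t) * H_derivs J hs (P t f) x)"
      unfolding U_def by (intro Bochner_Integration.integral_diff[symmetric] U_integrable[OF n hs])
    have "\<bar>LINT t|halfline. exp (- lam * t) * H_derivs J hs (P t f) y - exp (- lam * t) * H_derivs J hs (P t f) x\<bar> \<le> \<pi> hs * m y"
    proof (rule abs_integral_le_dominated(2))
      show "(\<lambda>t. exp (- lam * t) * H_derivs J hs (P t f) y - exp (- lam * t) * H_derivs J hs (P t f) x) \<in> borel_measurable halfline"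
        by (intro borel_measurable_diff U_integrand_measurable)
      show "has_bochner_integral halfline (\<lambda>t. \<pi> hs * g (y - x) t) (\<pi> hs * m y)"
        unfolding m_def by (intro has_bochner_integral_mult_right has_bochner_integral_integrable gi)
      fix t assume "t \<in> space halfline"
      then have t: "0 < t" by (simp add: space_restrict_space)
      have "\<bar>H_derivs J hs (P t f) y - H_derivs J hs (P t f) x\<bar> = \<bar>H_derivs J hs (P t (\<lambda>v. f (v + T t (y - x)) - f v)) x\<bar>"
        using P_shift_diff(2)[OF t f, of hs x "y - x"] by simp
      also have "\<dots> \<le> dconst (length hs) * \<kappa> t ^ length hs * \<pi> hs * ((2 * B) powr (1 - (1 / 2) ^ length hs) * P t (r t (y - x)) x powr (1 / 2) ^ length hs)"
        by (rule P_bound_dominated[OF t P_shift_diff(1)[OF t f] rb(1)[OF t]])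
          (use rb(2)[OF t] in \<open>auto simp: r_def abs_le_iff\<close>)
      finally have "exp (- lam * t) * \<bar>H_derivs J hs (P t f) y - H_derivs J hs (P t f) x\<bar>
          \<le> exp (- lam * t) * (dconst n * \<kappa> t ^ n * \<pi> hs * ((2 * B) powr (1 - e) * d t (y - x) powr e))"
        by (intro mult_left_mono) (auto simp: hs d_def e_def)
      then show "\<bar>exp (- lam * t) * H_derivs J hs (P t f) y - exp (- lam * t) * H_derivs J hs (P t f) x\<bar> \<le> \<pi> hs * g (y - x) t"
        by (simp add: right_diff_distrib[symmetric] abs_mult g_def weight_def K_def mult_ac)
    qed
    then show ?thesis by (simp add: eq mult.commute)
  qed
  moreover have "m \<midarrow>x\<rightarrow> 0"
    unfolding tendsto_at_iff_sequentially comp_def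
  proof (intro allI impI)
    fix u assume u: "u \<longlonglongrightarrow> x"
    \<comment> \<open>Dominated convergence twice: in \<open>y\<close> for fixed \<open>t\<close>,
      where continuity of \<open>f\<close> sends \<open>r\<close> to 0 below the bound
      \<open>2 B\<close>, then in \<open>t\<close> below a multiple of the integrable
      weight.\<close>
    have "(\<lambda>i. LINT t|halfline. g (u i - x) t) \<longlonglongrightarrow> (LINT t|halfline. 0)"
    proof (rule integral_dominated_convergence[where w="\<lambda>t. K * (2 * B) powr e * weight n t"])
      show "integrable halfline (\<lambda>t. K * (2 * B) powr e * weight n t)"
        using weight_integrable[OF n] by simp
      show "AE t in halfline. norm (g (u i - x) t) \<le> K * (2 * B) powr e * weight n t" for i
        using gle g0 by (intro AE_I2) (simp add: space_restrict_space)
      show "AE t in halfline. (\<lambda>i. g (u i - x) t) \<longlonglongrightarrow> 0"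
      proof (rule AE_I2)
        fix t assume "t \<in> space halfline"
        then have t: "0 < t" by (simp add: space_restrict_space)
        interpret prob_space "\<mu> t" using t prob_space_mu by simp
        have "(\<lambda>i. d t (u i - x)) \<longlonglongrightarrow> (LINT y|\<mu> t. 0)"
          unfolding d_def mehler_def
        proof (rule integral_dominated_convergence[where w="\<lambda>_. 2 * B"])
          show "(\<lambda>y. r t (u i - x) (T t x + y)) \<in> borel_measurable (\<mu> t)" for i
            using P_integrable[OF rb(1)[OF t], of t] t by auto
          show "AE y in \<mu> t. norm (r t (u i - x) (T t x + y)) \<le> 2 * B" for i using rb(2)[OF t] by auto
          show "AE y in \<mu> t. (\<lambda>i. r t (u i - x) (T t x + y)) \<longlonglongrightarrow> 0"
          proof (rule AE_I2)
            fix y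
            have "(\<lambda>i. T t x + y + T t (u i - x)) \<longlonglongrightarrow> T t x + y + T t (x - x)"
              by (intro tendsto_intros u)
            then have "(\<lambda>i. f (T t x + y + T t (u i - x))) \<longlonglongrightarrow> f (T t x + y)"
              by (intro continuous_on_tendsto_compose[OF bcontfun_continuous[OF f]]) (auto simp: blinfun.zero_right)
            then have "(\<lambda>i. \<bar>f (T t x + y + T t (u i - x)) - f (T t x + y)\<bar>) \<longlonglongrightarrow> \<bar>f (T t x + y) - f (T t x + y)\<bar>"
              by (intro tendsto_intros)
            then show "(\<lambda>i. r t (u i - x) (T t x + y)) \<longlonglongrightarrow> 0" by (simp add: r_def)
          qed
        qed auto
        then have "(\<lambda>i. d t (u i - x) powr e) \<longlonglongrightarrow> 0 powr e"
          using e d0 by (intro tendsto_powr') auto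
        then have "(\<lambda>i. weight n t * (K * d t (u i - x) powr e)) \<longlonglongrightarrow> weight n t * (K * 0 powr e)"
          by (intro tendsto_mult tendsto_const)
        then show "(\<lambda>i. g (u i - x) t) \<longlonglongrightarrow> 0" by (simp add: g_def)
      qed
    qed (use gm in auto)
    then show "(\<lambda>i. m (u i)) \<longlonglongrightarrow> 0" by (simp add: m_def)
  qed
  ultimately show thesis using that by blast
qed

lemma U_bcontfun:
  assumes n: "real (length hs) * \<theta> < 1"
  shows "U hs \<in> bcontfun"
proof (rule bcontfunI_real[OF _ U_bound[OF n refl]])
  show "continuous_on UNIV (U hs)"
    unfolding continuous_on_eq_continuous_at[OF open_UNIV] isCont_def
  proof
    fix x
    obtain m where m: "m \<midarrow>x\<rightarrow> (0::real)" "\<And>y. \<bar>U hs y - U hs x\<bar> \<le> m y * \<pi> hs"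
      using U_norm_continuous[OF n, of x] by metis
    have "((\<lambda>y. m y * \<pi> hs) \<longlongrightarrow> 0) (at x)" using tendsto_mult[OF m(1) tendsto_const] by simp
    then have "((\<lambda>y. U hs y - U hs x) \<longlongrightarrow> 0) (at x)"
      by (rule Lim_null_comparison[rotated]) (simp add: m(2))
    then show "U hs \<midarrow>x\<rightarrow> U hs x" by (simp add: LIM_zero_iff)
  qed
qed

text \<open>Differentiation under the time integral: the mean value inequality bounds the difference
  quotients by the weight of the next order, which is integrable by the hypothesis on
  \<open>Suc (length hs)\<close>.\<close>

lemma U_H_derivative:
  assumes n: "real (Suc (length hs)) * \<theta> < 1"
  shows "((\<lambda>s. U hs (x + s *\<^sub>R J h)) has_field_derivative U (h # hs) x) (at 0)"
  unfolding DERIV_def tendsto_at_iff_sequentially comp_def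
proof (intro allI impI)
  fix u :: "nat \<Rightarrow> real" assume u0: "\<forall>i. u i \<in> UNIV - {0}" and u: "u \<longlonglongrightarrow> 0"
  have n': "real (length hs) * \<theta> < 1" using n pos by (simp add: distrib_right)
  let ?W = "\<lambda>t. H_derivs J hs (P t f)"
  let ?q = "\<lambda>s t. exp (- lam * t) * ?W t (x + s *\<^sub>R J h) - exp (- lam * t) * ?W t x"
  let ?w = "\<lambda>t. dconst (Suc (length hs)) * \<pi> (h # hs) * B * weight (Suc (length hs)) t"
  have df: "H_differentiable J h (?W t)" if "0 < t" for t
    using P_smooth[OF that f] by (simp add: H_smooth_def)
  have "(\<lambda>i. LINT t|halfline. ?q (u i) t / u i) \<longlonglongrightarrow> (LINT t|halfline. exp (- lam * t) * H_derivs J (h # hs) (P t f) x)"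
  proof (rule integral_dominated_convergence[where w="?w"])
    show "integrable halfline ?w" using weight_integrable[OF n] by simp
    show "(\<lambda>t. ?q (u i) t / u i) \<in> borel_measurable halfline" for i
      by (intro borel_measurable_divide borel_measurable_diff U_integrand_measurable) auto
    show "(\<lambda>t. exp (- lam * t) * H_derivs J (h # hs) (P t f) x) \<in> borel_measurable halfline"
      by (rule U_integrand_measurable)
    show "AE t in halfline. norm (?q (u i) t / u i) \<le> ?w t" for i
    proof (rule AE_I2)
      fix t assume "t \<in> space halfline"
      then have t: "0 < t" by (simp add: space_restrict_space)
      have "\<bar>?W t (x + u i *\<^sub>R J h) - ?W t x\<bar> \<le> \<bar>u i\<bar> * (dconst (Suc (length hs)) * \<kappa> t ^ Suc (length hs) * \<pi> (h # hs) * B)"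
        using P_bound[OF t f B, of "h # hs"] by (intro H_deriv_increment_le[OF df[OF t]]) auto
      then have "\<bar>?W t (x + u i *\<^sub>R J h) - ?W t x\<bar> / \<bar>u i\<bar> \<le> dconst (Suc (length hs)) * \<kappa> t ^ Suc (length hs) * \<pi> (h # hs) * B"
        using u0 by (simp add: divide_le_eq mult.commute del: dconst.simps power_Suc)
      then have "exp (- lam * t) * (\<bar>?W t (x + u i *\<^sub>R J h) - ?W t x\<bar> / \<bar>u i\<bar>)
          \<le> exp (- lam * t) * (dconst (Suc (length hs)) * \<kappa> t ^ Suc (length hs) * \<pi> (h # hs) * B)"
        by (intro mult_left_mono) auto
      then show "norm (?q (u i) t / u i) \<le> ?w t"
        by (simp add: right_diff_distrib[symmetric] abs_mult weight_def mult_ac del: dconst.simps power_Suc)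
    qed
    show "AE t in halfline. (\<lambda>i. ?q (u i) t / u i) \<longlonglongrightarrow> exp (- lam * t) * H_derivs J (h # hs) (P t f) x"
    proof (rule AE_I2)
      fix t assume "t \<in> space halfline"
      then have t: "0 < t" by (simp add: space_restrict_space)
      have "((\<lambda>s. (?W t (x + s *\<^sub>R J h) - ?W t x) / s) \<longlongrightarrow> H_derivs J (h # hs) (P t f) x) (at 0)"
        using H_differentiable_DERIV_0[OF df[OF t], of x] by (simp add: DERIV_def)
      then have "(\<lambda>i. (?W t (x + u i *\<^sub>R J h) - ?W t x) / u i) \<longlonglongrightarrow> H_derivs J (h # hs) (P t f) x"
        using u0 u by (auto simp: tendsto_at_iff_sequentially comp_def)
      then have "(\<lambda>i. exp (- lam * t) * ((?W t (x + u i *\<^sub>R J h) - ?W t x) / u i)) \<longlonglongrightarrow> exp (- lam * t) * H_derivs J (h # hs) (P t f) x"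
        by (intro tendsto_mult tendsto_const)
      then show "(\<lambda>i. ?q (u i) t / u i) \<longlonglongrightarrow> exp (- lam * t) * H_derivs J (h # hs) (P t f) x"
        by (simp add: right_diff_distrib[symmetric])
    qed
  qed
  then have "(\<lambda>i. LINT t|halfline. ?q (u i) t / u i) \<longlonglongrightarrow> U (h # hs) x"
    by (simp only: U_def)
  moreover have "(LINT t|halfline. ?q s t / s) = (U hs (x + s *\<^sub>R J h) - U hs x) / s" for s
    unfolding U_def using U_integrable[OF n' refl] by (simp only: integral_divide_zero Bochner_Integration.integral_diff)
  ultimately show "(\<lambda>i. (U hs (x + (0 + u i) *\<^sub>R J h) - U hs (x + 0 *\<^sub>R J h)) / u i) \<longlonglongrightarrow> U (h # hs) x"
    by (simp only: add_0 scaleR_zero_left add_0_right)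
qed

section \<open>Identification of the derivatives of the resolvent\<close>

definition U_form :: "nat \<Rightarrow> 'a \<Rightarrow> 'h list \<Rightarrow> real" where
  "U_form n x hs = (if length hs = n then U hs x else 0)"

lemma U_form_norm_le:
  assumes n: "real n * \<theta> < 1"
  shows "form_norm n (U_form n x) \<le> ennreal (dconst n * weight_int lam n * B)"
  using U_bound[OF n] by (intro form_norm_le) (simp add: U_form_def)

lemma U_form_in_forms:
  assumes n: "real n * \<theta> < 1"
  shows "U_form n x \<in> forms n"
  unfolding forms_def
proof (intro CollectI conjI allI impI)
  show "form_norm n (U_form n x) < \<infinity>"
    using U_form_norm_le[OF n] by (rule order.strict_trans1) simp
  fix hs :: "'h list" and i assume hs: "length hs = n" "i < n"
  let ?W = "\<lambda>h t. H_derivs J (hs[i := h]) (P t f) x"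
  have lin: "linear (\<lambda>h. ?W h t)" if "t \<in> space halfline" for t
    using that hs by (intro linear_H_derivs[OF J_linear P_smooth[OF _ f]]) (auto simp: space_restrict_space)
  have int: "integrable halfline (\<lambda>t. exp (- lam * t) * ?W h t)" for h
    using hs by (intro U_integrable[OF n]) simp
  have "linear (\<lambda>h. U (hs[i := h]) x)"
  proof (rule linearI)
    fix h k and c :: real
    have "U (hs[i := h + k]) x = (LINT t|halfline. exp (- lam * t) * ?W h t + exp (- lam * t) * ?W k t)"
      unfolding U_def by (rule Bochner_Integration.integral_cong) (simp_all add: linear_add[OF lin] distrib_left)
    also have "\<dots> = U (hs[i := h]) x + U (hs[i := k]) x"
      unfolding U_def by (rule Bochner_Integration.integral_add[OF int int])
    finally show "U (hs[i := h + k]) x = U (hs[i := h]) x + U (hs[i := k]) x" .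
    have "U (hs[i := c *\<^sub>R h]) x = (LINT t|halfline. c * (exp (- lam * t) * ?W h t))"
      unfolding U_def by (rule Bochner_Integration.integral_cong) (simp_all add: linear_cmul[OF lin])
    then show "U (hs[i := c *\<^sub>R h]) x = c *\<^sub>R U (hs[i := h]) x" by (simp add: U_def)
  qed
  then show "linear (\<lambda>h. U_form n x (hs[i := h]))" using hs by (simp add: U_form_def)
qed (simp add: U_form_def)

text \<open>\<open>U_H_derivative\<close> is a limit for each \<open>hs\<close> separately, whereas
  the norm requires uniformity in \<open>hs\<close>. By the mean value theorem the quotient is
  \<open>U (h # hs)\<close> at a point of the segment, and \<open>U_norm_continuous\<close> of order
  \<open>n + 1\<close> provides a common modulus.\<close>

lemma U_form_has_H_derivative:
  assumes n: "real (Suc n) * \<theta> < 1"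
  shows "has_H_derivative J n (U_form n) (U_form (Suc n) x) x"
  unfolding has_H_derivative_def
proof (intro conjI allI)
  show "U_form (Suc n) x \<in> forms (Suc n)" by (rule U_form_in_forms[OF n])
  fix h
  obtain m where m: "m \<midarrow>x\<rightarrow> (0::real)" "\<And>y hs. length hs = Suc n \<Longrightarrow> \<bar>U hs y - U hs x\<bar> \<le> m y * \<pi> hs"
    using U_norm_continuous[OF n, of x] by metis
  show "((\<lambda>t. form_norm n (\<lambda>hs. (U_form n (x + t *\<^sub>R J h) hs - U_form n x hs) / t - U_form (Suc n) x (h # hs))) \<longlongrightarrow> 0) (at 0)"
  proof (rule form_norm_tendsto_0)
    fix e :: real assume e: "0 < e"
    \<comment> \<open>The product over \<open>h # hs\<close> carries the factor
      \<open>norm h\<close>; adding 1 avoids division by zero.\<close>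
    define e' where "e' = e / (norm h + 1)"
    have h1: "0 < norm h + 1" by (rule add_nonneg_pos) auto
    have e': "0 < e'" "e' * norm h \<le> e"
      using e h1 by (simp_all add: e'_def pos_divide_le_eq)
    obtain \<delta> where \<delta>: "0 < \<delta>" "\<And>y. y \<noteq> x \<Longrightarrow> norm (y - x) < \<delta> \<Longrightarrow> \<bar>m y\<bar> < e'"
      using m(1) e'(1) by (force simp: LIM_def dist_norm)
    have near: "\<bar>U hs y - U hs x\<bar> \<le> e' * \<pi> hs" if "norm (y - x) < \<delta>" "length hs = Suc n" for y hs
    \<comment> \<open>The limit of \<open>m\<close> at \<open>x\<close> gives no information on the
      value \<open>m x\<close>.\<close>
    proof (cases "y = x")
      case True
      then show ?thesis using e'(1) prod_list_norm_nonneg[of hs] by simp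
    next
      case False
      have "\<bar>U hs y - U hs x\<bar> \<le> m y * \<pi> hs" by (rule m(2)[OF that(2)])
      also have "\<dots> \<le> e' * \<pi> hs"
        using \<delta>(2)[OF False that(1)] prod_list_norm_nonneg[of hs] by (intro mult_right_mono) auto
      finally show ?thesis .
    qed
    have "((\<lambda>t. norm (t *\<^sub>R J h)) \<longlongrightarrow> 0) (at (0::real))" by (auto intro!: tendsto_eq_intros)
    then have "\<forall>\<^sub>F t in at (0::real). norm (t *\<^sub>R J h) < \<delta>"
      using \<delta>(1) by (rule order_tendstoD)
    moreover have "\<forall>\<^sub>F t in at (0::real). t \<noteq> 0" by (rule eventually_neq_at_within)
    ultimately show "\<forall>\<^sub>F t in at 0. \<forall>hs. length hs = n \<longrightarrow>
        \<bar>(U_form n (x + t *\<^sub>R J h) hs - U_form n x hs) / t - U_form (Suc n) x (h # hs)\<bar> \<le> e * \<pi> hs"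
    proof eventually_elim
      case (elim t)
      show ?case
      proof (intro allI impI)
        fix hs :: "'h list" assume hs: "length hs = n"
        have D: "((\<lambda>s. U hs (y + s *\<^sub>R J h)) has_field_derivative U (h # hs) y) (at 0)" for y
          using n hs by (intro U_H_derivative) simp
        have df: "H_differentiable J h (U hs)" using D by (rule H_differentiableI[of "U hs" J h "U (h # hs)"])
        have Dh: "H_deriv J h (U hs) y = U (h # hs) y" for y by (intro H_deriv_eqI D)
        obtain \<xi> where \<xi>: "\<bar>\<xi>\<bar> \<le> \<bar>t\<bar>" "U hs (x + t *\<^sub>R J h) - U hs x = t * H_deriv J h (U hs) (x + \<xi> *\<^sub>R J h)"
          using H_deriv_mvt[OF df] by metis
        have "norm (\<xi> *\<^sub>R J h) \<le> norm (t *\<^sub>R J h)" using \<xi>(1) by (simp add: mult_right_mono)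
        then have "\<bar>U (h # hs) (x + \<xi> *\<^sub>R J h) - U (h # hs) x\<bar> \<le> e' * \<pi> (h # hs)"
          using elim hs by (intro near) auto
        also have "\<dots> = (e' * norm h) * \<pi> hs" by simp
        also have "\<dots> \<le> e * \<pi> hs" using e'(2) prod_list_norm_nonneg[of hs] by (rule mult_right_mono)
        finally show "\<bar>(U_form n (x + t *\<^sub>R J h) hs - U_form n x hs) / t - U_form (Suc n) x (h # hs)\<bar> \<le> e * \<pi> hs"
          using \<xi>(2) elim(2) hs by (simp add: U_form_def Dh)
      qed
    qed
  qed
qed

text \<open>The definite description in \<open>D_H\<close> is resolved by
  \<open>has_H_derivative_unique\<close> together with the derivative just exhibited.\<close>

lemma D_H_resolvent:
  assumes n: "real n * \<theta> < 1"
  shows "D_H J n (mehler_resolvent T \<mu> lam f) = U_form n"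
  using n
proof (induction n)
  case 0
  show ?case by (auto simp: U_form_def U_Nil fun_eq_iff)
next
  case (Suc n)
  have "real n * \<theta> \<le> real (Suc n) * \<theta>" using pos by (intro mult_right_mono) auto
  then have IH: "D_H J n (mehler_resolvent T \<mu> lam f) = U_form n" using Suc by simp
  show ?case
  proof
    fix x
    show "D_H J (Suc n) (mehler_resolvent T \<mu> lam f) x = U_form (Suc n) x"
      unfolding D_H.simps IH using U_form_has_H_derivative[OF Suc.prems]
      by (intro the_equality) (auto intro: has_H_derivative_unique)
  qed
qed

text \<open>All orders up to \<open>n\<close> are subcritical, so everything but the Zygmund
  seminorm is already controlled. What remains for both parts of the theorem is the pointwise second
  difference estimate \<open>zyg\<close>.\<close>

lemma resolvent_in_zygmund_space:
  assumes n: "real n * \<theta> < 1" and K: "0 \<le> K"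
    and zyg: "\<And>hs x h. length hs = n \<Longrightarrow> h \<noteq> 0 \<Longrightarrow>
      \<bar>U hs (x + 2 *\<^sub>R J h) - 2 * U hs (x + J h) + U hs x\<bar> \<le> K * norm h * \<pi> hs"
  shows "mehler_resolvent T \<mu> lam f \<in> zygmund_space J (Suc n)"
    "zygmund_norm J (Suc n) (mehler_resolvent T \<mu> lam f) \<le> ennreal ((\<Sum>k=0..n. dconst k * weight_int lam k) * B + K)"
proof -
  let ?u = "mehler_resolvent T \<mu> lam f"
  have le: "real k * \<theta> < 1" if "k \<le> n" for k
    using n that pos mult_right_mono[of "real k" "real n" \<theta>] by linarith
  have DH: "D_H J k ?u = U_form k" if "k \<le> n" for k using D_H_resolvent[OF le[OF that]] .
  have zs: "zygmund_seminorm J n (U_form n) \<le> ennreal K"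
    unfolding zygmund_seminorm_def
  proof (intro SUP_least)
    fix x and h :: 'h assume "h \<in> - {0}"
    then have h: "0 < norm h" by simp
    have "form_norm n (\<lambda>hs. U_form n (x + 2 *\<^sub>R J h) hs - 2 * U_form n (x + J h) hs + U_form n x hs) \<le> ennreal (K * norm h)"
      using zyg h by (intro form_norm_le) (simp add: U_form_def)
    then have "form_norm n (\<lambda>hs. U_form n (x + 2 *\<^sub>R J h) hs - 2 * U_form n (x + J h) hs + U_form n x hs) / ennreal (norm h)
        \<le> ennreal (K * norm h) / ennreal (norm h)"
      by (rule divide_right_mono_ennreal)
    also have "\<dots> = ennreal K" using h K by (simp add: divide_ennreal)
    finally show "form_norm n (\<lambda>hs. U_form n (x + 2 *\<^sub>R J h) hs - 2 * U_form n (x + J h) hs + U_form n x hs) / ennreal (norm h) \<le> ennreal K" .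
  qed
  have sup: "(SUP x. form_norm k (U_form k x)) \<le> ennreal (dconst k * weight_int lam k * B)" if "k \<le> n" for k
    by (intro SUP_least U_form_norm_le le[OF that])
  have "U_form n \<in> Cb_forms n"
    unfolding Cb_forms_def
  proof (intro CollectI conjI allI)
    show "U_form n x \<in> forms n" for x by (rule U_form_in_forms[OF n])
    show "(SUP x. form_norm n (U_form n x)) < \<infinity>"
      using sup[of n] by (rule order.strict_trans1) auto
    fix x
    obtain m where m: "m \<midarrow>x\<rightarrow> (0::real)" "\<And>y hs. length hs = n \<Longrightarrow> \<bar>U hs y - U hs x\<bar> \<le> m y * \<pi> hs"
      using U_norm_continuous[OF n, of x] by metis
    show "((\<lambda>y. form_norm n (\<lambda>hs. U_form n y hs - U_form n x hs)) \<longlongrightarrow> 0) (at x)"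
    proof (rule form_norm_tendsto_0)
      fix e :: real assume "0 < e"
      with m(1) have "\<forall>\<^sub>F y in at x. m y < e" by (rule order_tendstoD)
      then show "\<forall>\<^sub>F y in at x. \<forall>hs. length hs = n \<longrightarrow> \<bar>U_form n y hs - U_form n x hs\<bar> \<le> e * \<pi> hs"
      proof eventually_elim
        case (elim y)
        show ?case
        proof (intro allI impI)
          fix hs :: "'h list" assume hs: "length hs = n"
          have "m y * \<pi> hs \<le> e * \<pi> hs" using elim prod_list_norm_nonneg[of hs] by (intro mult_right_mono) auto
          then show "\<bar>U_form n y hs - U_form n x hs\<bar> \<le> e * \<pi> hs" using m(2)[OF hs, of y] hs by (simp add: U_form_def)
        qed
      qed
    qed
  qed
  then have Z1: "U_form n \<in> Z1_forms J n"
    using zs by (auto simp: Z1_forms_def intro: order.strict_trans1)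
  have "?u \<in> C_H J n"
    unfolding C_H_def
  proof (intro CollectI conjI allI impI ballI)
    show "?u \<in> bcontfun" using U_bcontfun[of "[]"] by (simp add: U_Nil)
    show "\<exists>D. has_H_derivative J k (D_H J k ?u) D x" if "k < n" for k x
      using U_form_has_H_derivative[OF le, of k x] that by (auto simp: DH)
    show "(\<lambda>x. D_H J k ?u x hs) \<in> bcontfun" if "k \<in> {1..n}" "length hs = k" for k hs
      using that U_bcontfun[of hs] le[of k] by (simp add: DH U_form_def)
  qed
  then show "?u \<in> zygmund_space J (Suc n)"
    using Z1 by (simp add: zygmund_space_def DH)
  \<comment> \<open>The sup norm is the term \<open>k = 0\<close>, which merges it into the sum over
    the orders.\<close>
  have "sup_norm ?u = (SUP x. form_norm 0 (U_form 0 x))"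
    by (simp add: sup_norm_def form_norm_0 U_form_def U_Nil)
  then have "C_H_norm J n ?u = (\<Sum>k=0..n. SUP x. form_norm k (U_form k x))"
    by (simp add: C_H_norm_def sum.atLeast_Suc_atMost DH)
  also have "\<dots> \<le> (\<Sum>k=0..n. ennreal (dconst k * weight_int lam k * B))"
    by (intro sum_mono sup) simp
  also have "\<dots> = ennreal ((\<Sum>k=0..n. dconst k * weight_int lam k) * B)"
    using dconst_nonneg weight_int_nonneg B_nonneg by (subst sum_ennreal) (auto simp: sum_distrib_right)
  finally have "zygmund_norm J (Suc n) ?u \<le> ennreal ((\<Sum>k=0..n. dconst k * weight_int lam k) * B) + ennreal K"
    using zs by (auto simp: zygmund_norm_def DH intro: add_mono)
  also have "\<dots> = ennreal ((\<Sum>k=0..n. dconst k * weight_int lam k) * B + K)"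
    using dconst_nonneg weight_int_nonneg B_nonneg K by (intro ennreal_plus[symmetric] mult_nonneg_nonneg sum_nonneg) auto
  finally show "zygmund_norm J (Suc n) ?u \<le> ennreal ((\<Sum>k=0..n. dconst k * weight_int lam k) * B + K)" .
qed

section \<open>Second differences at the critical order\<close>

lemma U_second_difference:
  assumes n: "real (length hs) * \<theta> < 1"
  shows "U hs (x + 2 *\<^sub>R J h) - 2 * U hs (x + J h) + U hs x = (LINT t|halfline. exp (- lam * t) *
    (H_derivs J hs (P t f) (x + 2 *\<^sub>R J h) - 2 * H_derivs J hs (P t f) (x + J h) + H_derivs J hs (P t f) x))"
proof -
  note i = U_integrable[OF n refl]
  have "U hs (x + 2 *\<^sub>R J h) - 2 * U hs (x + J h) + U hs x = (LINT t|halfline. exp (- lam * t) * H_derivs J hs (P t f) (x + 2 *\<^sub>R J h)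
      - 2 * (exp (- lam * t) * H_derivs J hs (P t f) (x + J h)) + exp (- lam * t) * H_derivs J hs (P t f) x)"
    unfolding U_def using i by (simp del: mult_minus_left)
  then show ?thesis by (simp add: algebra_simps)
qed

lemma second_difference_measurable:
  "(\<lambda>t. H_derivs J hs (P t f) y - 2 * H_derivs J hs (P t f) z + H_derivs J hs (P t f) x) \<in> borel_measurable halfline"
  by (intro borel_measurable_add borel_measurable_diff borel_measurable_times borel_measurable_const H_derivs_measurable f)

lemma first_difference_le:
  assumes t: "0 < t" and g: "g \<in> bcontfun" and b: "\<And>x. \<bar>g x\<bar> \<le> b"
  shows "\<bar>H_derivs J hs (P t g) (x + J h) - H_derivs J hs (P t g) x\<bar>
    \<le> dconst (Suc (length hs)) * \<kappa> t ^ Suc (length hs) * (norm h * \<pi> hs) * b"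
proof -
  have "H_differentiable J h (H_derivs J hs (P t g))" using P_smooth[OF t g] by (simp add: H_smooth_def)
  from H_deriv_increment_le[OF this, of "dconst (Suc (length hs)) * \<kappa> t ^ Suc (length hs) * (norm h * \<pi> hs) * b" x 1]
    P_bound[OF t g b, of "h # hs"]
  show ?thesis by (simp del: dconst.simps power_Suc)
qed

text \<open>The estimates use, in order: the values of the derivative alone with coefficients 1, 2,
  1; two first differences; two more derivatives along \<open>h\<close>; and, with one difference
  transferred to \<open>f\<close> by \<open>P_shift_diff\<close>, the values or one first difference
  of what is left.\<close>

lemma second_difference_le:
  assumes t: "0 < t"
  defines "G \<equiv> \<lambda>hs x h. H_derivs J hs (P t f) (x + 2 *\<^sub>R J h) - 2 * H_derivs J hs (P t f) (x + J h) + H_derivs J hs (P t f) x"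
  shows "\<bar>G hs x h\<bar> \<le> 4 * (dconst (length hs) * \<kappa> t ^ length hs * \<pi> hs * B)" (is ?A)
    "\<bar>G hs x h\<bar> \<le> 2 * (dconst (Suc (length hs)) * \<kappa> t ^ Suc (length hs) * (norm h * \<pi> hs) * B)" (is ?B)
    "\<bar>G hs x h\<bar> \<le> dconst (Suc (Suc (length hs))) * \<kappa> t ^ Suc (Suc (length hs)) * (norm h * (norm h * \<pi> hs)) * B" (is ?C)
    "(\<And>y. \<bar>f (y + T t (J h)) - f y\<bar> \<le> b) \<Longrightarrow> \<bar>G hs x h\<bar> \<le> 2 * (dconst (length hs) * \<kappa> t ^ length hs * \<pi> hs * b)" (is "PROP ?b \<Longrightarrow> ?D")
    "(\<And>y. \<bar>f (y + T t (J h)) - f y\<bar> \<le> b) \<Longrightarrow>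
      \<bar>G hs x h\<bar> \<le> dconst (Suc (length hs)) * \<kappa> t ^ Suc (length hs) * (norm h * \<pi> hs) * b" (is "PROP ?b \<Longrightarrow> ?E")
proof -
  let ?W = "H_derivs J hs (P t f)"
  have two: "x + 2 *\<^sub>R J h = x + J h + J h" by (simp add: scaleR_2 add.assoc)
  have sm: "H_smooth J (P t f)" by (rule P_smooth[OF t f])
  have bd: "\<bar>?W y\<bar> \<le> dconst (length hs) * \<kappa> t ^ length hs * \<pi> hs * B" for y by (rule P_bound[OF t f B])
  show ?A using bd[of "x + 2 *\<^sub>R J h"] bd[of "x + J h"] bd[of x] unfolding G_def by linarith
  show ?B using first_difference_le[OF t f B, of hs "x + J h" h] first_difference_le[OF t f B, of hs x h]
    unfolding G_def two by linarith
  have Geq: "G hs x h = (?W (x + J h + J h) - ?W (x + J h)) - (?W (x + J h) - ?W x)"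
    unfolding G_def two by simp
  define d where "d y = ?W (y + J h) - ?W y" for y
  have df: "H_differentiable J h ?W" using sm by (simp add: H_smooth_def)
  have "H_differentiable J h (\<lambda>y. 1 * ?W (y + J h) + (-1) * ?W y)"
    by (intro H_differentiable_lin H_differentiable_shift df)
  then have dd: "H_differentiable J h d" by (simp add: d_def[abs_def])
  have "H_deriv J h (\<lambda>y. 1 * ?W (y + J h) + (-1) * ?W y)
      = (\<lambda>y. 1 * H_deriv J h (\<lambda>y. ?W (y + J h)) y + (-1) * H_deriv J h ?W y)"
    by (intro H_deriv_lin H_differentiable_shift df)
  then have dderiv: "H_deriv J h d y = H_derivs J (h # hs) (P t f) (y + J h) - H_derivs J (h # hs) (P t f) y" for y
    using H_derivs_shift[of J "[h]" ?W "J h"] by (simp add: d_def[abs_def] fun_eq_iff)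
  have "\<bar>H_deriv J h d y\<bar> \<le> dconst (Suc (Suc (length hs))) * \<kappa> t ^ Suc (Suc (length hs)) * (norm h * (norm h * \<pi> hs)) * B" for y
    using first_difference_le[OF t f B, of "h # hs" y h] unfolding dderiv by (simp del: dconst.simps power_Suc H_derivs.simps)
  from H_deriv_increment_le[OF dd this, of x 1] show ?C
    by (simp add: Geq d_def del: dconst.simps power_Suc)
  define g where "g y = f (y + T t (J h)) - f y" for y
  have g: "g \<in> bcontfun" unfolding g_def[abs_def] by (rule P_shift_diff(1)[OF t f])
  have deq: "d y = H_derivs J hs (P t g) y" for y
    unfolding d_def g_def[abs_def] by (rule P_shift_diff(2)[OF t f])
  have Gd: "G hs x h = d (x + J h) - d x" by (simp add: Geq d_def)
  {
    assume "\<And>y. \<bar>f (y + T t (J h)) - f y\<bar> \<le> b"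
    then have b: "\<bar>g y\<bar> \<le> b" for y by (simp add: g_def)
    show ?D using P_bound[OF t g b, of hs "x + J h"] P_bound[OF t g b, of hs x] unfolding Gd deq by linarith
    show ?E using first_difference_le[OF t g b, of hs x h] unfolding Gd deq .
  }
qed

lemma \<kappa>_large: "1 < t \<Longrightarrow> \<kappa> t = 1"
  by (simp add: \<kappa>_def)

lemma \<kappa>_small: "0 < t \<Longrightarrow> t \<le> 1 \<Longrightarrow> real n * \<theta> = e \<Longrightarrow> \<kappa> t ^ n = t powr - e"
  using \<kappa>_power[of t n] by simp

text \<open>\<open>critical_integral\<close> with \<open>p = 0\<close> and \<open>q = 2\<close>: the
  crude bound of order \<open>n\<close> is integrable at 0, the bound of order \<open>n + 2\<close>
  away from it, and one first order bound serves times beyond 1.\<close>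

lemma critical_second_difference:
  assumes n: "real (Suc (length hs)) * \<theta> = 1" and h: "h \<noteq> 0"
  shows "\<bar>U hs (x + 2 *\<^sub>R J h) - 2 * U hs (x + J h) + U hs x\<bar> \<le>
    (4 * dconst (length hs) / \<theta> + dconst (Suc (Suc (length hs))) / \<theta> + 2 * dconst (Suc (length hs)) / lam) * B * norm h * \<pi> hs"
proof -
  let ?n = "length hs"
  have e: "real ?n * \<theta> = 1 - (1 - 0) * \<theta>" "real (Suc (Suc ?n)) * \<theta> = 1 + (2 - 1) * \<theta>"
    using n by (simp_all add: distrib_right)
  then have "real ?n * \<theta> < 1" using pos by simp
  from U_second_difference[OF this]
  have "\<bar>U hs (x + 2 *\<^sub>R J h) - 2 * U hs (x + J h) + U hs x\<bar> = \<bar>LINT t|halfline. exp (- lam * t) *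
    (H_derivs J hs (P t f) (x + 2 *\<^sub>R J h) - 2 * H_derivs J hs (P t f) (x + J h) + H_derivs J hs (P t f) x)\<bar>" by simp
  also have "\<dots> \<le> (4 * dconst ?n * \<pi> hs * B / ((1 - 0) * \<theta>) + dconst (Suc (Suc ?n)) * \<pi> hs * B / ((2 - 1) * \<theta>)
      + 2 * dconst (Suc ?n) * \<pi> hs * B / lam) * norm h"
  proof (rule critical_integral[OF second_difference_measurable])
    let ?G = "\<lambda>t. H_derivs J hs (P t f) (x + 2 *\<^sub>R J h) - 2 * H_derivs J hs (P t f) (x + J h) + H_derivs J hs (P t f) x"
    fix t :: real
    assume t: "0 < t" "t \<le> 1"
    show "\<bar>?G t\<bar> \<le> 4 * dconst ?n * \<pi> hs * B * norm h powr 0 * t powr - (1 - (1 - 0) * \<theta>)"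
      using second_difference_le(1)[OF t(1), of hs x h] h by (simp add: \<kappa>_small[OF t e(1)] mult_ac)
    show "\<bar>?G t\<bar> \<le> dconst (Suc (Suc ?n)) * \<pi> hs * B * norm h powr 2 * t powr - (1 + (2 - 1) * \<theta>)"
      using second_difference_le(3)[OF t(1), of hs x h] h unfolding \<kappa>_small[OF t e(2)]
      by (simp add: power2_eq_square mult_ac del: dconst.simps)
  next
    fix t :: real assume "1 < t"
    then show "\<bar>H_derivs J hs (P t f) (x + 2 *\<^sub>R J h) - 2 * H_derivs J hs (P t f) (x + J h) + H_derivs J hs (P t f) x\<bar>
        \<le> 2 * dconst (Suc ?n) * \<pi> hs * B * norm h"
      using second_difference_le(2)[of t hs x h] by (simp add: \<kappa>_large mult_ac del: dconst.simps)
  qed (use pos lam h B_nonneg dconst_nonneg[of "Suc (Suc ?n)"] dconst_nonneg[of "Suc ?n"] dconst_nonneg[of ?n] prod_list_norm_nonneg[of hs]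
      in \<open>auto intro!: mult_nonneg_nonneg simp del: dconst.simps\<close>)
  also have "\<dots> = (4 * dconst ?n / \<theta> + dconst (Suc (Suc ?n)) / \<theta> + 2 * dconst (Suc ?n) / lam) * B * norm h * \<pi> hs"
    by (simp add: distrib_left distrib_right mult_ac del: dconst.simps)
  finally show ?thesis .
qed

text \<open>\<open>critical_integral\<close> with \<open>p = \<alpha>\<close> and
  \<open>q = 1 + \<alpha>\<close>: the difference falling on \<open>f\<close> yields
  \<open>norm h powr \<alpha>\<close>, and the other one is left alone for small \<open>t\<close> or
  traded for a derivative.\<close>

lemma hoelder_second_difference:
  assumes n: "real (Suc (length hs)) * \<theta> = 1 + \<alpha> * \<theta>" and \<alpha>: "0 < \<alpha>" "\<alpha> < 1" and h: "h \<noteq> 0"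
    and b: "0 \<le> b" "\<And>x k. \<bar>f (x + J k) - f x\<bar> \<le> b * norm k powr \<alpha>"
  shows "\<bar>U hs (x + 2 *\<^sub>R J h) - 2 * U hs (x + J h) + U hs x\<bar> \<le>
    ((2 * dconst (length hs) / ((1 - \<alpha>) * \<theta>) + dconst (Suc (length hs)) / (\<alpha> * \<theta>)) * \<Lambda> powr \<alpha> * b
      + 2 * dconst (Suc (length hs)) / lam * B) * norm h * \<pi> hs"
proof -
  let ?n = "length hs"
  have e: "real ?n * \<theta> = 1 - (1 - \<alpha>) * \<theta>" "real (Suc ?n) * \<theta> = 1 + (1 + \<alpha> - 1) * \<theta>"
    using n by (simp_all add: algebra_simps)
  have "0 < (1 - \<alpha>) * \<theta>" using pos \<alpha> by simp
  then have "real ?n * \<theta> < 1" using e by linarith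
  from U_second_difference[OF this]
  have "\<bar>U hs (x + 2 *\<^sub>R J h) - 2 * U hs (x + J h) + U hs x\<bar> = \<bar>LINT t|halfline. exp (- lam * t) *
    (H_derivs J hs (P t f) (x + 2 *\<^sub>R J h) - 2 * H_derivs J hs (P t f) (x + J h) + H_derivs J hs (P t f) x)\<bar>" by simp
  also have "\<dots> \<le> (2 * dconst ?n * \<pi> hs * (b * \<Lambda> powr \<alpha>) / ((1 - \<alpha>) * \<theta>)
      + dconst (Suc ?n) * \<pi> hs * (b * \<Lambda> powr \<alpha>) / ((1 + \<alpha> - 1) * \<theta>) + 2 * dconst (Suc ?n) * \<pi> hs * B / lam) * norm h"
  proof (rule critical_integral[OF second_difference_measurable])
    let ?G = "\<lambda>t. H_derivs J hs (P t f) (x + 2 *\<^sub>R J h) - 2 * H_derivs J hs (P t f) (x + J h) + H_derivs J hs (P t f) x"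
    fix t :: real
    assume t: "0 < t" "t \<le> 1"
    have bt: "\<bar>f (y + T t (J h)) - f y\<bar> \<le> b * \<Lambda> powr \<alpha> * norm h powr \<alpha>" for y
    proof -
      have "\<bar>f (y + T t (J h)) - f y\<bar> \<le> b * norm (S t h) powr \<alpha>"
        unfolding T_J[OF t(1)] by (rule b(2))
      also have "\<dots> \<le> b * (\<Lambda> * norm h) powr \<alpha>"
        using norm_S[OF t] \<alpha> b(1) by (intro mult_left_mono powr_mono2) auto
      finally show ?thesis by (simp add: powr_mult mult.assoc)
    qed
    show "\<bar>?G t\<bar> \<le> 2 * dconst ?n * \<pi> hs * (b * \<Lambda> powr \<alpha>) * norm h powr \<alpha> * t powr - (1 - (1 - \<alpha>) * \<theta>)"
      using second_difference_le(4)[OF t(1) bt, of hs x] unfolding \<kappa>_small[OF t e(1)] by (simp add: mult_ac)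
    have "norm h powr (1 + \<alpha>) = norm h * norm h powr \<alpha>" using h by (simp add: powr_add)
    then show "\<bar>?G t\<bar> \<le> dconst (Suc ?n) * \<pi> hs * (b * \<Lambda> powr \<alpha>) * norm h powr (1 + \<alpha>) * t powr - (1 + (1 + \<alpha> - 1) * \<theta>)"
      using second_difference_le(5)[OF t(1) bt, of hs x] unfolding \<kappa>_small[OF t e(2)]
      by (simp add: mult_ac del: dconst.simps)
  next
    \<comment> \<open>\<open>norm_S\<close> covers times up to 1; beyond it the sup bound of
      \<open>f\<close> is used, which brings \<open>B\<close> into the constant.\<close>
    fix t :: real assume "1 < t"
    then show "\<bar>H_derivs J hs (P t f) (x + 2 *\<^sub>R J h) - 2 * H_derivs J hs (P t f) (x + J h) + H_derivs J hs (P t f) x\<bar>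
        \<le> 2 * dconst (Suc ?n) * \<pi> hs * B * norm h"
      using second_difference_le(2)[of t hs x h] by (simp add: \<kappa>_large mult_ac del: dconst.simps)
  qed (use pos lam h \<alpha> b B_nonneg dconst_nonneg[of "Suc ?n"] dconst_nonneg[of ?n] prod_list_norm_nonneg[of hs]
      in \<open>auto intro!: mult_nonneg_nonneg simp del: dconst.simps\<close>)
  also have "\<dots> = ((2 * dconst ?n / ((1 - \<alpha>) * \<theta>) + dconst (Suc ?n) / (\<alpha> * \<theta>)) * \<Lambda> powr \<alpha> * b
      + 2 * dconst (Suc ?n) / lam * B) * norm h * \<pi> hs"
    by (simp add: distrib_left distrib_right mult_ac del: dconst.simps)
  finally show ?thesis .
qed

end

section \<open>Finite norms and the two regularity statements\<close>

lemma sup_normE: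
  assumes "f \<in> bcontfun"
  obtains B where "0 \<le> B" "sup_norm f = ennreal B" "\<And>x. \<bar>f x\<bar> \<le> B"
proof -
  obtain B0 where "\<And>x. \<bar>f x\<bar> \<le> B0" using bcontfun_boundE[OF assms] by blast
  then have "sup_norm f \<le> ennreal B0" unfolding sup_norm_def by (intro SUP_least ennreal_leI)
  then obtain B where B: "0 \<le> B" "sup_norm f = ennreal B" by (cases "sup_norm f") (auto simp: top_unique)
  have "ennreal \<bar>f x\<bar> \<le> ennreal B" for x unfolding B(2)[symmetric] sup_norm_def by (rule SUP_upper) simp
  then show thesis using that B by simp
qed

lemma hoelder_seminormE:
  assumes J: "J 0 = 0" and f: "f \<in> hoelder_space J \<alpha>"
  obtains b where "0 \<le> b" "hoelder_seminorm J \<alpha> f = ennreal b" "\<And>x k. \<bar>f (x + J k) - f x\<bar> \<le> b * norm k powr \<alpha>"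
proof -
  obtain b where b: "0 \<le> b" "hoelder_seminorm J \<alpha> f = ennreal b"
    using f by (cases "hoelder_seminorm J \<alpha> f") (auto simp: hoelder_space_def)
  have "\<bar>f (x + J k) - f x\<bar> \<le> b * norm k powr \<alpha>" for x k
  proof (cases "k = 0")
    case False
    then have "ennreal (\<bar>f (x + J k) - f x\<bar> / norm k powr \<alpha>) \<le> hoelder_seminorm J \<alpha> f"
      unfolding hoelder_seminorm_def by (intro SUP_upper2[of x] SUP_upper2[of k]) auto
    then show ?thesis using b False by (simp add: divide_le_eq)
  qed (simp add: J)
  then show thesis using that b by blast
qed

theorem theorem3p9:
  fixes T :: "real \<Rightarrow> 'a::{banach,second_countable_topology} \<Rightarrow>\<^sub>L 'a"
    and \<mu> :: "real \<Rightarrow> 'a measure"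
    and J :: "'h::banach \<Rightarrow> 'a"
    and Ht :: "real \<Rightarrow> 'a set"
    and M C \<theta> \<omega> lam :: real
  assumes mehler: "generalized_mehler T \<mu>"
    and Ht: "\<And>t. 0 < t \<Longrightarrow> subspace (Ht t) \<and> Ht t \<noteq> {0}"
    and fomin: "\<And>t h. 0 < t \<Longrightarrow> h \<in> Ht t \<Longrightarrow> fomin_differentiable (\<mu> t) h"
    and embedding: "bounded_linear J" "inj J"
    and constants: "0 < M" "0 < C" "0 < \<theta>"
    and T_H: "\<And>t h. 0 < t \<Longrightarrow> \<exists>g. T t (J h) = J g \<and> norm g \<le> M * exp (\<omega> * t) * norm h"
    and T_Ht: "\<And>t h. 0 < t \<Longrightarrow> T t (J h) \<in> Ht t"
    and density: "\<And>t h. 0 < t \<Longrightarrow> \<exists>\<beta>. fomin_density (\<mu> t) (T t (J h)) \<beta> \<and>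
      (LINT y|\<mu> t. \<bar>\<beta> y\<bar>) \<le> C * exp (\<omega> * t) * t powr (- \<theta>) * norm h"
    and lam: "0 < lam"
  shows "(\<forall>k::nat. 1 \<le> k \<and> 1 / \<theta> = real k \<longrightarrow>
      (\<exists>K>0. \<forall>f\<in>bcontfun.
        mehler_resolvent T \<mu> lam f \<in> zygmund_space J k \<and>
        zygmund_norm J k (mehler_resolvent T \<mu> lam f) \<le> ennreal K * sup_norm f)) \<and>
    (\<forall>(\<alpha>::real) k::nat. 0 < \<alpha> \<and> \<alpha> < 1 \<and> 1 \<le> k \<and> \<alpha> + 1 / \<theta> = real k \<longrightarrow>
      (\<exists>K>0. \<forall>f\<in>hoelder_space J \<alpha>.
        mehler_resolvent T \<mu> lam f \<in> zygmund_space J k \<and>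
        zygmund_norm J k (mehler_resolvent T \<mu> lam f) \<le> ennreal K * hoelder_norm J \<alpha> f))"
proof -
  \<comment> \<open>For \<open>0 < t \<le> 1\<close> the growth factor is at most
    \<open>exp \<bar>\<omega>\<bar>\<close>, so it is absorbed into the constants.\<close>
  define \<Lambda> where "\<Lambda> = M * exp \<bar>\<omega>\<bar>"
  define \<Gamma> where "\<Gamma> = C * exp \<bar>\<omega>\<bar>"
  have expw: "exp (\<omega> * t) \<le> exp \<bar>\<omega>\<bar>" if "0 < t" "t \<le> 1" for t
  proof -
    have "\<omega> * t \<le> \<bar>\<omega>\<bar> * t" using that by (intro mult_right_mono) auto
    also have "\<dots> \<le> \<bar>\<omega>\<bar>" using that by (simp add: mult_left_le)
    finally show ?thesis by simp
  qed
  \<comment> \<open>The implication is moved inside the existential so that the choice of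
    \<open>S\<close> is made for all \<open>t\<close>.\<close>
  have "\<forall>t h. \<exists>g. 0 < t \<longrightarrow> T t (J h) = J g \<and> norm g \<le> M * exp (\<omega> * t) * norm h"
    using T_H by blast
  then obtain S where S: "\<And>t h. 0 < t \<Longrightarrow> T t (J h) = J (S t h)"
      "\<And>t h. 0 < t \<Longrightarrow> norm (S t h) \<le> M * exp (\<omega> * t) * norm h"
    by metis
  interpret generalized_mehler T \<mu> by (rule mehler)
  interpret smoothing_mehler T \<mu> J S \<Lambda> \<Gamma> \<theta>
  proof (intro smoothing_mehler.intro smoothing_mehler_axioms.intro mehler)
    fix t :: real and h :: 'h assume t: "0 < t" "t \<le> 1"
    have "M * exp (\<omega> * t) * norm h \<le> \<Lambda> * norm h"
      unfolding \<Lambda>_def using expw[OF t] constants by (intro mult_right_mono mult_left_mono) auto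
    then show "norm (S t h) \<le> \<Lambda> * norm h" using S(2)[OF t(1), of h] by linarith
    obtain \<beta> where \<beta>: "fomin_density (\<mu> t) (T t (J h)) \<beta>"
        "(LINT y|\<mu> t. \<bar>\<beta> y\<bar>) \<le> C * exp (\<omega> * t) * t powr (- \<theta>) * norm h"
      using density[OF t(1)] by blast
    have "C * exp (\<omega> * t) * t powr (- \<theta>) * norm h \<le> \<Gamma> * t powr (- \<theta>) * norm h"
      unfolding \<Gamma>_def using expw[OF t] constants by (intro mult_right_mono mult_left_mono) auto
    then show "\<exists>\<beta>. fomin_density (\<mu> t) (T t (J h)) \<beta> \<and> (LINT y|\<mu> t. \<bar>\<beta> y\<bar>) \<le> \<Gamma> * t powr (- \<theta>) * norm h"
      using \<beta> by (intro exI[of _ \<beta>]) auto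
  qed (use embedding S constants in \<open>auto simp: \<Lambda>_def \<Gamma>_def\<close>)
  define A where "A n = (\<Sum>k=0..n. dconst k * weight_int lam k)" for n
  have A0: "0 \<le> A n" for n
  proof -
    have "0 \<le> weight_int lam k" for k
      unfolding weight_int_def \<kappa>_def by (intro integral_nonneg_AE AE_I2) simp
    then show ?thesis unfolding A_def by (intro sum_nonneg mult_nonneg_nonneg dconst_nonneg)
  qed
  note dn = dconst_nonneg
  show ?thesis
  proof (intro conjI allI impI)
    fix k :: nat assume k: "1 \<le> k \<and> 1 / \<theta> = real k"
    \<comment> \<open>\<open>n = k - 1\<close> is the highest order of classical derivatives; order
      \<open>k\<close> sits at the critical exponent \<open>k \<theta> = 1\<close>.\<close>
    then obtain n where n: "k = Suc n" by (cases k) auto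
    have kn: "real (Suc n) * \<theta> = 1" using k constants unfolding n by (simp add: field_simps)
    then have n1: "real n * \<theta> < 1" using constants by (simp add: distrib_right)
    define Kz where "Kz = 4 * dconst n / \<theta> + dconst (Suc (Suc n)) / \<theta> + 2 * dconst (Suc n) / lam"
    have Kz: "0 \<le> Kz" unfolding Kz_def using dn[of n] dn[of "Suc n"] dn[of "Suc (Suc n)"] lam constants
      by (simp del: dconst.simps)
    show "\<exists>K>0. \<forall>f\<in>bcontfun. mehler_resolvent T \<mu> lam f \<in> zygmund_space J k \<and>
        zygmund_norm J k (mehler_resolvent T \<mu> lam f) \<le> ennreal K * sup_norm f"
    \<comment> \<open>The witness is named before \<open>f\<close> is introduced; the summand 1
      secures positivity.\<close>
    proof (intro exI[of _ "A n + Kz + 1"] conjI ballI)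
      show "0 < A n + Kz + 1" using A0[of n] Kz by linarith
      fix f :: "'a \<Rightarrow> real" assume f: "f \<in> bcontfun"
      obtain B where Bf: "0 \<le> B" "sup_norm f = ennreal B" "\<And>x. \<bar>f x\<bar> \<le> B" using sup_normE[OF f] by metis
      interpret smoothing_resolvent T \<mu> J S \<Lambda> \<Gamma> \<theta> lam f B by unfold_locales (fact lam f Bf(3))+
      have z: "\<bar>U hs (x + 2 *\<^sub>R J h) - 2 * U hs (x + J h) + U hs x\<bar> \<le> Kz * B * norm h * \<pi> hs"
        if "length hs = n" "h \<noteq> 0" for hs x h
        using critical_second_difference[of hs h x] kn that by (simp add: Kz_def del: dconst.simps)
      have KB: "0 \<le> Kz * B" using Kz Bf by simp
      show "mehler_resolvent T \<mu> lam f \<in> zygmund_space J k"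
        unfolding n by (rule resolvent_in_zygmund_space(1)[OF n1 KB z])
      have "zygmund_norm J k (mehler_resolvent T \<mu> lam f) \<le> ennreal (A n * B + Kz * B)"
        unfolding n A_def by (rule resolvent_in_zygmund_space(2)[OF n1 KB z])
      also have "\<dots> \<le> ennreal ((A n + Kz + 1) * B)" using Bf by (intro ennreal_leI) (simp add: distrib_right)
      also have "\<dots> = ennreal (A n + Kz + 1) * sup_norm f" using A0[of n] Kz Bf by (simp add: ennreal_mult)
      finally show "zygmund_norm J k (mehler_resolvent T \<mu> lam f) \<le> ennreal (A n + Kz + 1) * sup_norm f" .
    qed
  next
    fix \<alpha> :: real and k :: nat assume "0 < \<alpha> \<and> \<alpha> < 1 \<and> 1 \<le> k \<and> \<alpha> + 1 / \<theta> = real k"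
    then have \<alpha>: "0 < \<alpha>" "\<alpha> < 1" and k: "1 \<le> k" "\<alpha> + 1 / \<theta> = real k" by auto
    then obtain n where n: "k = Suc n" by (cases k) auto
    \<comment> \<open>Order \<open>k\<close> now exceeds the critical exponent by
      \<open>\<alpha> \<theta>\<close>, the gain from Hoelder regularity, while order
      \<open>n\<close> stays below it because \<open>\<alpha> < 1\<close>.\<close>
    have kn: "real (Suc n) * \<theta> = 1 + \<alpha> * \<theta>" using k(2) constants unfolding n by (simp add: field_simps)
    have "0 < (1 - \<alpha>) * \<theta>" using \<alpha> constants by simp
    then have n1: "real n * \<theta> < 1" using kn by (simp add: algebra_simps)
    define K1 where "K1 = (2 * dconst n / ((1 - \<alpha>) * \<theta>) + dconst (Suc n) / (\<alpha> * \<theta>)) * \<Lambda> powr \<alpha>"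
    define K2 where "K2 = 2 * dconst (Suc n) / lam"
    have K12: "0 \<le> K1" "0 \<le> K2" unfolding K1_def K2_def using dn[of n] dn[of "Suc n"] lam constants \<alpha>
      by (auto simp del: dconst.simps)
    show "\<exists>K>0. \<forall>f\<in>hoelder_space J \<alpha>. mehler_resolvent T \<mu> lam f \<in> zygmund_space J k \<and>
        zygmund_norm J k (mehler_resolvent T \<mu> lam f) \<le> ennreal K * hoelder_norm J \<alpha> f"
    proof (intro exI[of _ "A n + K1 + K2 + 1"] conjI ballI)
      show "0 < A n + K1 + K2 + 1" using A0[of n] K12 by linarith
      fix f :: "'a \<Rightarrow> real" assume fh: "f \<in> hoelder_space J \<alpha>"
      then have f: "f \<in> bcontfun" by (simp add: hoelder_space_def)
      obtain B where Bf: "0 \<le> B" "sup_norm f = ennreal B" "\<And>x. \<bar>f x\<bar> \<le> B" using sup_normE[OF f] by metis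
      have "J 0 = 0" using embedding(1) by (rule linear_simps(3))
      then obtain b where b: "0 \<le> b" "hoelder_seminorm J \<alpha> f = ennreal b"
          "\<And>x k. \<bar>f (x + J k) - f x\<bar> \<le> b * norm k powr \<alpha>"
        using hoelder_seminormE[OF _ fh] by metis
      interpret smoothing_resolvent T \<mu> J S \<Lambda> \<Gamma> \<theta> lam f B by unfold_locales (fact lam f Bf(3))+
      have z: "\<bar>U hs (x + 2 *\<^sub>R J h) - 2 * U hs (x + J h) + U hs x\<bar> \<le> (K1 * b + K2 * B) * norm h * \<pi> hs"
        if "length hs = n" "h \<noteq> 0" for hs x h
        using hoelder_second_difference[of hs \<alpha> h b x] kn that \<alpha> b by (simp add: K1_def K2_def del: dconst.simps)
      have KB: "0 \<le> K1 * b + K2 * B" using K12 Bf b by simp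
      show "mehler_resolvent T \<mu> lam f \<in> zygmund_space J k"
        unfolding n by (rule resolvent_in_zygmund_space(1)[OF n1 KB z])
      have "zygmund_norm J k (mehler_resolvent T \<mu> lam f) \<le> ennreal (A n * B + (K1 * b + K2 * B))"
        unfolding n A_def by (rule resolvent_in_zygmund_space(2)[OF n1 KB z])
      \<comment> \<open>\<open>B\<close> and \<open>b\<close> are the two summands of the Hoelder
        norm, so the separate constants are merged at the cost of nonnegative cross terms.\<close>
      also have "\<dots> \<le> ennreal ((A n + K1 + K2 + 1) * (B + b))"
        using A0[of n] K12 Bf b by (intro ennreal_leI) (simp add: algebra_simps)
      also have "\<dots> = ennreal (A n + K1 + K2 + 1) * hoelder_norm J \<alpha> f"
        using A0[of n] K12 Bf b by (simp add: ennreal_mult hoelder_norm_def)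
      finally show "zygmund_norm J k (mehler_resolvent T \<mu> lam f) \<le> ennreal (A n + K1 + K2 + 1) * hoelder_norm J \<alpha> f" .
    qed
  qed
qed

end
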